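(* Let $K$ satisfy the kernel assumption. Suppose that (S1), (S2) and (M1) hold with some $q\ge2$ and $0<\alpha\le1$. Then for all $u\in(0,1)$, provided that $n\to\infty$, $b=b_n\to0$, $nb\to\infty$ and $\sqrt{nb}\,n^{-\alpha}\to0$, $$\frac{1}{\sqrt{nb}}\sum_{t=1}^nK\Big(\frac{t/n-u}{b}\Big)\{X_{t,n}-\mathbb{E}X_{t,n}\}\overset{d}{\to}N\Big(0,\int K(x)^2dx\cdot\sigma^2(u)\Big),\qquad\sigma^2(u)=\sum_{k\in\mathbb{Z}}\mathrm{Cov}(\tilde X_0(u),\tilde X_k(u)).$$ Moreover, for $g\in\mathcal{L}_r(M,C)$, the same holds with $X_{t,n}$ replaced by $g(Z_{t,n})$ and $\tilde X_t(u)$ replaced by $g(\tilde Z_t(u))$, if the same assumptions are fulfilled for the process $X_{t,n}$ with $\tilde q=q(M+1)$ instead of $q$.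
   Context: $\|W\|_q:=(\mathbb{E}|W|^q)^{1/q}$. $(X_{t,n})_{t=1,\dots,n}$, $n\in\mathbb{N}$, is a triangular array of real random variables, and for each $u\in[0,1]$, $(\tilde X_t(u))_{t\in\mathbb{Z}}$ is a stationary and ergodic real process on the same probability space. (S1) (exponent $q$) $\sup_{u\in[0,1]}\|\tilde X_t(u)\|_q<\infty$, and there are $0<\alpha\le1$, $C_B>0$ such that uniformly in $t=1,\dots,n$ and $u,v\in[0,1]$: $\|\tilde X_t(u)-\tilde X_t(v)\|_q\le C_B|u-v|^\alpha$ and $\|X_{t,n}-\tilde X_t(t/n)\|_q\le C_Bn^{-\alpha}$. (S2) $u\mapsto\tilde X_t(u)$ is a.s. continuous for all $t\in\mathbb{Z}$ and $\|\sup_{u\in[0,1]}|\tilde X_t(u)|\|_q<\infty$. Dependence measure: $(\varepsilon_t)_{t\in\mathbb{Z}}$ are i.i.d. random variables, $\mathcal{F}_t:=(\varepsilon_t,\varepsilon_{t-1},\dots)$, and $\mathcal{F}_t^{*(t-k)}$ is $\mathcal{F}_t$ with $\varepsilon_{t-k}$ replaced by $\varepsilon_{t-k}^*$, which has the same distribution as $\varepsilon_1$ and is independent of all $\varepsilon_s$. For $W_t=H_t(\mathcal{F}_t)$ with $H_t$ measurable put $W_t^{*(t-k)}:=H_t(\mathcal{F}_t^{*(t-k)})$ and $\delta_q^W(k):=\sup_t\|W_t-W_t^{*(t-k)}\|_q$. (M1) For each $u$ there is a measurable $H(u,\cdot)$ with $\tilde X_t(u)=H(u,\mathcal{F}_t)$,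 and $\sum_{k\ge0}\sup_{u\in[0,1]}\delta_q^{\tilde X(u)}(k)<\infty$. Kernel assumption: $K:\mathbb{R}\to\mathbb{R}$ is bounded, of bounded variation, with compact support $[-\frac12,\frac12]$ and $\int K\,dx=1$. Class $\mathcal{L}_r(M,C)$ ($r\in\mathbb{N}$, $M\ge0$, $C\ge0$): all $g:\mathbb{R}^r\to\mathbb{R}$ with $\sup_{y\ne y'}\frac{|g(y)-g(y')|}{|y-y'|_1(1+|y|_1^M+|y'|_1^M)}\le C$, $|y|_1=\sum_i|y_i|$. $Z_{t,n}:=(X_{t,n},\dots,X_{t-r+1,n})'$, $\tilde Z_t(u):=(\tilde X_t(u),\dots,\tilde X_{t-r+1}(u))'$, with the convention $X_{s,n}:=\tilde X_s(0)$ for $s\le0$. *)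

theory Defs
  imports "HOL-Probability.Probability"
begin

section \<open>Probabilistic notions\<close>

text \<open>The norm \<open>(E |W|^q)^(1/q)\<close>, with value \<open>\<infinity>\<close> if the moment is infinite.\<close>

definition Lq_norm :: "'a measure \<Rightarrow> real \<Rightarrow> ('a \<Rightarrow> real) \<Rightarrow> ennreal" where
  "Lq_norm P q W =
    (let I = (\<integral>\<^sup>+\<omega>. ennreal (\<bar>W \<omega>\<bar> powr q) \<partial>P)
     in if I = \<infinity> then \<infinity> else ennreal (enn2real I powr (1 / q)))"

definition covariance :: "'a measure \<Rightarrow> ('a \<Rightarrow> real) \<Rightarrow> ('a \<Rightarrow> real) \<Rightarrow> real" where
  "covariance P V W =
    integral\<^sup>L P (\<lambda>\<omega>. (V \<omega> - integral\<^sup>L P V) * (W \<omega> - integral\<^sup>L P W))"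

text \<open>Normal law given by mean and variance; it is the point mass when the variance is 0.
  (The library's \<open>normal_density\<close> takes the standard deviation and does not cover this
  degenerate case.)  Only \<open>v \<ge> 0\<close> is meaningful.\<close>

definition normal_law :: "real \<Rightarrow> real \<Rightarrow> real measure" where
  "normal_law m v =
    (if v = 0 then return borel m
     else density lborel (\<lambda>x. ennreal (normal_density m (sqrt v) x)))"

definition stationary_process :: "'a measure \<Rightarrow> (int \<Rightarrow> 'a \<Rightarrow> real) \<Rightarrow> bool" where
  "stationary_process P Y \<longleftrightarrow>
    (\<forall>s. distr P (PiM UNIV (\<lambda>_. borel)) (\<lambda>\<omega> t. Y (t + s) \<omega>) =
         distr P (PiM UNIV (\<lambda>_. borel)) (\<lambda>\<omega> t. Y t \<omega>))"

text \<open>Ergodicity of a stationary process: shift-invariant events of its path space are trivial.\<close>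

definition ergodic_process :: "'a measure \<Rightarrow> (int \<Rightarrow> 'a \<Rightarrow> real) \<Rightarrow> bool" where
  "ergodic_process P Y \<longleftrightarrow>
    (\<forall>A \<in> sets (PiM UNIV (\<lambda>_. borel)).
       {x. (\<lambda>t. x (t + 1)) \<in> A} = A \<longrightarrow>
       measure P {\<omega> \<in> space P. (\<lambda>t. Y t \<omega>) \<in> A} \<in> {0, 1})"


section \<open>Innovations and the functional dependence measure\<close>

text \<open>The innovations \<open>eps t\<close> are i.i.d. with values in a measurable space \<open>E\<close>; each \<open>eps' s\<close> has
  their distribution and is independent of the whole family \<open>eps\<close>, i.e. the generated
  sigma-algebras are independent (\<open>indep_var\<close> only relates variables of the same type).\<close>

definition innovations ::
    "'a measure \<Rightarrow> 'e measure \<Rightarrow> (int \<Rightarrow> 'a \<Rightarrow> 'e) \<Rightarrow> (int \<Rightarrow> 'a \<Rightarrow> 'e) \<Rightarrow> bool" where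
  "innovations P E eps eps' \<longleftrightarrow>
    prob_space.indep_vars P (\<lambda>_. E) eps UNIV \<and>
    (\<forall>t. distr P E (eps t) = distr P E (eps 1)) \<and>
    (\<forall>s. eps' s \<in> measurable P E \<and>
         distr P E (eps' s) = distr P E (eps 1) \<and>
         prob_space.indep_set P
           (sets (vimage_algebra (space P) (eps' s) E))
           (sets (vimage_algebra (space P) (\<lambda>\<omega> t. eps t \<omega>) (PiM UNIV (\<lambda>_. E)))))"

text \<open>Coordinate \<open>j\<close> of the past at time \<open>t\<close> is \<open>eps (t - j)\<close>; so replacing the innovation at time
  \<open>t - k\<close> means updating coordinate \<open>k\<close>.\<close>

definition past :: "(int \<Rightarrow> 'a \<Rightarrow> 'e) \<Rightarrow> int \<Rightarrow> 'a \<Rightarrow> nat \<Rightarrow> 'e" where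
  "past eps t \<omega> = (\<lambda>j. eps (t - int j) \<omega>)"

definition past_star ::
    "(int \<Rightarrow> 'a \<Rightarrow> 'e) \<Rightarrow> (int \<Rightarrow> 'a \<Rightarrow> 'e) \<Rightarrow> nat \<Rightarrow> int \<Rightarrow> 'a \<Rightarrow> nat \<Rightarrow> 'e" where
  "past_star eps eps' k t \<omega> = (past eps t \<omega>)(k := eps' (t - int k) \<omega>)"

text \<open>Dependence measure of the process \<open>W\<^sub>t = G t (past eps t)\<close>.\<close>

definition dep_measure ::
    "'a measure \<Rightarrow> (int \<Rightarrow> 'a \<Rightarrow> 'e) \<Rightarrow> (int \<Rightarrow> 'a \<Rightarrow> 'e) \<Rightarrow> real \<Rightarrow>
     (int \<Rightarrow> (nat \<Rightarrow> 'e) \<Rightarrow> real) \<Rightarrow> nat \<Rightarrow> ennreal" where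
  "dep_measure P eps eps' q G k =
    (SUP t. Lq_norm P q (\<lambda>\<omega>. G t (past eps t \<omega>) - G t (past_star eps eps' k t \<omega>)))"


section \<open>Assumptions\<close>

text \<open>The triangular array is \<open>X t n\<close> (relevant for \<open>1 \<le> t \<le> n\<close>), the stationary approximation at
  rescaled time \<open>u \<in> [0,1]\<close> is \<open>Xst t u\<close>.\<close>

definition assumption_S1 ::
    "'a measure \<Rightarrow> (int \<Rightarrow> nat \<Rightarrow> 'a \<Rightarrow> real) \<Rightarrow> (int \<Rightarrow> real \<Rightarrow> 'a \<Rightarrow> real) \<Rightarrow>
     real \<Rightarrow> real \<Rightarrow> bool" where
  "assumption_S1 P X Xst q \<alpha> \<longleftrightarrow>
    (\<forall>t. (SUP u\<in>{0..1}. Lq_norm P q (Xst t u)) < \<infinity>) \<and>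
    (\<exists>C>0. \<forall>n. \<forall>t\<in>{1..int n}.
       (\<forall>u\<in>{0..1}. \<forall>v\<in>{0..1}.
          Lq_norm P q (\<lambda>\<omega>. Xst t u \<omega> - Xst t v \<omega>) \<le> ennreal (C * \<bar>u - v\<bar> powr \<alpha>)) \<and>
       Lq_norm P q (\<lambda>\<omega>. X t n \<omega> - Xst t (real_of_int t / real n) \<omega>)
         \<le> ennreal (C * real n powr (- \<alpha>)))"

text \<open>The real-valued supremum below is a genuine one on the almost sure event where the path is
  continuous; its values elsewhere do not affect the norm.\<close>

definition assumption_S2 ::
    "'a measure \<Rightarrow> (int \<Rightarrow> real \<Rightarrow> 'a \<Rightarrow> real) \<Rightarrow> real \<Rightarrow> bool" where
  "assumption_S2 P Xst q \<longleftrightarrow>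
    (\<forall>t. (AE \<omega> in P. continuous_on {0..1} (\<lambda>u. Xst t u \<omega>)) \<and>
         Lq_norm P q (\<lambda>\<omega>. SUP u\<in>{0..1}. \<bar>Xst t u \<omega>\<bar>) < \<infinity>)"

text \<open>The representation is an almost sure equality of random variables.\<close>

definition assumption_M1 ::
    "'a measure \<Rightarrow> 'e measure \<Rightarrow> (int \<Rightarrow> 'a \<Rightarrow> 'e) \<Rightarrow> (int \<Rightarrow> 'a \<Rightarrow> 'e) \<Rightarrow>
     (int \<Rightarrow> real \<Rightarrow> 'a \<Rightarrow> real) \<Rightarrow> real \<Rightarrow> bool" where
  "assumption_M1 P E eps eps' Xst q \<longleftrightarrow>
    (\<exists>H :: real \<Rightarrow> (nat \<Rightarrow> 'e) \<Rightarrow> real.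
       (\<forall>u\<in>{0..1}. H u \<in> borel_measurable (PiM UNIV (\<lambda>_. E)) \<and>
          (\<forall>t. AE \<omega> in P. Xst t u \<omega> = H u (past eps t \<omega>))) \<and>
       (\<Sum>k. SUP u\<in>{0..1}. dep_measure P eps eps' q (\<lambda>_. H u) k) < \<infinity>)"

text \<open>Finite total variation on the whole real line.\<close>

definition bounded_variation :: "(real \<Rightarrow> real) \<Rightarrow> bool" where
  "bounded_variation f \<longleftrightarrow>
    (\<exists>V. \<forall>n (x :: nat \<Rightarrow> real). mono x \<longrightarrow> (\<Sum>i<n. \<bar>f (x (Suc i)) - f (x i)\<bar>) \<le> V)"

definition kernel_assumption :: "(real \<Rightarrow> real) \<Rightarrow> bool" where
  "kernel_assumption K \<longleftrightarrow>
    bounded (range K) \<and> bounded_variation K \<and>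
    (\<forall>x. x \<notin> {-1/2..1/2} \<longrightarrow> K x = 0) \<and>
    (LINT x|lborel. K x) = 1"


section \<open>The function class and lagged vectors\<close>

text \<open>Vectors in \<open>r\<close>-dimensional space are the extensional functions on \<open>{..<r}\<close>.\<close>

abbreviation rvec :: "nat \<Rightarrow> (nat \<Rightarrow> real) set" where
  "rvec r \<equiv> {..<r} \<rightarrow>\<^sub>E UNIV"

definition l1_norm :: "nat \<Rightarrow> (nat \<Rightarrow> real) \<Rightarrow> real" where
  "l1_norm r y = (\<Sum>i<r. \<bar>y i\<bar>)"

text \<open>Power of a nonnegative real with the convention that \<open>0\<close> to the power \<open>0\<close> is \<open>1\<close>
  (in the library, \<open>0 powr 0 = 0\<close>).\<close>

definition nonneg_pow :: "real \<Rightarrow> real \<Rightarrow> real" where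
  "nonneg_pow x a = (if a = 0 then 1 else x powr a)"

definition lip_class :: "nat \<Rightarrow> real \<Rightarrow> real \<Rightarrow> ((nat \<Rightarrow> real) \<Rightarrow> real) set" where
  "lip_class r M C =
    {g. \<forall>y\<in>rvec r. \<forall>y'\<in>rvec r. y \<noteq> y' \<longrightarrow>
       \<bar>g y - g y'\<bar> /
         (l1_norm r (\<lambda>i. y i - y' i) *
          (1 + nonneg_pow (l1_norm r y) M + nonneg_pow (l1_norm r y') M)) \<le> C}"

definition Z_array ::
    "(int \<Rightarrow> nat \<Rightarrow> 'a \<Rightarrow> real) \<Rightarrow> (int \<Rightarrow> real \<Rightarrow> 'a \<Rightarrow> real) \<Rightarrow>
     nat \<Rightarrow> int \<Rightarrow> nat \<Rightarrow> 'a \<Rightarrow> nat \<Rightarrow> real" where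
  "Z_array X Xst r t n \<omega> =
    (\<lambda>i\<in>{..<r}. let s = t - int i in if s \<le> 0 then Xst s 0 \<omega> else X s n \<omega>)"

definition Z_stat ::
    "(int \<Rightarrow> real \<Rightarrow> 'a \<Rightarrow> real) \<Rightarrow> nat \<Rightarrow> int \<Rightarrow> real \<Rightarrow> 'a \<Rightarrow> nat \<Rightarrow> real" where
  "Z_stat Xst r t u \<omega> = (\<lambda>i\<in>{..<r}. Xst (t - int i) u \<omega>)"


section \<open>The central limit statement\<close>

definition kernel_sum ::
    "'a measure \<Rightarrow> (real \<Rightarrow> real) \<Rightarrow> (nat \<Rightarrow> real) \<Rightarrow> real \<Rightarrow>
     (int \<Rightarrow> nat \<Rightarrow> 'a \<Rightarrow> real) \<Rightarrow> nat \<Rightarrow> 'a \<Rightarrow> real" where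
  "kernel_sum P K b u W n \<omega> =
    1 / sqrt (real n * b n) *
    (\<Sum>t = 1..int n. K ((real_of_int t / real n - u) / b n) *
                     (W t n \<omega> - integral\<^sup>L P (W t n)))"

definition long_run_variance :: "'a measure \<Rightarrow> (int \<Rightarrow> 'a \<Rightarrow> real) \<Rightarrow> real" where
  "long_run_variance P Y = (\<Sum>\<^sub>\<infinity>k\<in>UNIV. covariance P (Y 0) (Y k))"

text \<open>The first two conjuncts say that the long-run variance is a convergent series and a
  legitimate variance; without them \<open>infsum\<close> and \<open>normal_law\<close> could take default values.\<close>

definition local_clt ::
    "'a measure \<Rightarrow> (real \<Rightarrow> real) \<Rightarrow> (nat \<Rightarrow> real) \<Rightarrow> real \<Rightarrow>
     (int \<Rightarrow> nat \<Rightarrow> 'a \<Rightarrow> real) \<Rightarrow> (int \<Rightarrow> 'a \<Rightarrow> real) \<Rightarrow> bool" where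
  "local_clt P K b u W Y \<longleftrightarrow>
    (\<lambda>k. covariance P (Y 0) (Y k)) summable_on UNIV \<and>
    0 \<le> long_run_variance P Y \<and>
    weak_conv_m
      (\<lambda>n. distr P borel (kernel_sum P K b u W n))
      (normal_law 0 ((LINT x|lborel. (K x)\<^sup>2) * long_run_variance P Y))"

end

theory Submission
  imports Defs
begin

text \<open>The innovations are transported to product spaces with identical factors, where replacing
  them by independent copies is a reindexing of coordinates.  Resampling the coordinates one at a
  time yields \<open>\<bar>Cov (f, g)\<bar> \<le> \<Sum>i. infl f i * infl g i\<close>, so a weighted sum of causal variables is controlled
  in \<open>L\<^sup>2\<close> by its weights and the summed influences of its terms; an influence is at most \<open>2 * \<delta> k\<close> by
  assumption and at most twice the \<open>L\<^sup>2\<close> norm of the term, which makes these sums small for small terms.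
  This is used twice: to freeze the process at time \<open>u\<close>, and to replace, in each block of fixed
  length \<open>L\<close>, the innovations that precede the block by fresh copies.  The blocks then are i.i.d., bounded
  variation of the kernel makes the weights constant on blocks, and the characteristic functions of weighted
  i.i.d. sums converge; finally \<open>L\<close> tends to infinity.\<close>

section \<open>Square integrable functions\<close>

text \<open>Since q = 2 is allowed, only second moments are at hand, and the dependence has no rate
  of decay beyond summability; smallness therefore has to come from dominated convergence. Bounding
  all errors term by term does not suffice either: the absolute weights add up to order sqrt(n b),
  and freezing changes a single term by order b^\<alpha>, a product that need not vanish. The
  covariance inequality brings in the squared weights instead, whose sum stays bounded. Only the
  distance between the array and its stationary approximation is summed term by term, and the
  condition on sqrt(n b) n^(-\<alpha>) pays for it. Blocks need no gaps between them: the error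
  caused by a resampled past depends only on the position within the block and fades towards its
  end, so its average over the block vanishes as \<open>L\<close> grows. The statement on
  \<open>X\<close> itself is the case of the coordinate projection, with r = 1 and M = 0.\<close>

definition L2 :: "'a measure \<Rightarrow> ('a \<Rightarrow> real) set" where
  "L2 M = {f \<in> borel_measurable M. integrable M (\<lambda>x. (f x)\<^sup>2)}"

definition norm2 :: "'a measure \<Rightarrow> ('a \<Rightarrow> real) \<Rightarrow> real" where
  "norm2 M f = sqrt (\<integral>x. (f x)\<^sup>2 \<partial>M)"

lemma L2_measurable[measurable_dest]: "f \<in> L2 M \<Longrightarrow> f \<in> borel_measurable M"
  by (simp add: L2_def)

lemma L2_square_integrable: "f \<in> L2 M \<Longrightarrow> integrable M (\<lambda>x. (f x)\<^sup>2)"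
  by (simp add: L2_def)

lemma norm2_nonneg[simp]: "0 \<le> norm2 M f"
  by (simp add: norm2_def)

lemma norm2_square: "(norm2 M f)\<^sup>2 = (\<integral>x. (f x)\<^sup>2 \<partial>M)"
  by (simp add: norm2_def)

lemma L2_mult_integrable:
  assumes "f \<in> L2 M" "g \<in> L2 M"
  shows "integrable M (\<lambda>x. f x * g x)"
proof (rule Bochner_Integration.integrable_bound)
  show "integrable M (\<lambda>x. (f x)\<^sup>2 + (g x)\<^sup>2)"
    using assms by (auto intro: L2_square_integrable)
  show "(\<lambda>x. f x * g x) \<in> borel_measurable M"
    using assms by measurable
  have "\<bar>a * b\<bar> \<le> a\<^sup>2 + b\<^sup>2" for a b :: real
  proof -
    have "2 * \<bar>a\<bar> * \<bar>b\<bar> \<le> a\<^sup>2 + b\<^sup>2"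
      using sum_squares_bound[of "\<bar>a\<bar>" "\<bar>b\<bar>"] by simp
    moreover have "0 \<le> \<bar>a\<bar> * \<bar>b\<bar>" by simp
    ultimately show ?thesis unfolding abs_mult by linarith
  qed
  then show "AE x in M. norm (f x * g x) \<le> norm ((f x)\<^sup>2 + (g x)\<^sup>2)"
    by simp
qed

lemma L2_add:
  assumes "f \<in> L2 M" "g \<in> L2 M"
  shows "(\<lambda>x. f x + g x) \<in> L2 M"
proof -
  have "integrable M (\<lambda>x. (f x)\<^sup>2 + 2 * (f x * g x) + (g x)\<^sup>2)"
    using assms L2_mult_integrable[OF assms] by (intro Bochner_Integration.integrable_add integrable_mult_right L2_square_integrable)
  moreover have "(\<lambda>x. f x + g x) \<in> borel_measurable M"
    using assms by measurable
  ultimately show ?thesis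
    by (simp add: L2_def power2_sum algebra_simps)
qed

lemma L2_cmult: "f \<in> L2 M \<Longrightarrow> (\<lambda>x. c * f x) \<in> L2 M"
  by (auto simp: L2_def power_mult_distrib)

lemma L2_diff: "f \<in> L2 M \<Longrightarrow> g \<in> L2 M \<Longrightarrow> (\<lambda>x. f x - g x) \<in> L2 M"
  using L2_add[of f M "\<lambda>x. (-1) * g x"] L2_cmult[of g M "-1"] by simp

lemma L2_zero: "(\<lambda>x. 0) \<in> L2 M"
  by (simp add: L2_def)

lemma L2_sum: "(\<And>t. t \<in> T \<Longrightarrow> f t \<in> L2 M) \<Longrightarrow> (\<lambda>x. \<Sum>t\<in>T. f t x) \<in> L2 M"
  by (induction T rule: infinite_finite_induct) (auto simp: L2_zero intro: L2_add)

lemma (in finite_measure) L2_const: "(\<lambda>x. c) \<in> L2 M"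
  by (simp add: L2_def)

lemma (in finite_measure) L2_integrable: "f \<in> L2 M \<Longrightarrow> integrable M f"
  using L2_mult_integrable[OF _ L2_const[of 1]] by simp

lemma L2_Cauchy_Schwarz:
  assumes "f \<in> L2 M" "g \<in> L2 M"
  shows "\<bar>\<integral>x. f x * g x \<partial>M\<bar> \<le> norm2 M f * norm2 M g"
proof -
  define a b c where "a = (\<integral>x. (f x)\<^sup>2 \<partial>M)" and "b = (\<integral>x. (g x)\<^sup>2 \<partial>M)" and "c = (\<integral>x. f x * g x \<partial>M)"
  note [simp] = L2_square_integrable[OF assms(1)] L2_square_integrable[OF assms(2)] L2_mult_integrable[OF assms]
  have q: "0 \<le> a + 2 * t * c + t\<^sup>2 * b" for t
  proof -
    have "0 \<le> (\<integral>x. (f x + t * g x)\<^sup>2 \<partial>M)" by simp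
    also have "\<dots> = (\<integral>x. (f x)\<^sup>2 + (2 * t) * (f x * g x) + t\<^sup>2 * (g x)\<^sup>2 \<partial>M)"
      by (rule Bochner_Integration.integral_cong) (auto simp: power2_eq_square algebra_simps)
    also have "\<dots> = a + 2 * t * c + t\<^sup>2 * b"
      by (simp add: a_def b_def c_def)
    finally show ?thesis .
  qed
  have b0: "0 \<le> b" by (simp add: b_def)
  have "c\<^sup>2 \<le> a * b"
  proof (cases "b = 0")
    case True
    have "c = 0"
    proof (rule ccontr)
      assume "c \<noteq> 0"
      \<comment> \<open>For \<open>b = 0\<close> the quadratic is affine in \<open>t\<close>, and
        this \<open>t\<close> gives it the value -1.\<close>
      then have "0 \<le> a + (- (2 * a) - 2) / 2" using q[of "- (a + 1) / (2 * c)"] True by simp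
      then show False by (simp add: field_simps)
    qed
    then show ?thesis using True by simp
  next
    case False
    then have "a - c\<^sup>2 / b \<ge> 0" using q[of "- c / b"] by (simp add: power2_eq_square)
    then show ?thesis using b0 False by (simp add: field_simps)
  qed
  then have "\<bar>c\<bar> \<le> sqrt (a * b)" by (simp add: real_le_rsqrt)
  then show ?thesis by (simp add: norm2_def a_def b_def c_def real_sqrt_mult)
qed

lemma norm2_cmult: "norm2 M (\<lambda>x. c * f x) = \<bar>c\<bar> * norm2 M f"
  by (simp add: norm2_def power_mult_distrib real_sqrt_mult)

lemma norm2_zero[simp]: "norm2 M (\<lambda>x. 0) = 0"
  by (simp add: norm2_def)

lemma norm2_add:
  assumes "f \<in> L2 M" "g \<in> L2 M"
  shows "norm2 M (\<lambda>x. f x + g x) \<le> norm2 M f + norm2 M g"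
proof -
  have "(norm2 M (\<lambda>x. f x + g x))\<^sup>2 = (\<integral>x. (f x)\<^sup>2 + 2 * (f x * g x) + (g x)\<^sup>2 \<partial>M)"
    unfolding norm2_square by (rule Bochner_Integration.integral_cong) (auto simp: power2_eq_square algebra_simps)
  also have "\<dots> = (norm2 M f)\<^sup>2 + 2 * (\<integral>x. f x * g x \<partial>M) + (norm2 M g)\<^sup>2"
    using assms by (simp add: L2_square_integrable L2_mult_integrable norm2_square)
  also have "\<dots> \<le> (norm2 M f + norm2 M g)\<^sup>2"
    using L2_Cauchy_Schwarz[OF assms] by (simp add: power2_sum)
  finally show ?thesis by (rule power2_le_imp_le) simp
qed

lemma norm2_diff:
  assumes "f \<in> L2 M" "g \<in> L2 M"
  shows "norm2 M (\<lambda>x. f x - g x) \<le> norm2 M f + norm2 M g"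
  using norm2_add[OF assms(1) L2_cmult[OF assms(2), of "-1"]] norm2_cmult[of M "-1" g] by simp

lemma norm2_sum:
  "(\<And>t. t \<in> T \<Longrightarrow> f t \<in> L2 M) \<Longrightarrow> norm2 M (\<lambda>x. \<Sum>t\<in>T. f t x) \<le> (\<Sum>t\<in>T. norm2 M (f t))"
proof (induction T rule: infinite_finite_induct)
  case (insert t T)
  have "norm2 M (\<lambda>x. f t x + (\<Sum>t\<in>T. f t x)) \<le> norm2 M (f t) + norm2 M (\<lambda>x. \<Sum>t\<in>T. f t x)"
    by (intro norm2_add L2_sum) (use insert in auto)
  with insert show ?case by fastforce
qed auto

lemma (in prob_space) L1_le_norm2:
  assumes "f \<in> L2 M"
  shows "(\<integral>x. \<bar>f x\<bar> \<partial>M) \<le> norm2 M f"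
proof -
  have "(\<lambda>x. \<bar>f x\<bar>) \<in> L2 M" using assms by (auto simp: L2_def)
  from L2_Cauchy_Schwarz[OF this L2_const[of 1]] show ?thesis
    by (simp add: norm2_def prob_space)
qed

lemma (in prob_space) norm2_centered_le:
  assumes "f \<in> L2 M"
  shows "norm2 M (\<lambda>x. f x - expectation f) \<le> norm2 M f"
proof -
  have "(norm2 M (\<lambda>x. f x - expectation f))\<^sup>2 = variance f" by (simp add: norm2_square)
  also have "\<dots> = expectation (\<lambda>x. (f x)\<^sup>2) - (expectation f)\<^sup>2"
    using assms by (intro variance_eq L2_integrable L2_square_integrable)
  also have "\<dots> \<le> (norm2 M f)\<^sup>2" by (simp add: norm2_square)
  finally show ?thesis by (rule power2_le_imp_le) simp
qed

lemma L2_distr: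
  assumes "T \<in> measurable M N" "f \<in> borel_measurable N"
  shows "f \<in> L2 (distr M N T) \<longleftrightarrow> (\<lambda>x. f (T x)) \<in> L2 M"
  using assms by (auto simp: L2_def integrable_distr_eq)

lemma norm2_distr:
  assumes "T \<in> measurable M N" "f \<in> borel_measurable N"
  shows "norm2 (distr M N T) f = norm2 M (\<lambda>x. f (T x))"
  using assms by (simp add: norm2_def integral_distr)


section \<open>Product spaces with identical factors\<close>

abbreviation iid :: "'e measure \<Rightarrow> ('i \<Rightarrow> 'e) measure" where
  "iid N \<equiv> Pi\<^sub>M UNIV (\<lambda>_. N)"

lemma measurable_reindex: "(\<lambda>z i. z (h i)) \<in> measurable (iid N) (iid N)"
  by (rule measurable_PiM_single') (auto simp: space_PiM)

lemma measurable_compose_reindex: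
  "f \<in> measurable (iid N) L \<Longrightarrow> (\<lambda>z. f (\<lambda>i. z (h i))) \<in> measurable (iid N) L"
  by (rule measurable_compose[OF measurable_reindex])

text \<open>The flag of a coordinate tells the two independent copies of an innovation apart.\<close>

definition mix :: "'i set \<Rightarrow> ('i \<times> bool \<Rightarrow> 'e) \<Rightarrow> 'i \<Rightarrow> 'e" where
  "mix J z = (\<lambda>i. z (i, i \<in> J))"

lemma inj_pair_left: "inj (\<lambda>i. (i, p i))"
  by (auto intro: injI)

lemma measurable_mix[measurable]: "mix J \<in> measurable (iid N) (iid N)"
  unfolding mix_def[abs_def] by (rule measurable_reindex)

context prob_space
begin

lemma prob_space_iid: "prob_space (iid M)"
  by (intro prob_space_PiM prob_space_axioms)

text \<open>Distinct coordinates of an i.i.d. family are i.i.d. again. \<open>h\<close> need not be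
  onto, so this one fact covers the shifts, the selection of subfamilies and the passage to
  independent copies used throughout.\<close>

lemma reindex: "inj h \<Longrightarrow> distr (iid M) (iid M) (\<lambda>z i. z (h i)) = iid M"
  using distr_PiM_reindex[of UNIV "\<lambda>_. M" h UNIV] prob_space_axioms by (simp add: restrict_def)

lemma L2_reindex: "inj h \<Longrightarrow> f \<in> L2 (iid M) \<Longrightarrow> (\<lambda>z. f (\<lambda>i. z (h i))) \<in> L2 (iid M)"
  using L2_distr[OF measurable_reindex[of h M], of f] reindex[of h] by (simp add: L2_measurable)

lemma norm2_reindex:
  "inj h \<Longrightarrow> f \<in> borel_measurable (iid M) \<Longrightarrow> norm2 (iid M) (\<lambda>z. f (\<lambda>i. z (h i))) = norm2 (iid M) f"
  using norm2_distr[OF measurable_reindex[of h M], of f] reindex[of h] by simp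

lemma integral_reindex:
  fixes f :: "_ \<Rightarrow> 'b::{banach, second_countable_topology}"
  shows "inj h \<Longrightarrow> f \<in> borel_measurable (iid M) \<Longrightarrow>
    (\<integral>z. f (\<lambda>i. z (h i)) \<partial>iid M) = (\<integral>z. f z \<partial>iid M)"
  using integral_distr[OF measurable_reindex[of h M], of f] reindex[of h] by simp

lemma measure_reindex:
  "inj h \<Longrightarrow> A \<in> sets (iid M) \<Longrightarrow>
    measure (iid M) {z \<in> space (iid M). (\<lambda>i. z (h i)) \<in> A} = measure (iid M) A"
  using measure_distr[OF measurable_reindex[of h M], of A] reindex[of h]
  by (simp add: vimage_def Int_def conj_commute)

lemma integrable_reindex:
  fixes f :: "_ \<Rightarrow> 'b::{banach, second_countable_topology}"
  shows "inj h \<Longrightarrow> integrable (iid M) f \<Longrightarrow> integrable (iid M) (\<lambda>z. f (\<lambda>i. z (h i)))"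
  using integrable_distr[OF measurable_reindex[of h M], of f] reindex[of h] by simp

lemma integrable_mix:
  fixes f :: "_ \<Rightarrow> 'b::{banach, second_countable_topology}"
  shows "integrable (iid M) f \<Longrightarrow> integrable (iid M) (\<lambda>z. f (mix J z))"
  using integrable_reindex[OF inj_pair_left, of f "\<lambda>i. i \<in> J"] by (simp add: mix_def)

text \<open>\<open>mix J\<close> and \<open>mix UNIV\<close> agree on the coordinates in
  \<open>J\<close> and read independent copies elsewhere, so a small discrepancy means that the
  event is nearly determined by finitely many coordinates. The induction follows the generation of
  the product sigma-algebra; having the bound for all supersets of \<open>J0\<close> is what allows
  finitely many such sets to be merged.\<close>

lemma resample_sets:
  fixes A :: "('i \<Rightarrow> 'a) set"
  assumes "A \<in> sets (iid M)" "0 < e"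
  shows "\<exists>J0. finite J0 \<and> (\<forall>J. J0 \<subseteq> J \<longrightarrow>
    measure (iid M) {z \<in> space (iid M). (mix J z \<in> A) \<noteq> (mix UNIV z \<in> A)} < e)"
proof -
  interpret I: prob_space "iid M :: ('i \<times> bool \<Rightarrow> 'a) measure" by (rule prob_space_iid)
  interpret I1: prob_space "iid M :: ('i \<Rightarrow> 'a) measure" by (rule prob_space_iid)
  let ?D = "\<lambda>J A. {z \<in> space (iid M). (mix J z \<in> A) \<noteq> (mix UNIV z \<in> (A :: ('i \<Rightarrow> 'a) set))}"
  have mixsp: "mix J z \<in> space (iid M)" if "z \<in> space (iid M)" for J :: "'i set" and z
    using measurable_space[OF measurable_mix that] .
  have Dm[measurable]: "?D J A \<in> sets (iid M)" if "A \<in> sets (iid M)" for J A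
  proof -
    have [measurable]: "A \<in> sets (iid M)" by fact
    show ?thesis by measurable
  qed
  have "A \<in> sigma_sets (space (iid M)) (prod_algebra UNIV (\<lambda>_. M))"
    using assms(1) by (simp add: sets_PiM space_PiM)
  then show ?thesis using assms(2)
  proof (induction arbitrary: e)
    case (Basic A)
    from Basic(1) obtain J E where J: "finite J" "A = prod_emb UNIV (\<lambda>_. M) J (Pi\<^sub>E J E)"
      by (auto elim!: prod_algebraE)
    \<comment> \<open>A cylinder over \<open>J\<close> is decided by the shared coordinates, so the
      discrepancy is empty and not merely small.\<close>
    have D0: "?D J' A = {}" if "J \<subseteq> J'" for J'
    proof -
      have "mix J' z \<in> A \<longleftrightarrow> mix UNIV z \<in> A" if z: "z \<in> space (iid M)" for z
      proof -
        have "restrict (mix J' z) J = restrict (mix UNIV z) J"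
          using \<open>J \<subseteq> J'\<close> by (auto simp: mix_def fun_eq_iff restrict_def subset_iff)
        then show ?thesis using mixsp[OF z, of J'] mixsp[OF z, of UNIV]
          by (simp add: J(2) prod_emb_iff space_PiM PiE_iff)
      qed
      then show ?thesis by auto
    qed
    show ?case
    proof (intro exI[of _ J] conjI allI impI J(1))
      fix J' assume "J \<subseteq> J'"
      then show "measure (iid M) (?D J' A) < e" unfolding D0[OF \<open>J \<subseteq> J'\<close>] using Basic.prems by simp
    qed
  next
    case Empty
    then show ?case by auto
  next
    case (Compl A)
    have "?D J (space (iid M) - A) = ?D J A" for J
      using mixsp by auto
    then show ?case using Compl by simp
  next
    case (Union A)
    have A[measurable]: "A i \<in> sets (iid M)" for i
      using Union.hyps by (simp add: sets_PiM space_PiM)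
    have "(\<lambda>n. measure (iid M) (\<Union>i<n. A i)) \<longlonglongrightarrow> measure (iid M) (\<Union>n. \<Union>i<n. A i)"
      by (intro I1.finite_Lim_measure_incseq) (auto simp: incseq_def intro: less_le_trans)
    also have "(\<Union>n. \<Union>i<n. A i) = (\<Union>i. A i)" by auto
    finally have "\<forall>\<^sub>F n in sequentially. dist (measure (iid M) (\<Union>i<n. A i)) (measure (iid M) (\<Union>i. A i)) < e / 4"
      using \<open>0 < e\<close> by (intro tendstoD) auto
    then obtain n where n: "dist (measure (iid M) (\<Union>i<n. A i)) (measure (iid M) (\<Union>i. A i)) < e / 4"
      by (auto simp: eventually_sequentially)
    \<comment> \<open>The tail of the union enters once through \<open>mix J\<close> and once
      through \<open>mix UNIV\<close>, hence e / 4. The other half of \<open>e\<close> is shared by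
      the \<open>n\<close> initial sets, with n + 1 in the denominator to allow n = 0.\<close>
    define R where "R = (\<Union>i. A i) - (\<Union>i<n. A i)"
    have R[measurable]: "R \<in> sets (iid M)" unfolding R_def by measurable
    have "measure (iid M) R = measure (iid M) (\<Union>i. A i) - measure (iid M) (\<Union>i<n. A i)"
      unfolding R_def by (intro I1.finite_measure_Diff) auto
    then have mR: "measure (iid M) R < e / 4"
      using n by (simp add: dist_real_def abs_real_def split: if_splits)
    have RJ: "measure (iid M) {z \<in> space (iid M). mix J z \<in> R} < e / 4" for J
      using measure_reindex[OF inj_pair_left R, of "\<lambda>i. i \<in> J"] mR by (simp add: mix_def)
    have "\<forall>i. \<exists>J0. finite J0 \<and> (\<forall>J. J0 \<subseteq> J \<longrightarrow> measure (iid M) (?D J (A i)) < e / (2 * (real n + 1)))"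
      using \<open>0 < e\<close> by (intro allI Union.IH) auto
    from choice[OF this] obtain J0 where J0': "\<forall>i. finite (J0 i) \<and>
        (\<forall>J. J0 i \<subseteq> J \<longrightarrow> measure (iid M) (?D J (A i)) < e / (2 * (real n + 1)))" by blast
    then have J0: "\<And>i. finite (J0 i)"
      "\<And>i J. J0 i \<subseteq> J \<Longrightarrow> measure (iid M) (?D J (A i)) < e / (2 * (real n + 1))"
      by blast+
    show ?case
    proof (intro exI[of _ "\<Union>i<n. J0 i"] conjI allI impI)
      show "finite (\<Union>i<n. J0 i)" using J0(1) by auto
      fix J assume J: "(\<Union>i<n. J0 i) \<subseteq> J"
      have "measure (iid M) (?D J (\<Union>i. A i)) \<le> measure (iid M) ((\<Union>i<n. ?D J (A i)) \<union>
          ({z \<in> space (iid M). mix J z \<in> R} \<union> {z \<in> space (iid M). mix UNIV z \<in> R}))"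
        by (intro I.finite_measure_mono) (auto simp: R_def)
      also have "\<dots> \<le> measure (iid M) (\<Union>i<n. ?D J (A i)) +
          measure (iid M) ({z \<in> space (iid M). mix J z \<in> R} \<union> {z \<in> space (iid M). mix UNIV z \<in> R})"
        by (intro measure_Un_le) auto
      also have "\<dots> \<le> (\<Sum>i<n. measure (iid M) (?D J (A i))) +
          (measure (iid M) {z \<in> space (iid M). mix J z \<in> R} + measure (iid M) {z \<in> space (iid M). mix UNIV z \<in> R})"
        by (intro add_mono measure_Un_le measure_UNION_le) auto
      also have "(\<Sum>i<n. measure (iid M) (?D J (A i))) \<le> (\<Sum>i<n. e / (2 * (real n + 1)))"
      proof (rule sum_mono)
        fix i assume "i \<in> {..<n}"
        then have "J0 i \<subseteq> J" using J by blast
        then show "measure (iid M) (?D J (A i)) \<le> e / (2 * (real n + 1))" by (rule less_imp_le[OF J0(2)])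
      qed
      also have "(\<Sum>i<n. e / (2 * (real n + 1))) \<le> e / 2"
        using \<open>0 < e\<close> by (simp add: field_simps)
      finally show "measure (iid M) (?D J (\<Union>i. A i)) < e"
        using RJ[of J] RJ[of UNIV] by simp
    qed
  qed
qed

lemma resample_L1:
  fixes f :: "('i \<Rightarrow> 'a) \<Rightarrow> real"
  assumes "integrable (iid M) f" "0 < e"
  shows "\<exists>J0. finite J0 \<and> (\<forall>J. J0 \<subseteq> J \<longrightarrow> (\<integral>z. \<bar>f (mix J z) - f (mix UNIV z)\<bar> \<partial>iid M) < e)"
  using assms
proof (induction arbitrary: e rule: integrable_induct)
  case (base A c)
  interpret I: prob_space "iid M :: ('i \<times> bool \<Rightarrow> 'a) measure" by (rule prob_space_iid)
  have [measurable]: "A \<in> sets (iid M)" by fact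
  have "0 < e / (\<bar>c\<bar> + 1)" using base.prems by simp
  from resample_sets[OF base(1) this] obtain J0 where J0: "finite J0" "\<And>J. J0 \<subseteq> J \<Longrightarrow>
    measure (iid M) {z \<in> space (iid M). (mix J z \<in> A) \<noteq> (mix UNIV z \<in> A)} < e / (\<bar>c\<bar> + 1)" by blast
  show ?case
  proof (intro exI[of _ J0] conjI allI impI J0(1))
    fix J assume J: "J0 \<subseteq> J"
    let ?D = "{z \<in> space (iid M). (mix J z \<in> A) \<noteq> (mix UNIV z \<in> A)}"
    have "(\<integral>z. \<bar>indicator A (mix J z) *\<^sub>R c - indicator A (mix UNIV z) *\<^sub>R c\<bar> \<partial>iid M) =
        (\<integral>z. \<bar>c\<bar> * indicator ?D z \<partial>iid M)"
      by (intro Bochner_Integration.integral_cong) (auto simp: indicator_def)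
    also have "\<dots> = \<bar>c\<bar> * measure (iid M) ?D" by simp
    also have "\<dots> \<le> \<bar>c\<bar> * (e / (\<bar>c\<bar> + 1))"
      using J0(2)[OF J] by (intro mult_left_mono) auto
    also have "\<dots> < e" using base.prems by (simp add: field_simps)
    finally show "(\<integral>z. \<bar>indicator A (mix J z) *\<^sub>R c - indicator A (mix UNIV z) *\<^sub>R c\<bar> \<partial>iid M) < e" .
  qed
next
  case (add f g)
  have e2: "0 < e / 2" using add.prems by simp
  obtain J1 where J1: "finite J1" "\<And>J. J1 \<subseteq> J \<Longrightarrow> (\<integral>z. \<bar>f (mix J z) - f (mix UNIV z)\<bar> \<partial>iid M) < e / 2"
    using add.IH(1)[OF e2] by blast
  obtain J2 where J2: "finite J2" "\<And>J. J2 \<subseteq> J \<Longrightarrow> (\<integral>z. \<bar>g (mix J z) - g (mix UNIV z)\<bar> \<partial>iid M) < e / 2"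
    using add.IH(2)[OF e2] by blast
  have i: "integrable (iid M) (\<lambda>z. f (mix J z))" "integrable (iid M) (\<lambda>z. g (mix J z))" for J
    by (intro integrable_mix add.hyps)+
  show ?case
  proof (intro exI[of _ "J1 \<union> J2"] conjI allI impI)
    fix J assume "J1 \<union> J2 \<subseteq> J"
    have "(\<integral>z. \<bar>f (mix J z) + g (mix J z) - (f (mix UNIV z) + g (mix UNIV z))\<bar> \<partial>iid M) \<le>
        (\<integral>z. \<bar>f (mix J z) - f (mix UNIV z)\<bar> + \<bar>g (mix J z) - g (mix UNIV z)\<bar> \<partial>iid M)"
      using i by (intro integral_mono) auto
    also have "\<dots> = (\<integral>z. \<bar>f (mix J z) - f (mix UNIV z)\<bar> \<partial>iid M) + (\<integral>z. \<bar>g (mix J z) - g (mix UNIV z)\<bar> \<partial>iid M)"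
      using i by simp
    also have "\<dots> < e" using J1(2)[of J] J2(2)[of J] \<open>J1 \<union> J2 \<subseteq> J\<close> by auto
    finally show "(\<integral>z. \<bar>f (mix J z) + g (mix J z) - (f (mix UNIV z) + g (mix UNIV z))\<bar> \<partial>iid M) < e" .
  qed (use J1(1) J2(1) in simp)
next
  case (lim f s)
  have sf: "integrable (iid M) (\<lambda>x. \<bar>s i x - f x\<bar>)" for i using lim by auto
  have "(\<lambda>i. \<integral>x. \<bar>s i x - f x\<bar> \<partial>iid M) \<longlonglongrightarrow> (\<integral>x. 0 \<partial>(iid M :: ('i \<Rightarrow> 'a) measure))"
  \<comment> \<open>The approximating functions satisfy |s i x| <= 2 |f x|, which accounts for the
    factor 3.\<close>
  proof (rule integral_dominated_convergence[where w="\<lambda>x. 3 * \<bar>f x\<bar>"])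
    show "AE x in iid M. (\<lambda>i. \<bar>s i x - f x\<bar>) \<longlonglongrightarrow> 0"
    proof (rule AE_I2)
      fix x :: "'i \<Rightarrow> 'a" assume "x \<in> space (iid M)"
      then have "(\<lambda>i. s i x - f x) \<longlonglongrightarrow> 0" using lim(2) LIM_zero by blast
      then show "(\<lambda>i. \<bar>s i x - f x\<bar>) \<longlonglongrightarrow> 0" by (rule tendsto_rabs_zero)
    qed
    show "AE x in iid M. norm \<bar>s i x - f x\<bar> \<le> 3 * \<bar>f x\<bar>" for i
    proof (rule AE_I2)
      fix x :: "'i \<Rightarrow> 'a" assume "x \<in> space (iid M)"
      from lim(3)[OF this, of i] show "norm \<bar>s i x - f x\<bar> \<le> 3 * \<bar>f x\<bar>" by simp
    qed
  qed (use lim sf in auto)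
  then have "\<forall>\<^sub>F i in sequentially. (\<integral>x. \<bar>s i x - f x\<bar> \<partial>iid M) < e / 3"
    using lim.prems by (intro order_tendstoD(2)[of _ 0]) auto
  then obtain i where i: "(\<integral>x. \<bar>s i x - f x\<bar> \<partial>iid M) < e / 3"
    by (auto simp: eventually_sequentially)
  have e3: "0 < e / 3" using lim.prems by simp
  obtain J0 where
    J0: "finite J0" "\<And>J. J0 \<subseteq> J \<Longrightarrow> (\<integral>z. \<bar>s i (mix J z) - s i (mix UNIV z)\<bar> \<partial>iid M) < e / 3"
    using lim.IH[OF e3, of i] by blast
  have sfJ: "(\<integral>z. \<bar>s i (mix J z) - f (mix J z)\<bar> \<partial>iid M) < e / 3" for J
    using i integral_reindex[OF inj_pair_left, of "\<lambda>x. \<bar>s i x - f x\<bar>" "\<lambda>i. i \<in> J"] sf[of i]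
    by (simp add: mix_def)
  have int: "integrable (iid M) (\<lambda>z. f (mix J z))" "integrable (iid M) (\<lambda>z. s i (mix J z))" for J
    by (intro integrable_mix lim.hyps)+
  show ?case
  proof (intro exI[of _ J0] conjI allI impI J0(1))
    fix J assume J: "J0 \<subseteq> J"
    have "(\<integral>z. \<bar>f (mix J z) - f (mix UNIV z)\<bar> \<partial>iid M) \<le>
        (\<integral>z. \<bar>s i (mix J z) - f (mix J z)\<bar> + \<bar>s i (mix J z) - s i (mix UNIV z)\<bar> +
          \<bar>s i (mix UNIV z) - f (mix UNIV z)\<bar> \<partial>iid M)"
      using int by (intro integral_mono) auto
    also have "\<dots> = (\<integral>z. \<bar>s i (mix J z) - f (mix J z)\<bar> \<partial>iid M) + (\<integral>z. \<bar>s i (mix J z) - s i (mix UNIV z)\<bar> \<partial>iid M) +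
          (\<integral>z. \<bar>s i (mix UNIV z) - f (mix UNIV z)\<bar> \<partial>iid M)"
      using int by simp
    also have "\<dots> < e" using sfJ[of J] sfJ[of UNIV] J0(2)[OF J] by simp
    finally show "(\<integral>z. \<bar>f (mix J z) - f (mix UNIV z)\<bar> \<partial>iid M) < e" .
  qed
qed

end

section \<open>Influences and the covariance inequality\<close>

text \<open>Coordinate \<open>None\<close> is the independent copy that replaces coordinate \<open>i\<close>.\<close>

definition infl :: "'e measure \<Rightarrow> (('i \<Rightarrow> 'e) \<Rightarrow> real) \<Rightarrow> 'i \<Rightarrow> real" where
  "infl N f i =
    norm2 (iid N) (\<lambda>z. f (\<lambda>j. z (Some j)) - f (\<lambda>j. z (if j = i then None else Some j)))"

lemma infl_nonneg[simp]: "0 \<le> infl N f i"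
  by (simp add: infl_def)

lemma infl_minus_const: "infl N (\<lambda>z. f z - c) i = infl N f i"
  by (simp add: infl_def)

lemma infl_cmult: "infl N (\<lambda>z. c * f z) i = \<bar>c\<bar> * infl N f i"
proof -
  have "infl N (\<lambda>z. c * f z) i =
    norm2 (iid N) (\<lambda>z. c * (f (\<lambda>j. z (Some j)) - f (\<lambda>j. z (if j = i then None else Some j))))"
    by (simp add: infl_def right_diff_distrib)
  then show ?thesis by (simp add: norm2_cmult infl_def)
qed

context prob_space
begin

lemma inj_upd: "inj (\<lambda>j. if j = i then None else Some j)"
  by (auto intro!: injI split: if_splits)

lemma L2_infl:
  assumes "f \<in> L2 (iid M)"
  shows "(\<lambda>z. f (\<lambda>j. z (Some j))) \<in> L2 (iid M)"
    "(\<lambda>z. f (\<lambda>j. z (if j = i then None else Some j))) \<in> L2 (iid M)"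
  by (rule L2_reindex[OF _ assms], simp) (rule L2_reindex[OF inj_upd assms])

lemma infl_le: "f \<in> L2 (iid M) \<Longrightarrow> infl M f i \<le> 2 * norm2 (iid M) f"
  unfolding infl_def using norm2_diff[OF L2_infl, of f f i] norm2_reindex[of Some f]
    norm2_reindex[of "\<lambda>j. if j = i then None else Some j" f] inj_upd[of i]
  by (simp add: L2_measurable)

lemma infl_diff:
  assumes "f \<in> L2 (iid M)" "g \<in> L2 (iid M)"
  shows "infl M (\<lambda>z. f z - g z) i \<le> infl M f i + infl M g i"
proof -
  have "infl M (\<lambda>z. f z - g z) i = norm2 (iid M)
     (\<lambda>z. (f (\<lambda>j. z (Some j)) - f (\<lambda>j. z (if j = i then None else Some j))) -
       (g (\<lambda>j. z (Some j)) - g (\<lambda>j. z (if j = i then None else Some j))))"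
    by (simp add: infl_def algebra_simps)
  also have "\<dots> \<le> infl M f i + infl M g i"
    unfolding infl_def using assms by (intro norm2_diff L2_diff L2_infl)
  finally show ?thesis .
qed

lemma infl_sum:
  assumes "\<And>t. t \<in> T \<Longrightarrow> f t \<in> L2 (iid M)"
  shows "infl M (\<lambda>z. \<Sum>t\<in>T. f t z) i \<le> (\<Sum>t\<in>T. infl M (f t) i)"
proof -
  have "infl M (\<lambda>z. \<Sum>t\<in>T. f t z) i = norm2 (iid M)
     (\<lambda>z. \<Sum>t\<in>T. f t (\<lambda>j. z (Some j)) - f t (\<lambda>j. z (if j = i then None else Some j)))"
    by (simp add: infl_def sum_subtractf)
  also have "\<dots> \<le> (\<Sum>t\<in>T. infl M (f t) i)"
    unfolding infl_def using assms by (intro norm2_sum L2_diff L2_infl)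
  finally show ?thesis .
qed

lemma measurable_infl:
  fixes f :: "_ \<Rightarrow> real"
  assumes "f \<in> borel_measurable (iid M)"
  shows "(\<lambda>z. f (\<lambda>j. z (Some j)) - f (\<lambda>j. z (if j = i then None else Some j))) \<in> borel_measurable (iid M)"
  using measurable_compose_reindex[OF assms, of Some]
    measurable_compose_reindex[OF assms, of "\<lambda>j. if j = i then None else Some j"] by (rule borel_measurable_diff)

text \<open>\<open>map_option h\<close> relabels the coordinates and fixes \<open>None\<close>, so
  the spare copy stays apart; injectivity turns \<open>h j = h k\<close> into
  \<open>j = k\<close>.\<close>

lemma infl_reindex:
  assumes "inj h" "f \<in> borel_measurable (iid M)"
  shows "infl M (\<lambda>z. f (\<lambda>k. z (h k))) (h k) = infl M f k"
proof -
  let ?g = "\<lambda>z. f (\<lambda>j. z (Some j)) - f (\<lambda>j. z (if j = k then None else Some j))"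
  have "norm2 (iid M) (\<lambda>z. ?g (\<lambda>i. z (map_option h i))) = norm2 (iid M) ?g"
    by (intro norm2_reindex measurable_infl assms option.inj_map)
  also have "(\<lambda>z. ?g (\<lambda>i. z (map_option h i))) =
    (\<lambda>z. f (\<lambda>j. z (Some (h j))) - f (\<lambda>j. z (if h j = h k then None else Some (h j))))"
    by (auto simp: fun_eq_iff inj_eq[OF assms(1)] if_distrib intro!: arg_cong[of _ _ f])
  finally show ?thesis by (simp add: infl_def)
qed

lemma infl_reindex_0:
  assumes "i \<notin> range h"
  shows "infl M (\<lambda>z. f (\<lambda>k. z (h k))) i = 0"
proof -
  have "h k \<noteq> i" for k using assms by auto
  then show ?thesis by (simp add: infl_def)
qed

text \<open>Since \<open>i \<notin> J\<close>, enlarging \<open>J\<close> by \<open>i\<close>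
  switches just coordinate \<open>i\<close> to its other copy, which after relabelling is the single
  replacement in \<open>infl\<close>. This prices one step of the telescoping sum in
  \<open>covariance_bound\<close>.\<close>

lemma infl_mix:
  assumes "f \<in> borel_measurable (iid M)" "i \<notin> J"
  shows "norm2 (iid M) (\<lambda>z. f (mix J z) - f (mix (insert i J) z)) = infl M f i"
proof -
  define h where "h = (\<lambda>x. case x of None \<Rightarrow> (i, True) | Some j \<Rightarrow> (j, j \<in> J))"
  have h: "inj h" using assms(2) by (auto simp: h_def inj_def split: option.splits)
  let ?g = "\<lambda>z. f (\<lambda>j. z (Some j)) - f (\<lambda>j. z (if j = i then None else Some j))"
  have "norm2 (iid M) (\<lambda>z. ?g (\<lambda>x. z (h x))) = norm2 (iid M) ?g"
    by (intro norm2_reindex measurable_infl assms h)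
  also have "(\<lambda>z. ?g (\<lambda>x. z (h x))) = (\<lambda>z. f (mix J z) - f (mix (insert i J) z))"
  proof
    fix z :: "'b \<times> bool \<Rightarrow> 'a"
    have "(\<lambda>j. z (h (Some j))) = mix J z" by (simp add: h_def mix_def)
    moreover have "(\<lambda>j. z (h (if j = i then None else Some j))) = mix (insert i J) z"
      by (auto simp: h_def mix_def fun_eq_iff)
    ultimately show "?g (\<lambda>x. z (h x)) = f (mix J z) - f (mix (insert i J) z)" by simp
  qed
  finally show ?thesis by (simp add: infl_def)
qed

lemma L2_mix: "f \<in> L2 (iid M) \<Longrightarrow> (\<lambda>z. f (mix J z)) \<in> L2 (iid M)"
  using L2_reindex[OF inj_pair_left, of f "\<lambda>i. i \<in> J"] by (simp add: mix_def)

lemma norm2_mix: "f \<in> borel_measurable (iid M) \<Longrightarrow> norm2 (iid M) (\<lambda>z. f (mix J z)) = norm2 (iid M) f"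
  using norm2_reindex[OF inj_pair_left, of f "\<lambda>i. i \<in> J"] by (simp add: mix_def)

lemma integral_mix:
  fixes f :: "_ \<Rightarrow> 'b::{banach, second_countable_topology}"
  shows "f \<in> borel_measurable (iid M) \<Longrightarrow> (\<integral>z. f (mix J z) \<partial>iid M) = (\<integral>z. f z \<partial>iid M)"
  using integral_reindex[OF inj_pair_left, of f "\<lambda>i. i \<in> J"] by (simp add: mix_def)

text \<open>Truncation reduces this to \<open>resample_L1\<close>: for functions bounded by
  \<open>n\<close> a squared difference is at most 2n times its absolute value, and the error of
  truncation is the same under every mixture because mixing preserves the law.\<close>

lemma resample_L2:
  fixes f :: "('i \<Rightarrow> 'a) \<Rightarrow> real"
  assumes f: "f \<in> L2 (iid M)" and e: "0 < e"
  shows "\<exists>J0. finite J0 \<and> (\<forall>J. J0 \<subseteq> J \<longrightarrow> norm2 (iid M) (\<lambda>z. f (mix J z) - f (mix UNIV z)) \<le> e)"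
proof -
  interpret I: prob_space "iid M :: ('i \<times> bool \<Rightarrow> 'a) measure" by (rule prob_space_iid)
  interpret I1: prob_space "iid M :: ('i \<Rightarrow> 'a) measure" by (rule prob_space_iid)
  note [measurable] = L2_measurable[OF f]
  define T where "T n x = max (- real n) (min (real n) (f x))" for n x
  have T: "\<bar>T n x\<bar> \<le> real n" "\<bar>T n x\<bar> \<le> \<bar>f x\<bar>" "\<bar>f x - T n x\<bar> \<le> \<bar>f x\<bar>" for n x
    by (auto simp: T_def)
  have [measurable]: "T n \<in> borel_measurable (iid M)" for n unfolding T_def[abs_def] by measurable
  have TL2: "T n \<in> L2 (iid M)" for n
    unfolding L2_def using T(2)
    by (auto intro!: Bochner_Integration.integrable_bound[OF L2_square_integrable[OF f]] simp: abs_le_square_iff)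
  have "(\<lambda>n. \<integral>x. (f x - T n x)\<^sup>2 \<partial>iid M) \<longlonglongrightarrow> (\<integral>x. 0 \<partial>(iid M :: ('i \<Rightarrow> 'a) measure))"
  proof (rule integral_dominated_convergence[where w="\<lambda>x. (f x)\<^sup>2"])
    show "AE x in iid M. (\<lambda>n. (f x - T n x)\<^sup>2) \<longlonglongrightarrow> 0"
    proof (rule AE_I2)
      fix x
      have "\<forall>\<^sub>F n in sequentially. (f x - T n x)\<^sup>2 = 0"
        using eventually_ge_at_top[of "nat \<lceil>\<bar>f x\<bar>\<rceil>"]
      proof eventually_elim
        case (elim n)
        then have "\<bar>f x\<bar> \<le> real n" by linarith
        then show ?case by (auto simp: T_def)
      qed
      then show "(\<lambda>n. (f x - T n x)\<^sup>2) \<longlonglongrightarrow> 0" by (rule tendsto_eventually)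
    qed
    show "AE x in iid M. norm ((f x - T n x)\<^sup>2) \<le> (f x)\<^sup>2" for n
      using T(3) by (simp add: abs_le_square_iff)
  qed (use f in \<open>auto simp: L2_square_integrable\<close>)
  then have "(\<lambda>n. norm2 (iid M) (\<lambda>x. f x - T n x)) \<longlonglongrightarrow> 0"
    unfolding norm2_def using tendsto_real_sqrt by fastforce
  then have "\<forall>\<^sub>F n in sequentially. norm2 (iid M) (\<lambda>x. f x - T n x) < e / 3 \<and> n > 0"
    using e by (intro eventually_conj order_tendstoD(2)[of _ 0] eventually_gt_at_top) auto
  then obtain n where n: "norm2 (iid M) (\<lambda>x. f x - T n x) < e / 3" "n > 0"
    by (auto simp: eventually_sequentially)
  have e': "0 < (e / 3)\<^sup>2 / (2 * real n)" using e n by simp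
  obtain J0 where J0: "finite J0" "\<And>J. J0 \<subseteq> J \<Longrightarrow>
      (\<integral>z. \<bar>T n (mix J z) - T n (mix UNIV z)\<bar> \<partial>iid M) < (e / 3)\<^sup>2 / (2 * real n)"
    using resample_L1[OF I1.L2_integrable[OF TL2] e', of n] by blast
  show ?thesis
  proof (intro exI[of _ J0] conjI allI impI J0(1))
    fix J assume J: "J0 \<subseteq> J"
    have TJ: "(\<lambda>z. T n (mix J z)) \<in> L2 (iid M)" for J by (rule L2_mix[OF TL2])
    have "(norm2 (iid M) (\<lambda>z. T n (mix J z) - T n (mix UNIV z)))\<^sup>2 \<le>
        (\<integral>z. 2 * real n * \<bar>T n (mix J z) - T n (mix UNIV z)\<bar> \<partial>iid M)"
      unfolding norm2_square
    proof (rule integral_mono)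
      show "integrable (iid M) (\<lambda>z. (T n (mix J z) - T n (mix UNIV z))\<^sup>2)"
        by (intro L2_square_integrable L2_diff TJ)
      show "integrable (iid M) (\<lambda>z. 2 * real n * \<bar>T n (mix J z) - T n (mix UNIV z)\<bar>)"
        by (intro integrable_mult_right integrable_abs I.L2_integrable L2_diff TJ)
      fix z
      have "(T n (mix J z) - T n (mix UNIV z))\<^sup>2 = \<bar>T n (mix J z) - T n (mix UNIV z)\<bar> * \<bar>T n (mix J z) - T n (mix UNIV z)\<bar>"
        by (simp add: power2_eq_square flip: abs_mult)
      also have "\<dots> \<le> 2 * real n * \<bar>T n (mix J z) - T n (mix UNIV z)\<bar>"
        using T(1)[of n "mix J z"] T(1)[of n "mix UNIV z"] by (intro mult_right_mono) auto
      finally show "(T n (mix J z) - T n (mix UNIV z))\<^sup>2 \<le> 2 * real n * \<bar>T n (mix J z) - T n (mix UNIV z)\<bar>" .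
    qed
    also have "\<dots> \<le> (e / 3)\<^sup>2" using J0(2)[OF J] n(2) by (simp add: field_simps)
    finally have a: "norm2 (iid M) (\<lambda>z. T n (mix J z) - T n (mix UNIV z)) \<le> e / 3"
      by (rule power2_le_imp_le) (use e in simp)
    have b: "norm2 (iid M) (\<lambda>z. f (mix J z) - T n (mix J z)) < e / 3" for J
      using norm2_mix[of "\<lambda>x. f x - T n x" J] n(1) by simp
    have fJ: "(\<lambda>z. f (mix J z) - T n (mix J z)) \<in> L2 (iid M)" for J
      by (intro L2_diff TJ L2_mix f)
    have "norm2 (iid M) (\<lambda>z. f (mix J z) - f (mix UNIV z)) = norm2 (iid M) (\<lambda>z.
        ((f (mix J z) - T n (mix J z)) - (f (mix UNIV z) - T n (mix UNIV z))) + (T n (mix J z) - T n (mix UNIV z)))"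
      by simp
    also have "\<dots> \<le> norm2 (iid M) (\<lambda>z. (f (mix J z) - T n (mix J z)) - (f (mix UNIV z) - T n (mix UNIV z))) +
        norm2 (iid M) (\<lambda>z. T n (mix J z) - T n (mix UNIV z))"
      by (intro norm2_add L2_diff fJ TJ)
    also have "\<dots> \<le> norm2 (iid M) (\<lambda>z. f (mix J z) - T n (mix J z)) + norm2 (iid M) (\<lambda>z. f (mix UNIV z) - T n (mix UNIV z)) + e / 3"
      by (intro add_mono a norm2_diff fJ)
    also have "\<dots> \<le> e" using b[of J] b[of UNIV] by simp
    finally show "norm2 (iid M) (\<lambda>z. f (mix J z) - f (mix UNIV z)) \<le> e" .
  qed
qed

lemma indep_vars_coordinates:
  "prob_space.indep_vars (iid M) (\<lambda>_. M) (\<lambda>(i :: 'i) z. z i) UNIV"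
proof -
  interpret I: prob_space "iid M :: ('i \<Rightarrow> 'a) measure" by (rule prob_space_iid)
  have c: "distr (iid M) M (\<lambda>z. z i) = M" for i :: 'i
    using distr_PiM_component[of "UNIV :: 'i set" "\<lambda>_. M"] prob_space_axioms by simp
  have "distr (iid M) (iid M) (\<lambda>x. \<lambda>i\<in>UNIV. x i) = Pi\<^sub>M UNIV (\<lambda>i :: 'i. distr (iid M) M (\<lambda>z. z i))"
    unfolding c using reindex[of "\<lambda>i :: 'i. i"] by (simp add: restrict_def)
  then show ?thesis by (subst I.indep_vars_iff_distr_eq_PiM) auto
qed

text \<open>Dependence on the block \<open>K j\<close> is expressed pointwise. A fixed point
  \<open>c\<close> of the space fills the coordinates outside the block, which makes
  \<open>F j\<close> a measurable function of the restriction to \<open>K j\<close>.\<close>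

lemma indep_blocks:
  fixes F :: "'j \<Rightarrow> ('i \<Rightarrow> 'a) \<Rightarrow> real"
  assumes K: "disjoint_family_on K L"
    and F: "\<And>j. j \<in> L \<Longrightarrow> F j \<in> borel_measurable (iid M)"
    and dep: "\<And>j z z'. j \<in> L \<Longrightarrow> (\<And>i. i \<in> K j \<Longrightarrow> z i = z' i) \<Longrightarrow> F j z = F j z'"
  shows "prob_space.indep_vars (iid M) (\<lambda>_. borel) F L"
proof -
  interpret I: prob_space "iid M :: ('i \<Rightarrow> 'a) measure" by (rule prob_space_iid)
  obtain c where c: "c \<in> space M" using not_empty by auto
  let ?Y = "\<lambda>j w. F j (\<lambda>i. if i \<in> K j then w i else c)"
  have m: "?Y j \<in> borel_measurable (Pi\<^sub>M (K j) (\<lambda>_. M))" if "j \<in> L" for j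
  proof (rule measurable_compose[OF _ F[OF that]])
    show "(\<lambda>w i. if i \<in> K j then w i else c) \<in> measurable (Pi\<^sub>M (K j) (\<lambda>_. M)) (iid M)"
    proof (rule measurable_PiM_single')
      fix i show "(\<lambda>w. if i \<in> K j then w i else c) \<in> measurable (Pi\<^sub>M (K j) (\<lambda>_. M)) M"
        using c by (cases "i \<in> K j") auto
    qed (use c in \<open>auto simp: space_PiM PiE_iff\<close>)
  qed
  have "I.indep_vars (\<lambda>_. borel) (\<lambda>j z. ?Y j (restrict (\<lambda>i. z i) (K j))) L"
    by (rule I.indep_vars_compose2[OF I.indep_vars_restrict[OF indep_vars_coordinates]])
      (use K m in auto)
  moreover have "?Y j (restrict (\<lambda>i. z i) (K j)) = F j z" if "j \<in> L" for j z
    by (rule dep[OF that]) auto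
  ultimately show ?thesis
    using I.indep_vars_cong[of L L "\<lambda>j z. ?Y j (restrict (\<lambda>i. z i) (K j))" F "\<lambda>_. borel" "\<lambda>_. borel"] by auto
qed

text \<open>\<open>mix UNIV\<close> is an independent copy of \<open>mix {}\<close>, so the
  covariance is the expectation of f(mix {}) times g(mix {}) - g(mix UNIV). Switching the
  coordinates of \<open>g\<close> one at a time telescopes the difference. Exchanging the two copies
  of the coordinate just switched turns each term into half the expectation of a product of two
  single-coordinate differences, to which Cauchy-Schwarz applies. \<open>B\<close> bounds finite
  sums only, so the index set may be arbitrary.\<close>

lemma covariance_bound:
  fixes f g :: "('i \<Rightarrow> 'a) \<Rightarrow> real"
  assumes f: "f \<in> L2 (iid M)" and g: "g \<in> L2 (iid M)"
    and B: "\<And>J. finite J \<Longrightarrow> (\<Sum>i\<in>J. infl M f i * infl M g i) \<le> B"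
  shows "\<bar>(\<integral>z. f z * g z \<partial>iid M) - (\<integral>z. f z \<partial>iid M) * (\<integral>z. g z \<partial>iid M)\<bar> \<le> B"
proof -
  interpret I: prob_space "iid M :: ('i \<times> bool \<Rightarrow> 'a) measure" by (rule prob_space_iid)
  interpret I1: prob_space "iid M :: ('i \<Rightarrow> 'a) measure" by (rule prob_space_iid)
  note [measurable] = L2_measurable[OF f] L2_measurable[OF g]
  have [simp]: "(\<lambda>z. f (mix J z)) \<in> L2 (iid M)" "(\<lambda>z. g (mix J z)) \<in> L2 (iid M)" for J
    using f g by (auto intro: L2_mix)
  have finite_step: "\<bar>\<integral>z. f (mix {} z) * (g (mix {} z) - g (mix J z)) \<partial>iid M\<bar> \<le> (\<Sum>i\<in>J. infl M f i * infl M g i)"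
    if "finite J" for J
    using that
  proof (induction J)
    case empty
    then show ?case by simp
  next
    case (insert i J)
    let ?d = "\<lambda>z. g (mix J z) - g (mix (insert i J) z)"
    let ?T = "\<integral>z. f (mix {} z) * ?d z \<partial>iid M"
    \<comment> \<open>Exchanging the two copies of coordinate \<open>i\<close> preserves the measure and reverses the sign of \<open>?d\<close>.\<close>
    define h where "h = (\<lambda>(j, c). (j, if j = i then \<not> c else c))"
    have "inj h" by (auto simp: h_def inj_def split: if_splits)
    have hm: "mix {} (\<lambda>x. z (h x)) = mix {i} z" "mix J (\<lambda>x. z (h x)) = mix (insert i J) z"
      "mix (insert i J) (\<lambda>x. z (h x)) = mix J z" for z :: "_ \<Rightarrow> 'a"
      using insert.hyps by (auto simp: mix_def h_def fun_eq_iff)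
    have "?T = (\<integral>z. f (mix {i} z) * (g (mix (insert i J) z) - g (mix J z)) \<partial>iid M)"
      using integral_reindex[OF \<open>inj h\<close>, of "\<lambda>z. f (mix {} z) * ?d z"] by (simp add: hm)
    also have "\<dots> = (\<integral>z. - (f (mix {i} z) * ?d z) \<partial>iid M)"
      by (simp add: right_diff_distrib)
    also have "\<dots> = - (\<integral>z. f (mix {i} z) * ?d z \<partial>iid M)"
      by (rule Bochner_Integration.integral_minus)
    finally have "?T = - (\<integral>z. f (mix {i} z) * ?d z \<partial>iid M)" .
    moreover have "integrable (iid M) (\<lambda>z. f (mix J' z) * ?d z)" for J'
      by (intro L2_mult_integrable L2_diff) auto
    \<comment> \<open>Adding the original and the exchanged form of \<open>?T\<close> replaces
      \<open>f\<close> by its own difference in coordinate \<open>i\<close>. The factor 1/2 gained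
      in this way is given away below.\<close>
    ultimately have "2 * ?T = (\<integral>z. (f (mix {} z) - f (mix {i} z)) * ?d z \<partial>iid M)"
      by (simp add: left_diff_distrib)
    also have "\<bar>\<dots>\<bar> \<le> norm2 (iid M) (\<lambda>z. f (mix {} z) - f (mix {i} z)) * norm2 (iid M) ?d"
      by (intro L2_Cauchy_Schwarz L2_diff) auto
    also have "\<dots> = infl M f i * infl M g i"
      using infl_mix[of f i "{}"] infl_mix[of g i J] insert.hyps by simp
    finally have T: "\<bar>?T\<bar> \<le> infl M f i * infl M g i"
      by (simp add: abs_mult)
    have "(\<integral>z. f (mix {} z) * (g (mix {} z) - g (mix (insert i J) z)) \<partial>iid M) =
        (\<integral>z. f (mix {} z) * (g (mix {} z) - g (mix J z)) + f (mix {} z) * ?d z \<partial>iid M)"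
      by (simp add: algebra_simps)
    also have "\<dots> = (\<integral>z. f (mix {} z) * (g (mix {} z) - g (mix J z)) \<partial>iid M) + ?T"
      by (intro Bochner_Integration.integral_add L2_mult_integrable L2_diff) auto
    finally show ?case using insert T by (simp add: abs_le_iff)
  qed
  have "\<bar>\<integral>z. f (mix {} z) * (g (mix {} z) - g (mix UNIV z)) \<partial>iid M\<bar> \<le> B"
  proof (rule field_le_epsilon)
    fix e :: real assume "0 < e"
    \<comment> \<open>Cauchy-Schwarz against \<open>f\<close> multiplies this tolerance back to at
      most \<open>e\<close>; the 1 allows for a vanishing norm.\<close>
    then have "0 < e / (norm2 (iid M) f + 1)" by (simp add: add_nonneg_pos)
    from resample_L2[OF g this] obtain J where J: "finite J"
      "norm2 (iid M) (\<lambda>z. g (mix J z) - g (mix UNIV z)) \<le> e / (norm2 (iid M) f + 1)" by blast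
    have "(\<integral>z. f (mix {} z) * (g (mix {} z) - g (mix UNIV z)) \<partial>iid M) =
       (\<integral>z. f (mix {} z) * (g (mix {} z) - g (mix J z)) + f (mix {} z) * (g (mix J z) - g (mix UNIV z)) \<partial>iid M)"
      by (simp add: algebra_simps)
    also have "\<dots> = (\<integral>z. f (mix {} z) * (g (mix {} z) - g (mix J z)) \<partial>iid M) +
        (\<integral>z. f (mix {} z) * (g (mix J z) - g (mix UNIV z)) \<partial>iid M)"
      by (intro Bochner_Integration.integral_add L2_mult_integrable L2_diff) auto
    also have "\<bar>\<dots>\<bar> \<le> B + norm2 (iid M) (\<lambda>z. f (mix {} z)) * norm2 (iid M) (\<lambda>z. g (mix J z) - g (mix UNIV z))"
      using finite_step[OF J(1)] B[OF J(1)]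
      by (intro order_trans[OF abs_triangle_ineq] add_mono L2_Cauchy_Schwarz L2_diff) auto
    also have "norm2 (iid M) (\<lambda>z. f (mix {} z)) * norm2 (iid M) (\<lambda>z. g (mix J z) - g (mix UNIV z)) \<le>
        norm2 (iid M) f * (e / (norm2 (iid M) f + 1))"
      unfolding norm2_mix[OF L2_measurable[OF f]] by (intro mult_left_mono J) auto
    also have "\<dots> \<le> e"
      using \<open>0 < e\<close> by (simp add: divide_le_eq add_nonneg_pos distrib_left mult.commute)
    finally show "\<bar>\<integral>z. f (mix {} z) * (g (mix {} z) - g (mix UNIV z)) \<partial>iid M\<bar> \<le> B + e" by simp
  qed
  also have "(\<integral>z. f (mix {} z) * (g (mix {} z) - g (mix UNIV z)) \<partial>iid M) =
     (\<integral>z. f (mix {} z) * g (mix {} z) \<partial>iid M) - (\<integral>z. f (mix {} z) * g (mix UNIV z) \<partial>iid M)"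
    unfolding right_diff_distrib
    by (intro Bochner_Integration.integral_diff L2_mult_integrable) auto
  also have "(\<integral>z. f (mix {} z) * g (mix {} z) \<partial>iid M) = (\<integral>z. f z * g z \<partial>iid M)"
    by (rule integral_mix[of "\<lambda>x. f x * g x"]) measurable
  also have "(\<integral>z. f (mix {} z) * g (mix UNIV z) \<partial>iid M) = (\<integral>z. f z \<partial>iid M) * (\<integral>z. g z \<partial>iid M)"
  proof -
    \<comment> \<open>The two flags are two blocks of coordinates: \<open>f\<close> reads the copies
      flagged \<open>False\<close>, \<open>g\<close> those flagged \<open>True\<close>.\<close>
    let ?F = "\<lambda>c z. if c then g (mix UNIV z) else f (mix {} z)"
    have "I.indep_vars (\<lambda>_. borel) ?F UNIV"
    proof (rule indep_blocks[where K="\<lambda>c. {x. snd x = c}"])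
      show "disjoint_family_on (\<lambda>c. {x :: 'i \<times> bool. snd x = c}) UNIV"
        by (auto simp: disjoint_family_on_def)
      fix c show "?F c \<in> borel_measurable (iid M)" by (cases c) simp_all
    next
      fix c and z z' :: "'i \<times> bool \<Rightarrow> 'a" assume "\<And>i. i \<in> {x. snd x = c} \<Longrightarrow> z i = z' i"
      then have "mix (if c then UNIV else {}) z = mix (if c then UNIV else {}) z'"
        by (auto simp: mix_def fun_eq_iff)
      then show "?F c z = ?F c z'" by (cases c) auto
    qed
    moreover have "integrable (iid M) (?F c)" for c
      by (cases c) (auto intro: I.L2_integrable)
    ultimately have "(\<integral>z. (\<Prod>c\<in>UNIV. ?F c z) \<partial>iid M) = (\<Prod>c\<in>UNIV. \<integral>z. ?F c z \<partial>iid M)"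
      by (intro I.indep_vars_lebesgue_integral) auto
    then show ?thesis by (simp add: UNIV_bool mult.commute integral_mix)
  qed
  finally show ?thesis .
qed

text \<open>A Schur test for the matrix \<open>d\<close>: \<open>A\<close> bounds the influence of
  one innovation on all terms, \<open>B t\<close> the influence of all innovations on one term. In
  the applications \<open>A\<close> stays fixed and smallness comes from \<open>B t\<close>.\<close>

lemma variance_bound:
  fixes f :: "'t \<Rightarrow> ('i \<Rightarrow> 'a) \<Rightarrow> real"
  assumes f: "\<And>t. t \<in> T \<Longrightarrow> f t \<in> L2 (iid M)"
    and d: "\<And>t i. t \<in> T \<Longrightarrow> infl M (f t) i \<le> d t i"
    and A: "\<And>i. (\<Sum>t\<in>T. d t i) \<le> A"
    and B: "\<And>t J. t \<in> T \<Longrightarrow> finite J \<Longrightarrow> (\<Sum>i\<in>J. d t i) \<le> B t"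
  shows "(norm2 (iid M) (\<lambda>z. \<Sum>t\<in>T. w t * (f t z - (\<integral>z. f t z \<partial>iid M))))\<^sup>2 \<le> A * (\<Sum>t\<in>T. (w t)\<^sup>2 * B t)"
proof -
  interpret I: prob_space "iid M :: ('i \<Rightarrow> 'a) measure" by (rule prob_space_iid)
  define F where "F z = (\<Sum>t\<in>T. w t * f t z)" for z
  have F: "F \<in> L2 (iid M)" unfolding F_def[abs_def] by (intro L2_sum L2_cmult f)
  have d0: "0 \<le> d t i" if "t \<in> T" for t i
    by (rule order_trans[OF infl_nonneg d[OF that]])
  have A0: "0 \<le> A" using A[of undefined] by (rule order_trans[rotated]) (auto intro: sum_nonneg d0)
  have EF: "(\<integral>z. F z \<partial>iid M) = (\<Sum>t\<in>T. w t * (\<integral>z. f t z \<partial>iid M))"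
    unfolding F_def using f by (subst Bochner_Integration.integral_sum) (auto intro: I.L2_integrable)
  have "(norm2 (iid M) (\<lambda>z. \<Sum>t\<in>T. w t * (f t z - (\<integral>z. f t z \<partial>iid M))))\<^sup>2 = I.variance F"
    by (simp add: norm2_square EF F_def right_diff_distrib sum_subtractf)
  also have "\<dots> = (\<integral>z. F z * F z \<partial>iid M) - (\<integral>z. F z \<partial>iid M) * (\<integral>z. F z \<partial>iid M)"
    using F L2_square_integrable[OF F] by (subst I.variance_eq) (auto intro: I.L2_integrable simp: power2_eq_square)
  also have "\<dots> \<le> A * (\<Sum>t\<in>T. (w t)\<^sup>2 * B t)"
  proof (rule order_trans[OF abs_ge_self covariance_bound[OF F F]])
    fix J :: "'i set" assume J: "finite J"
    have "infl M F i * infl M F i \<le> (\<Sum>t\<in>T. (w t)\<^sup>2 * d t i) * A" for i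
    proof -
      have "infl M F i \<le> (\<Sum>t\<in>T. \<bar>w t\<bar> * infl M (f t) i)"
        unfolding F_def[abs_def] infl_cmult[symmetric] by (intro infl_sum L2_cmult f)
      \<comment> \<open>Splitting \<open>d\<close> into two roots lets Cauchy-Schwarz put the
        squared weights into one sum and leave the other free of weights.\<close>
      also have "\<dots> \<le> (\<Sum>t\<in>T. (\<bar>w t\<bar> * sqrt (d t i)) * sqrt (d t i))"
        using d d0 by (intro sum_mono) (auto simp: mult.assoc intro!: mult_left_mono)
      finally have "(infl M F i)\<^sup>2 \<le> (\<Sum>t\<in>T. (\<bar>w t\<bar> * sqrt (d t i)) * sqrt (d t i))\<^sup>2"
        by (intro power_mono) auto
      also have "\<dots> \<le> (\<Sum>t\<in>T. (\<bar>w t\<bar> * sqrt (d t i))\<^sup>2) * (\<Sum>t\<in>T. (sqrt (d t i))\<^sup>2)"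
        by (rule Cauchy_Schwarz_ineq_sum)
      also have "\<dots> = (\<Sum>t\<in>T. (w t)\<^sup>2 * d t i) * (\<Sum>t\<in>T. d t i)"
        using d0 by (simp add: power_mult_distrib)
      also have "\<dots> \<le> (\<Sum>t\<in>T. (w t)\<^sup>2 * d t i) * A"
        using d0 by (intro mult_left_mono A sum_nonneg) auto
      finally show ?thesis by (simp add: power2_eq_square)
    qed
    then have "(\<Sum>i\<in>J. infl M F i * infl M F i) \<le> (\<Sum>i\<in>J. (\<Sum>t\<in>T. (w t)\<^sup>2 * d t i) * A)"
      by (rule sum_mono)
    also have "\<dots> = A * (\<Sum>t\<in>T. (w t)\<^sup>2 * (\<Sum>i\<in>J. d t i))"
      by (simp add: sum_distrib_left sum_distrib_right mult_ac sum.swap[of _ T J])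
    also have "\<dots> \<le> A * (\<Sum>t\<in>T. (w t)\<^sup>2 * B t)"
      using A0 J by (intro mult_left_mono sum_mono B) auto
    finally show "(\<Sum>i\<in>J. infl M F i * infl M F i) \<le> A * (\<Sum>t\<in>T. (w t)\<^sup>2 * B t)" .
  qed
  finally show ?thesis .
qed

end

section \<open>A central limit theorem for weighted i.i.d. sums\<close>

lemma char_distr:
  assumes "X \<in> borel_measurable M"
  shows "char (distr M borel X) t = (CLINT x|M. iexp (t * X x))"
  using assms unfolding char_def by (subst integral_distr) auto

lemma char_distr_cmult:
  assumes "X \<in> borel_measurable M"
  shows "char (distr M borel (\<lambda>x. c * X x)) t = char (distr M borel X) (c * t)"
  using assms by (subst (1 2) char_distr) (auto simp: mult_ac)

text \<open>One formula covers the point mass \<open>v = 0\<close> as well, which is the limit when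
  the long-run variance vanishes.\<close>

lemma normal_law_properties:
  assumes "0 \<le> v"
  shows real_distribution_normal_law: "real_distribution (normal_law 0 v)"
    and char_normal_law: "char (normal_law 0 v) t = exp (- (t\<^sup>2 * v / 2))"
proof -
  have "real_distribution (normal_law 0 v) \<and> char (normal_law 0 v) t = exp (- (t\<^sup>2 * v / 2))"
  proof (cases "v = 0")
    case True
    have "prob_space (return borel (0::real))" by (rule prob_space_return) simp
    then have "real_distribution (return borel (0::real))"
      by (simp add: real_distribution_def real_distribution_axioms_def)
    moreover have "char (return borel (0::real)) t = 1"
      unfolding char_def by (subst integral_return) auto
    ultimately show ?thesis using True by (simp add: normal_law_def)
  next
    case False
    then have v: "0 < sqrt v" using assms by simp
    interpret S: real_distribution std_normal_distribution by (rule real_dist_normal_dist)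
    have "distributed std_normal_distribution lborel (\<lambda>x. x) std_normal_density"
      by (auto simp: distributed_def distr_id2 intro!: measurableI)
    from S.normal_density_affine[OF this, of "sqrt v" 0] v
    have "distributed std_normal_distribution lborel (\<lambda>x. sqrt v * x) (normal_density 0 (sqrt v))"
      by simp
    then have d: "distr std_normal_distribution lborel (\<lambda>x. sqrt v * x) = density lborel (normal_density 0 (sqrt v))"
      by (simp add: distributed_def)
    have "distr std_normal_distribution borel (\<lambda>x. sqrt v * x) = distr std_normal_distribution lborel (\<lambda>x. sqrt v * x)"
      by (rule distr_cong) auto
    with d have e: "normal_law 0 v = distr std_normal_distribution borel (\<lambda>x. sqrt v * x)"
      using False by (simp add: normal_law_def)
    have "char (distr std_normal_distribution borel (\<lambda>x. sqrt v * x)) t = char std_normal_distribution (sqrt v * t)"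
      by (subst char_distr_cmult) (auto simp: distr_id2)
    then have "char (normal_law 0 v) t = exp (- (t\<^sup>2 * v / 2))"
      unfolding e using assms by (simp add: char_std_normal_distribution power_mult_distrib mult.commute[of "t\<^sup>2" v])
    moreover have "real_distribution (normal_law 0 v)"
      unfolding e by (intro S.real_distribution_distr) auto
    ultimately show ?thesis by simp
  qed
  then show "real_distribution (normal_law 0 v)" "char (normal_law 0 v) t = exp (- (t\<^sup>2 * v / 2))" by auto
qed

lemma cmod_iexp_diff: "cmod (iexp x - iexp y) \<le> \<bar>x - y\<bar>"
proof -
  have "iexp x - iexp y = iexp y * (iexp (x - y) - 1)"
    by (simp add: algebra_simps flip: exp_add)
  then have "cmod (iexp x - iexp y) = cmod (iexp (x - y) - 1)"
    by (simp add: norm_mult)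
  also have "\<dots> \<le> \<bar>x - y\<bar>" using iexp_approx1[of "x - y" 0] by simp
  finally show ?thesis .
qed

text \<open>Takes the place of Slutsky's lemma: the approximation errors below are controlled in L1,
  and this carries them over to characteristic functions.\<close>

lemma (in prob_space) char_diff_le:
  assumes S: "S \<in> borel_measurable M" and T: "T \<in> borel_measurable M" and i: "integrable M (\<lambda>x. S x - T x)"
  shows "cmod (char (distr M borel S) t - char (distr M borel T) t) \<le> \<bar>t\<bar> * expectation (\<lambda>x. \<bar>S x - T x\<bar>)"
proof -
  note [measurable] = S T
  have int: "integrable M (\<lambda>x. iexp (t * S x))" "integrable M (\<lambda>x. iexp (t * T x))"
    by (intro integrable_const_bound[where B=1]; simp)+
  have "char (distr M borel S) t - char (distr M borel T) t = (CLINT x|M. iexp (t * S x) - iexp (t * T x))"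
    using int by (simp add: char_distr S T)
  also have "cmod \<dots> \<le> expectation (\<lambda>x. cmod (iexp (t * S x) - iexp (t * T x)))"
    by (rule integral_norm_bound)
  also have "\<dots> \<le> expectation (\<lambda>x. \<bar>t\<bar> * \<bar>S x - T x\<bar>)"
  proof (rule integral_mono)
    fix x
    have "cmod (iexp (t * S x) - iexp (t * T x)) \<le> \<bar>t * S x - t * T x\<bar>" by (rule cmod_iexp_diff)
    then show "cmod (iexp (t * S x) - iexp (t * T x)) \<le> \<bar>t\<bar> * \<bar>S x - T x\<bar>"
      by (simp add: abs_mult flip: right_diff_distrib)
  qed (use int i in auto)
  finally show ?thesis by simp
qed

lemma exp_minus_le_quadratic:
  fixes y :: real
  assumes "0 \<le> y"
  shows "exp (- y) \<le> 1 - y + y\<^sup>2 / 2"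
proof -
  have p: "0 < 1 + y + y\<^sup>2 / 2" using assms by (simp add: add_pos_nonneg)
  \<comment> \<open>The product equals 1 + y^4 / 4.\<close>
  have "1 \<le> (1 - y + y\<^sup>2 / 2) * (1 + y + y\<^sup>2 / 2)"
    using assms by (simp add: algebra_simps power2_eq_square)
  then have "1 / (1 + y + y\<^sup>2 / 2) \<le> 1 - y + y\<^sup>2 / 2" using p by (simp add: divide_le_eq)
  moreover have "exp (- y) \<le> 1 / (1 + y + y\<^sup>2 / 2)"
    using exp_lower_Taylor_quadratic[OF assms] p by (simp add: exp_minus field_simps)
  ultimately show ?thesis by linarith
qed

text \<open>A Lindeberg argument at the level of characteristic functions. The remainder of the
  second-order expansion carries the minimum of a square and a cube, so its expectation vanishes by
  dominated convergence without a third moment.\<close>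

lemma (in prob_space) weighted_iid_clt:
  fixes V :: "nat \<Rightarrow> 'a \<Rightarrow> real" and a :: "nat \<Rightarrow> nat \<Rightarrow> real" and m :: "nat \<Rightarrow> nat"
  assumes indep: "indep_vars (\<lambda>_. borel) V UNIV"
    and distr: "\<And>j. distr M borel (V j) = distr M borel (V 0)"
    and L2: "V 0 \<in> L2 M" and mean: "expectation (V 0) = 0"
    and a: "(\<lambda>n. \<Sum>j<m n. (a n j)\<^sup>2) \<longlonglongrightarrow> s"
    and \<kappa>: "\<And>n j. \<bar>a n j\<bar> \<le> \<kappa> n" "\<kappa> \<longlonglongrightarrow> 0"
  shows "(\<lambda>n. char (distr M borel (\<lambda>x. \<Sum>j<m n. a n j * V j x)) t) \<longlonglongrightarrow>
    complex_of_real (exp (- (t\<^sup>2 * (s * expectation (\<lambda>x. (V 0 x)\<^sup>2)) / 2)))"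
proof -
  define s2 where "s2 = expectation (\<lambda>x. (V 0 x)\<^sup>2)"
  have s2: "0 \<le> s2" by (simp add: s2_def)
  have [measurable]: "V j \<in> borel_measurable M" for j
    using indep by (auto simp: indep_vars_def)
  have V0: "integrable M (V 0)" "integrable M (\<lambda>x. (V 0 x)\<^sup>2)"
    using L2 by (auto intro: L2_integrable L2_square_integrable)
  define \<phi> where "\<phi> = char (distr M borel (V 0))"
  interpret D: real_distribution "distr M borel (V 0)" by (intro real_distribution_distr) auto
  define h where "h r = expectation (\<lambda>x. min (6 * (V 0 x)\<^sup>2) (r * \<bar>V 0 x\<bar> ^ 3))" for r
  have hint: "integrable M (\<lambda>x. min (6 * (V 0 x)\<^sup>2) (r * \<bar>V 0 x\<bar> ^ 3))" if "0 \<le> r" for r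
    by (rule Bochner_Integration.integrable_bound[OF integrable_mult_right[OF V0(2), of 6]])
      (use that in auto)
  have h_mono: "h r \<le> h r'" if "0 \<le> r" "r \<le> r'" for r r'
    unfolding h_def using that by (intro integral_mono hint min.mono mult_right_mono) auto
  have \<phi>_approx: "cmod (\<phi> r - (1 - r\<^sup>2 * s2 / 2)) \<le> r\<^sup>2 / 6 * h \<bar>r\<bar>" for r
    unfolding \<phi>_def h_def
    by (rule char_approx3'[OF _ V0 mean _ refl]) (auto simp: mean s2_def)
  \<comment> \<open>Two errors add up: the expansion of the characteristic function, and y^2 / 2 for
    1 - y against exp(-y), where y = (c t)^2 s2 / 2. In the second, one factor c^2 is kept for the
    summation over the weights and the other is bounded by r^2.\<close>
  have step: "cmod (\<phi> (c * t) - exp (- ((c * t)\<^sup>2 * s2 / 2))) \<le>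
      c\<^sup>2 * (t\<^sup>2 * h (r * \<bar>t\<bar>) / 6 + r\<^sup>2 * (t\<^sup>2 * s2)\<^sup>2 / 8)" if "\<bar>c\<bar> \<le> r" for c r
  proof -
    define y where "y = (c * t)\<^sup>2 * s2 / 2"
    have y: "0 \<le> y" using s2 by (simp add: y_def)
    have r: "0 \<le> r" "c\<^sup>2 \<le> r\<^sup>2" using that power_mono[of "\<bar>c\<bar>" r 2] by auto
    have "1 - y \<le> exp (- y)" using exp_ge_add_one_self[of "- y"] by simp
    with exp_minus_le_quadratic[OF y] have "\<bar>(1 - y) - exp (- y)\<bar> \<le> y\<^sup>2 / 2" by simp
    then have e: "cmod (complex_of_real (1 - y) - complex_of_real (exp (- y))) \<le> y\<^sup>2 / 2"
      unfolding of_real_diff[symmetric] norm_of_real .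
    have "cmod (\<phi> (c * t) - exp (- y)) \<le> cmod (\<phi> (c * t) - complex_of_real (1 - y)) + cmod (complex_of_real (1 - y) - complex_of_real (exp (- y)))"
      by (rule norm_diff_triangle_le[OF order_refl order_refl])
    also have "\<dots> \<le> (c * t)\<^sup>2 / 6 * h \<bar>c * t\<bar> + y\<^sup>2 / 2"
      using \<phi>_approx[of "c * t"] e by (intro add_mono) (simp_all add: y_def)
    also have "(c * t)\<^sup>2 / 6 * h \<bar>c * t\<bar> \<le> (c * t)\<^sup>2 / 6 * h (r * \<bar>t\<bar>)"
      using that by (intro mult_left_mono h_mono) (auto simp: abs_mult intro!: mult_right_mono)
    also have "y\<^sup>2 / 2 \<le> c\<^sup>2 * (r\<^sup>2 * (t\<^sup>2 * s2)\<^sup>2 / 8)"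
    proof -
      have "y\<^sup>2 / 2 = c\<^sup>2 * (c\<^sup>2 * ((t\<^sup>2 * s2)\<^sup>2 / 8))" by (simp add: y_def power2_eq_square)
      also have "\<dots> \<le> c\<^sup>2 * (r\<^sup>2 * ((t\<^sup>2 * s2)\<^sup>2 / 8))"
        by (intro mult_left_mono mult_right_mono r) auto
      finally show ?thesis by simp
    qed
    finally show ?thesis by (simp add: y_def power_mult_distrib distrib_left mult_ac)
  qed
  have bound: "cmod (char (distr M borel (\<lambda>x. \<Sum>j<m n. a n j * V j x)) t -
        complex_of_real (exp (- (t\<^sup>2 * ((\<Sum>j<m n. (a n j)\<^sup>2) * s2) / 2)))) \<le>
      (\<Sum>j<m n. (a n j)\<^sup>2) * (t\<^sup>2 * h (\<kappa> n * \<bar>t\<bar>) / 6 + (\<kappa> n)\<^sup>2 * (t\<^sup>2 * s2)\<^sup>2 / 8)" for n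
  proof -
    have "indep_vars (\<lambda>_. borel) (\<lambda>j x. a n j * V j x) {..<m n}"
      by (rule indep_vars_compose2[OF indep_vars_subset[OF indep]]) auto
    then have "char (distr M borel (\<lambda>x. \<Sum>j<m n. a n j * V j x)) t =
        (\<Prod>j<m n. char (distr M borel (\<lambda>x. a n j * V j x)) t)"
      by (rule char_distr_sum)
    also have "\<dots> = (\<Prod>j<m n. \<phi> (a n j * t))"
    proof (rule prod.cong[OF refl])
      fix j
      show "char (distr M borel (\<lambda>x. a n j * V j x)) t = \<phi> (a n j * t)"
        unfolding \<phi>_def distr[of j, symmetric] by (rule char_distr_cmult) measurable
    qed
    finally have 1: "char (distr M borel (\<lambda>x. \<Sum>j<m n. a n j * V j x)) t = (\<Prod>j<m n. \<phi> (a n j * t))" .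
    have 2: "complex_of_real (exp (- (t\<^sup>2 * ((\<Sum>j<m n. (a n j)\<^sup>2) * s2) / 2))) =
        (\<Prod>j<m n. complex_of_real (exp (- ((a n j * t)\<^sup>2 * s2 / 2))))"
      unfolding of_real_prod[symmetric]
      by (subst exp_sum[symmetric])
        (simp_all add: sum_negf sum_distrib_left sum_distrib_right sum_divide_distrib power_mult_distrib mult_ac)
    \<comment> \<open>All factors have modulus at most 1, so the difference of the products is at
      most the sum of the differences.\<close>
    have "cmod ((\<Prod>j<m n. \<phi> (a n j * t)) - (\<Prod>j<m n. complex_of_real (exp (- ((a n j * t)\<^sup>2 * s2 / 2))))) \<le>
        (\<Sum>j<m n. cmod (\<phi> (a n j * t) - complex_of_real (exp (- ((a n j * t)\<^sup>2 * s2 / 2)))))"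
      using s2 by (intro norm_prod_diff) (auto simp: \<phi>_def D.cmod_char_le_1)
    also have "\<dots> \<le> (\<Sum>j<m n. (a n j)\<^sup>2 * (t\<^sup>2 * h (\<kappa> n * \<bar>t\<bar>) / 6 + (\<kappa> n)\<^sup>2 * (t\<^sup>2 * s2)\<^sup>2 / 8))"
      by (intro sum_mono step \<kappa>)
    finally show ?thesis unfolding 1 2 by (simp add: sum_distrib_right)
  qed
  have \<kappa>0: "0 \<le> \<kappa> n" for n using \<kappa>(1)[of n 0] by linarith
  have "(\<lambda>n. h (\<kappa> n * \<bar>t\<bar>)) \<longlonglongrightarrow> expectation (\<lambda>x. 0)"
    unfolding h_def
  proof (rule integral_dominated_convergence[where w="\<lambda>x. 6 * (V 0 x)\<^sup>2"])
    show "AE x in M. (\<lambda>n. min (6 * (V 0 x)\<^sup>2) (\<kappa> n * \<bar>t\<bar> * \<bar>V 0 x\<bar> ^ 3)) \<longlonglongrightarrow> 0"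
    proof (rule AE_I2)
      fix x
      have "(\<lambda>n. \<kappa> n * \<bar>t\<bar> * \<bar>V 0 x\<bar> ^ 3) \<longlonglongrightarrow> 0"
        using \<kappa>(2) by (intro tendsto_mult_left_zero)
      then have "(\<lambda>n. min (6 * (V 0 x)\<^sup>2) (\<kappa> n * \<bar>t\<bar> * \<bar>V 0 x\<bar> ^ 3)) \<longlonglongrightarrow> min (6 * (V 0 x)\<^sup>2) 0"
        by (intro tendsto_intros)
      then show "(\<lambda>n. min (6 * (V 0 x)\<^sup>2) (\<kappa> n * \<bar>t\<bar> * \<bar>V 0 x\<bar> ^ 3)) \<longlonglongrightarrow> 0"
        by simp
    qed
    show "AE x in M. norm (min (6 * (V 0 x)\<^sup>2) (\<kappa> n * \<bar>t\<bar> * \<bar>V 0 x\<bar> ^ 3)) \<le> 6 * (V 0 x)\<^sup>2" for n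
      using \<kappa>0 by (intro AE_I2) auto
  qed (use V0 in auto)
  then have h0: "(\<lambda>n. h (\<kappa> n * \<bar>t\<bar>)) \<longlonglongrightarrow> 0" by simp
  have z: "(\<lambda>n. (\<Sum>j<m n. (a n j)\<^sup>2) * (t\<^sup>2 * h (\<kappa> n * \<bar>t\<bar>) / 6 + (\<kappa> n)\<^sup>2 * (t\<^sup>2 * s2)\<^sup>2 / 8)) \<longlonglongrightarrow>
      s * (t\<^sup>2 * 0 / 6 + 0\<^sup>2 * (t\<^sup>2 * s2)\<^sup>2 / 8)"
    by (intro tendsto_intros a h0 \<kappa>(2)) auto
  have "(\<lambda>n. complex_of_real (exp (- (t\<^sup>2 * ((\<Sum>j<m n. (a n j)\<^sup>2) * s2) / 2)))) \<longlonglongrightarrow>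
      complex_of_real (exp (- (t\<^sup>2 * (s * s2) / 2)))"
    by (intro tendsto_intros a) auto
  moreover have "(\<lambda>n. char (distr M borel (\<lambda>x. \<Sum>j<m n. a n j * V j x)) t -
        complex_of_real (exp (- (t\<^sup>2 * ((\<Sum>j<m n. (a n j)\<^sup>2) * s2) / 2)))) \<longlonglongrightarrow> 0"
    by (rule Lim_null_comparison[OF always_eventually]) (use bound z in auto)
  ultimately show ?thesis
    unfolding s2_def[symmetric] by (rule Lim_transform)
qed

section \<open>Riemann sums of functions of bounded variation\<close>

text \<open>\<open>bounded_variation\<close> with its bound named, since the bound enters the error
  terms.\<close>

definition variation_le :: "(real \<Rightarrow> real) \<Rightarrow> real \<Rightarrow> bool" where
  "variation_le f V \<longleftrightarrow> (\<forall>n (x :: nat \<Rightarrow> real). mono x \<longrightarrow> (\<Sum>i<n. \<bar>f (x (Suc i)) - f (x i)\<bar>) \<le> V)"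

lemma variation_le_compose:
  assumes "variation_le f V" "0 \<le> c" "\<And>x y. \<bar>\<phi> (f x) - \<phi> (f y)\<bar> \<le> c * \<bar>f x - f y\<bar>"
  shows "variation_le (\<lambda>x. \<phi> (f x)) (c * V)"
  unfolding variation_le_def
proof (intro allI impI)
  fix n and x :: "nat \<Rightarrow> real" assume "mono x"
  have "(\<Sum>i<n. \<bar>\<phi> (f (x (Suc i))) - \<phi> (f (x i))\<bar>) \<le> (\<Sum>i<n. c * \<bar>f (x (Suc i)) - f (x i)\<bar>)"
    by (intro sum_mono assms)
  also have "\<dots> \<le> c * V"
    using assms(1,2) \<open>mono x\<close> by (auto simp: variation_le_def sum_distrib_left[symmetric] intro!: mult_left_mono)
  finally show "(\<Sum>i<n. \<bar>\<phi> (f (x (Suc i))) - \<phi> (f (x i))\<bar>) \<le> c * V" .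
qed

text \<open>Interlacing makes \<open>a\<close> and \<open>c\<close> the even and odd entries of one
  monotone sequence; the differences in question are every second increment of \<open>f\<close>
  along it.\<close>

lemma variation_le_interlaced:
  assumes V: "variation_le f V" and ac: "\<And>j. a j \<le> c j" "\<And>j. c j \<le> a (Suc j)"
  shows "(\<Sum>j<m. \<bar>f (c j) - f (a j)\<bar>) \<le> V"
proof -
  define z where "z i = (if even i then a (i div 2) else c (i div 2))" for i
  have "mono z"
  proof (rule incseq_SucI)
    fix i show "z i \<le> z (Suc i)" using ac[of "i div 2"] by (cases "even i") (auto simp: z_def)
  qed
  have "(\<Sum>j<m. \<bar>f (c j) - f (a j)\<bar>) \<le> (\<Sum>i<2 * m. \<bar>f (z (Suc i)) - f (z i)\<bar>)"
    by (induction m) (auto simp: z_def)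
  also have "\<dots> \<le> V" using V \<open>mono z\<close> by (auto simp: variation_le_def)
  finally show ?thesis .
qed

text \<open>For a fixed offset \<open>y\<close> in [0, h) the grid and the grid moved by
  \<open>y\<close> interlace, so their values of \<open>f\<close> differ by at most \<open>V\<close>
  in total; integrating over \<open>y\<close> gives h V. Jumps of \<open>f\<close> are thereby
  allowed.\<close>

lemma riemann_sum_variation:
  assumes V: "variation_le f V" and int: "integrable lborel f"
    and supp: "\<And>x. x \<notin> {-1/2..1/2} \<Longrightarrow> f x = 0"
    and h: "0 < h" and x0: "x0 \<le> -1/2" "1/2 \<le> x0 + real m * h"
  shows "\<bar>h * (\<Sum>j<m. f (x0 + real j * h)) - (LINT x|lborel. f x)\<bar> \<le> h * V"
proof -
  have [measurable]: "f \<in> borel_measurable borel" using int by auto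
  let ?I = "\<lambda>j. {x0 + real j * h ..< x0 + real (Suc j) * h}"
  have fI: "integrable lborel (\<lambda>x. indicator A x * f x)" if "A \<in> sets borel" for A
    using integrable_real_mult_indicator[of A lborel f] int that by (simp add: mult.commute)
  have shift: "integrable lborel (\<lambda>y. indicator {0..<h} y * f (x0 + real j * h + y))"
    "(LINT x|lborel. indicator (?I j) x * f x) = (LINT y|lborel. indicator {0..<h} y * f (x0 + real j * h + y))" for j
  proof -
    have e: "indicator (?I j) (x0 + real j * h + y) = (indicator {0..<h} y :: real)" for y
      by (auto simp: indicator_def algebra_simps)
    show "integrable lborel (\<lambda>y. indicator {0..<h} y * f (x0 + real j * h + y))"
      using lborel_integrable_real_affine[OF fI[of "?I j"], of 1 "x0 + real j * h"] by (simp add: e del: of_nat_Suc)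
    show "(LINT x|lborel. indicator (?I j) x * f x) = (LINT y|lborel. indicator {0..<h} y * f (x0 + real j * h + y))"
      using lborel_integral_real_affine[of 1 "\<lambda>x. indicator (?I j) x * f x" "x0 + real j * h"] by (simp add: e del: of_nat_Suc)
  qed
  have part: "(\<Sum>j<k. indicator (?I j) x) = (indicator {x0..<x0 + real k * h} x :: real)" for x k
  proof (induction k)
    case (Suc k)
    define r where "r = real k * h"
    have r: "0 \<le> r" using h by (simp add: r_def)
    have e: "x0 + real (Suc k) * h = x0 + r + h" by (simp add: r_def distrib_right)
    have "indicator {x0..<x0 + r + h} x = (indicator {x0..<x0 + r} x + indicator {x0 + r..<x0 + r + h} x :: real)"
      using r h by (auto simp: indicator_def)
    then have "indicator {x0..<x0 + real (Suc k) * h} x = (indicator {x0..<x0 + real k * h} x + indicator (?I k) x :: real)"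
      unfolding e r_def[symmetric] .
    then show ?case using Suc by simp
  qed simp
  have "(LINT x|lborel. f x) = (LINT x|lborel. (\<Sum>j<m. indicator (?I j) x * f x))"
  proof (rule integral_cong_AE)
    \<comment> \<open>The cells are half-open and may end at 1/2, a point where \<open>f\<close>
      need not vanish; hence equality almost everywhere.\<close>
    show "AE x in lborel. f x = (\<Sum>j<m. indicator (?I j) x * f x)"
      using AE_lborel_singleton[of "1/2"]
    proof eventually_elim
      case (elim x)
      show ?case
      proof (cases "x \<in> {x0..<x0 + real m * h}")
        case False
        then have "f x = 0" using x0 elim by (intro supp) auto
        then show ?thesis by simp
      next
        case True
        then show ?thesis unfolding sum_distrib_right[symmetric] part by simp
      qed
    qed
  qed auto
  also have "\<dots> = (\<Sum>j<m. LINT y|lborel. indicator {0..<h} y * f (x0 + real j * h + y))"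
    unfolding shift(2)[symmetric] by (intro Bochner_Integration.integral_sum fI) simp
  finally have 1: "(LINT x|lborel. f x) = (\<Sum>j<m. LINT y|lborel. indicator {0..<h} y * f (x0 + real j * h + y))" .
  have ih: "integrable lborel (\<lambda>y. indicator {0..<h} y * c)" "(LINT y|lborel. indicator {0..<h} y * c) = h * c" for c :: real
    using h by (auto simp: mult.commute[of _ c])
  have 2: "h * (\<Sum>j<m. f (x0 + real j * h)) = (\<Sum>j<m. LINT y|lborel. indicator {0..<h} y * f (x0 + real j * h))"
    by (simp only: ih sum_distrib_left)
  let ?A = "\<lambda>j y. indicator {0..<h} y * f (x0 + real j * h)"
  let ?B = "\<lambda>j y. indicator {0..<h} y * f (x0 + real j * h + y)"
  have AB: "integrable lborel (\<lambda>y. ?A j y - ?B j y)" for j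
    by (rule Bochner_Integration.integrable_diff[OF ih(1) shift(1)])
  have "h * (\<Sum>j<m. f (x0 + real j * h)) - (LINT x|lborel. f x) = (\<Sum>j<m. (LINT y|lborel. ?A j y) - (LINT y|lborel. ?B j y))"
    unfolding 1 2 by (rule sum_subtractf[symmetric])
  also have "\<dots> = (\<Sum>j<m. LINT y|lborel. ?A j y - ?B j y)"
    by (rule sum.cong[OF refl], rule Bochner_Integration.integral_diff[OF ih(1) shift(1), symmetric])
  also have "\<dots> = (LINT y|lborel. (\<Sum>j<m. ?A j y - ?B j y))"
    by (rule Bochner_Integration.integral_sum[where f="\<lambda>j y. ?A j y - ?B j y", symmetric]) (rule AB)
  finally have 3: "h * (\<Sum>j<m. f (x0 + real j * h)) - (LINT x|lborel. f x) = (LINT y|lborel. (\<Sum>j<m. ?A j y - ?B j y))" .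
  have "\<bar>h * (\<Sum>j<m. f (x0 + real j * h)) - (LINT x|lborel. f x)\<bar> \<le> (LINT y|lborel. \<bar>\<Sum>j<m. ?A j y - ?B j y\<bar>)"
    unfolding 3 by (rule integral_abs_bound)
  also have "\<dots> \<le> (LINT y|lborel. indicator {0..<h} y * V)"
  proof (rule integral_mono)
    fix y
    show "\<bar>\<Sum>j<m. indicator {0..<h} y * f (x0 + real j * h) - indicator {0..<h} y * f (x0 + real j * h + y)\<bar> \<le> indicator {0..<h} y * V"
    proof (cases "y \<in> {0..<h}")
      case True
      have "\<bar>\<Sum>j<m. f (x0 + real j * h) - f (x0 + real j * h + y)\<bar> \<le> (\<Sum>j<m. \<bar>f (x0 + real j * h + y) - f (x0 + real j * h)\<bar>)"
        by (rule order_trans[OF sum_abs]) (simp add: abs_minus_commute)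
      also have "\<dots> \<le> V"
        using True by (intro variation_le_interlaced[OF V]) (auto simp: algebra_simps)
      finally show ?thesis using True by simp
    qed simp
  qed (rule integrable_abs, rule Bochner_Integration.integrable_sum, rule AB, rule ih(1))
  finally show ?thesis unfolding ih .
qed

text \<open>Time is shifted by one: the index \<open>\<tau>\<close> stands for \<open>t = \<tau> + 1\<close>.\<close>

definition grid :: "(nat \<Rightarrow> real) \<Rightarrow> real \<Rightarrow> nat \<Rightarrow> nat \<Rightarrow> real" where
  "grid b u n \<tau> = ((real \<tau> + 1) / real n - u) / b n"

section \<open>Kernel window around an interior point and sums over its grid\<close>

locale bandwidth =
  fixes b :: "nat \<Rightarrow> real" and u :: real
  assumes b0: "b \<longlonglongrightarrow> 0" and nb: "filterlim (\<lambda>n. real n * b n) at_top sequentially"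
    and u: "0 < u" "u < 1"
begin

lemma eventually_nb_pos: "\<forall>\<^sub>F n in sequentially. 0 < real n * b n"
  using nb by (simp add: filterlim_at_top_dense)

lemma eventually_b_pos: "\<forall>\<^sub>F n in sequentially. 0 < b n \<and> 0 < n"
  using eventually_nb_pos by eventually_elim (auto simp: zero_less_mult_iff)

text \<open>\<open>u\<close> is interior and the window has width \<open>b n\<close>, so any fixed
  number of initial times eventually falls outside the support of the kernel. This disposes of the
  times at which a lagged vector reaches back before time 1.\<close>

lemma eventually_grid_left: "\<forall>\<^sub>F n in sequentially. grid b u n l < -1/2"
proof -
  have "(\<lambda>n. (real l + 1) / real n + b n / 2) \<longlonglongrightarrow> 0 + 0 / 2"
    by (intro tendsto_intros b0 tendsto_divide_0[OF tendsto_const] filterlim_at_top_imp_at_infinity filterlim_real_sequentially) auto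
  then have "\<forall>\<^sub>F n in sequentially. (real l + 1) / real n + b n / 2 < u"
    using u by (intro order_tendstoD(2)) auto
  with eventually_b_pos show ?thesis
    by eventually_elim (auto simp: grid_def field_simps)
qed

lemma eventually_grid_right: "\<forall>\<^sub>F n in sequentially. \<forall>\<tau>\<ge>n. grid b u n \<tau> > 1/2"
proof -
  have "\<forall>\<^sub>F n in sequentially. b n < 2 * (1 - u)"
    using u by (intro order_tendstoD(2)[OF b0]) auto
  with eventually_b_pos show ?thesis
  proof eventually_elim
    case (elim n)
    show ?case
    proof (intro allI impI)
      fix \<tau> assume "n \<le> \<tau>"
      then have "1 \<le> (real \<tau> + 1) / real n" using elim by (simp add: field_simps)
      then have "(1 - u) / b n \<le> grid b u n \<tau>"
        unfolding grid_def using elim by (intro divide_right_mono) auto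
      moreover have "1/2 < (1 - u) / b n" using elim by (simp add: field_simps)
      ultimately show "grid b u n \<tau> > 1/2" by linarith
    qed
  qed
qed

lemma grid_add: "grid b u n (j * L + l) = grid b u n l + real j * (real L / (real n * b n))"
  by (simp add: grid_def field_simps add_divide_distrib diff_divide_distrib)

text \<open>Every \<open>L\<close>-th grid point gives mesh L / (n b). The
  \<open>n div L + 1\<close> cells reach past time \<open>n\<close>, where the grid has left the
  support, so the whole support is covered.\<close>

lemma riemann_tendsto:
  assumes V: "variation_le f V" and int: "integrable lborel f"
    and supp: "\<And>x. x \<notin> {-1/2..1/2} \<Longrightarrow> f x = 0" and L: "0 < L"
  shows "(\<lambda>n. (\<Sum>j<n div L + 1. f (grid b u n (j * L + l))) / (real n * b n)) \<longlonglongrightarrow> (LINT x|lborel. f x) / real L"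
proof -
  have "(\<lambda>n. (\<Sum>j<n div L + 1. f (grid b u n (j * L + l))) / (real n * b n) - (LINT x|lborel. f x) / real L) \<longlonglongrightarrow> 0"
  proof (rule Lim_null_comparison)
    show "(\<lambda>n. V / (real n * b n)) \<longlonglongrightarrow> 0"
      by (intro tendsto_divide_0[OF tendsto_const] filterlim_at_top_imp_at_infinity nb)
    show "\<forall>\<^sub>F n in sequentially. norm ((\<Sum>j<n div L + 1. f (grid b u n (j * L + l))) / (real n * b n) - (LINT x|lborel. f x) / real L) \<le> V / (real n * b n)"
      using eventually_nb_pos eventually_grid_left[of l] eventually_grid_right
    proof eventually_elim
      case (elim n)
      define h where "h = real L / (real n * b n)"
      have h: "0 < h" using L elim by (simp add: h_def)
      have "n \<le> (n div L + 1) * L + l"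
        using div_mult_mod_eq[of n L] mod_less_divisor[OF L, of n] unfolding distrib_right by linarith
      then have "1/2 < grid b u n ((n div L + 1) * L + l)" using elim by blast
      then have r: "1/2 \<le> grid b u n l + real (n div L + 1) * h"
        unfolding grid_add h_def by simp
      have "\<bar>h * (\<Sum>j<n div L + 1. f (grid b u n l + real j * h)) - (LINT x|lborel. f x)\<bar> \<le> h * V"
        using elim r by (intro riemann_sum_variation[OF V int supp h]) auto
      then have "\<bar>h * (\<Sum>j<n div L + 1. f (grid b u n (j * L + l))) - (LINT x|lborel. f x)\<bar> / real L \<le> h * V / real L"
        unfolding grid_add h_def[symmetric] by (intro divide_right_mono) auto
      also have "h * V / real L = V / (real n * b n)" using L by (simp add: h_def)
      also have "\<bar>h * (\<Sum>j<n div L + 1. f (grid b u n (j * L + l))) - (LINT x|lborel. f x)\<bar> / real L =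
          \<bar>(h * (\<Sum>j<n div L + 1. f (grid b u n (j * L + l))) - (LINT x|lborel. f x)) / real L\<bar>"
        by simp
      also have "(h * (\<Sum>j<n div L + 1. f (grid b u n (j * L + l))) - (LINT x|lborel. f x)) / real L =
         (\<Sum>j<n div L + 1. f (grid b u n (j * L + l))) / (real n * b n) - (LINT x|lborel. f x) / real L"
        using L by (simp add: h_def diff_divide_distrib)
      finally show ?case by simp
    qed
  qed
  then show ?thesis by (simp add: LIM_zero_iff)
qed

text \<open>For a fixed position \<open>l\<close> the points \<open>j * L\<close> and
  \<open>j * L + l\<close> interlace over \<open>j\<close> and cost at most \<open>V\<close>; there
  are \<open>L\<close> positions.\<close>

lemma block_oscillation:
  assumes V: "variation_le f V" and b: "0 < b n" "0 < n"
  shows "(\<Sum>j<m. \<Sum>l<L. \<bar>f (grid b u n (j * L + l)) - f (grid b u n (j * L))\<bar>) \<le> real L * V"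
proof -
  have mono: "grid b u n \<tau> \<le> grid b u n \<tau>'" if "\<tau> \<le> \<tau>'" for \<tau> \<tau>'
    unfolding grid_def using that b by (intro divide_right_mono diff_right_mono) auto
  have "(\<Sum>j<m. \<Sum>l<L. \<bar>f (grid b u n (j * L + l)) - f (grid b u n (j * L))\<bar>) =
      (\<Sum>l<L. \<Sum>j<m. \<bar>f (grid b u n (j * L + l)) - f (grid b u n (j * L))\<bar>)"
    by (rule sum.swap)
  also have "\<dots> \<le> (\<Sum>l<L. V)"
    by (intro sum_mono variation_le_interlaced[OF V] mono) auto
  finally show ?thesis by simp
qed

end

section \<open>Causal processes with summable influences\<close>

lemma cesaro_mean:
  fixes a :: "nat \<Rightarrow> real"
  assumes "a \<longlonglongrightarrow> l"
  shows "(\<lambda>n. (\<Sum>i<n. a i) / real n) \<longlonglongrightarrow> l"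
proof (rule LIMSEQ_I)
  fix e :: real assume e: "0 < e"
  obtain N where N: "\<And>n. N \<le> n \<Longrightarrow> norm (a n - l) < e / 2"
    using LIMSEQ_D[OF assms, of "e / 2"] e by auto
  define c where "c = (\<Sum>i<N. \<bar>a i - l\<bar>)"
  have c: "0 \<le> c" by (auto simp: c_def intro: sum_nonneg)
  show "\<exists>n0. \<forall>n\<ge>n0. norm ((\<Sum>i<n. a i) / real n - l) < e"
  proof (intro exI[of _ "max N (nat \<lceil>2 * c / e\<rceil> + 1)"] allI impI)
    fix n assume n: "max N (nat \<lceil>2 * c / e\<rceil> + 1) \<le> n"
    then have n': "N \<le> n" "2 * c / e < real n" "0 < n" by linarith+
    have "\<bar>\<Sum>i<n. a i - l\<bar> \<le> (\<Sum>i<n. \<bar>a i - l\<bar>)" by (rule sum_abs)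
    also have "\<dots> = c + (\<Sum>i\<in>{N..<n}. \<bar>a i - l\<bar>)"
      unfolding c_def using n'(1) by (simp add: lessThan_atLeast0 sum.atLeastLessThan_concat)
    also have "(\<Sum>i\<in>{N..<n}. \<bar>a i - l\<bar>) \<le> (\<Sum>i\<in>{N..<n}. e / 2)"
      using N by (intro sum_mono less_imp_le) auto
    also have "(\<Sum>i\<in>{N..<n}. e / 2) \<le> real n * (e / 2)"
      using e by simp
    also have "c < real n * (e / 2)" using n'(2) e by (simp add: field_simps)
    finally have "\<bar>\<Sum>i<n. a i - l\<bar> < real n * e" by (simp add: mult.commute)
    moreover have "(\<Sum>i<n. a i) / real n - l = (\<Sum>i<n. a i - l) / real n"
      using n'(3) by (simp add: sum_subtractf field_simps)
    ultimately show "norm ((\<Sum>i<n. a i) / real n - l) < e"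
      using n'(3) by (simp add: divide_less_eq mult.commute)
  qed
qed

lemma sum_inj_le_suminf:
  fixes g :: "nat \<Rightarrow> real"
  assumes "summable g" "\<And>k. 0 \<le> g k" "finite A" "inj_on h A"
  shows "(\<Sum>i\<in>A. g (h i)) \<le> suminf g"
proof -
  have "(\<Sum>i\<in>A. g (h i)) = sum g (h ` A)" using assms(4) by (simp add: sum.reindex)
  also have "\<dots> \<le> suminf g" using assms by (intro sum_le_suminf) auto
  finally show ?thesis .
qed

text \<open>Argument \<open>k\<close> of \<open>f\<close> is the innovation \<open>k\<close> steps
  back. \<open>\<delta>\<close> is a bound instead of the influence itself, so that one summable
  sequence can serve a whole family of functions at once.\<close>

locale causal = prob_space M for M :: "'e measure" +
  fixes f :: "(nat \<Rightarrow> 'e) \<Rightarrow> real" and \<delta> :: "nat \<Rightarrow> real"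
  assumes f: "f \<in> L2 (iid M)" and f_mean: "(\<integral>x. f x \<partial>iid M) = 0"
    and f_infl: "infl M f k \<le> \<delta> k" and \<delta>_summable: "summable \<delta>"
begin

lemma \<delta>_nonneg: "0 \<le> \<delta> k"
  by (rule order_trans[OF infl_nonneg f_infl])

section \<open>Autocovariances of the stationary process\<close>

definition stat :: "int \<Rightarrow> (int \<Rightarrow> 'e) \<Rightarrow> real" where
  "stat t z = f (\<lambda>k. z (t - int k))"

definition acov :: "int \<Rightarrow> real" where
  "acov k = (\<integral>z. stat 0 z * stat k z \<partial>iid M)"

lemma inj_past: "inj (\<lambda>k. t - int k)"
  by (auto intro: injI)

lemma L2_stat: "stat t \<in> L2 (iid M)"
  unfolding stat_def[abs_def] by (rule L2_reindex[OF inj_past f])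

lemma mean_stat: "(\<integral>z. stat t z \<partial>iid M) = 0"
  unfolding stat_def using integral_reindex[OF inj_past L2_measurable[OF f]] f_mean by simp

lemma infl_stat: "infl M (stat t) s \<le> (if s \<le> t then \<delta> (nat (t - s)) else 0)"
proof (cases "s \<le> t")
  case True
  then have s: "s = t - int (nat (t - s))" by simp
  have "infl M (stat t) s = infl M f (nat (t - s))"
    unfolding stat_def[abs_def] by (subst (1) s) (rule infl_reindex[OF inj_past L2_measurable[OF f]])
  then show ?thesis using f_infl True by simp
next
  case False
  then have "s \<notin> range (\<lambda>k. t - int k)" by auto
  then have "infl M (stat t) s = 0"
    unfolding stat_def[abs_def] by (rule infl_reindex_0[where f=f and h="\<lambda>k. t - int k"])
  then show ?thesis using False by simp
qed

lemma acov_shift: "(\<integral>z. stat s z * stat t z \<partial>iid M) = acov (t - s)"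
proof -
  have "(\<integral>z. stat 0 (\<lambda>i. z (i + s)) * stat (t - s) (\<lambda>i. z (i + s)) \<partial>iid M) = acov (t - s)"
    unfolding acov_def
    by (rule integral_reindex[where f="\<lambda>z. stat 0 z * stat (t - s) z"])
      (auto intro: injI borel_measurable_times L2_measurable L2_stat)
  then show ?thesis by (simp add: stat_def algebra_simps)
qed

lemma acov_minus: "acov (- k) = acov k"
  using acov_shift[of k 0] by (simp add: acov_def mult.commute)

lemma summable_shifted_product: "summable (\<lambda>j. \<delta> j * \<delta> (k + j))"
proof -
  have "\<delta> i \<le> suminf \<delta>" for i
    using sum_inj_le_suminf[OF \<delta>_summable \<delta>_nonneg, of "{i}" "\<lambda>i. i"] by simp
  then show ?thesis
    by (intro summable_comparison_test[OF _ summable_mult2[OF \<delta>_summable, of "suminf \<delta>"]])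
      (auto simp: \<delta>_nonneg abs_mult intro!: mult_left_mono)
qed

text \<open>The innovation at time -j acts on time 0 at lag \<open>j\<close> and on time
  \<open>k\<close> at lag \<open>k + j\<close>; innovations after time 0 do not act on time 0 at
  all.\<close>

lemma acov_bound: "\<bar>acov (int k)\<bar> \<le> (\<Sum>j. \<delta> j * \<delta> (k + j))"
proof -
  have "\<bar>acov (int k)\<bar> = \<bar>(\<integral>z. stat 0 z * stat (int k) z \<partial>iid M) -
      (\<integral>z. stat 0 z \<partial>iid M) * (\<integral>z. stat (int k) z \<partial>iid M)\<bar>"
    by (simp add: acov_def mean_stat)
  also have "\<dots> \<le> (\<Sum>j. \<delta> j * \<delta> (k + j))"
  proof (rule covariance_bound[OF L2_stat L2_stat])
    fix J :: "int set" assume J: "finite J"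
    have "(\<Sum>i\<in>J. infl M (stat 0) i * infl M (stat (int k)) i) \<le>
        (\<Sum>i\<in>J. if i \<le> 0 then \<delta> (nat (- i)) * \<delta> (k + nat (- i)) else 0)"
    proof (rule sum_mono)
      fix i
      have "infl M (stat 0) i * infl M (stat (int k)) i \<le>
          (if i \<le> 0 then \<delta> (nat (0 - i)) else 0) * (if i \<le> int k then \<delta> (nat (int k - i)) else 0)"
        by (intro mult_mono infl_stat) (auto simp: \<delta>_nonneg)
      also have "\<dots> = (if i \<le> 0 then \<delta> (nat (- i)) * \<delta> (k + nat (- i)) else 0)"
      proof (cases "i \<le> 0")
        case True
        then have "nat (int k - i) = k + nat (- i)" "i \<le> int k" by linarith+
        then show ?thesis using True by simp
      qed simp
      finally show "infl M (stat 0) i * infl M (stat (int k)) i \<le> \<dots>" .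
    qed
    also have "\<dots> = (\<Sum>i\<in>{i \<in> J. i \<le> 0}. \<delta> (nat (- i)) * \<delta> (k + nat (- i)))"
      using J by (simp add: sum.inter_filter)
    also have "\<dots> \<le> (\<Sum>j. \<delta> j * \<delta> (k + j))"
      using J by (intro sum_inj_le_suminf[OF summable_shifted_product, where h="\<lambda>i. nat (- i)"])
        (auto simp: \<delta>_nonneg inj_on_def)
    finally show "(\<Sum>i\<in>J. infl M (stat 0) i * infl M (stat (int k)) i) \<le> (\<Sum>j. \<delta> j * \<delta> (k + j))" .
  qed
  finally show ?thesis .
qed

lemma summable_acov: "summable (\<lambda>k. \<bar>acov (int k)\<bar>)"
proof (rule summableI_nonneg_bounded)
  fix n
  have s': "summable (\<lambda>j. \<Sum>k<n. \<delta> j * \<delta> (k + j))"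
    by (intro summable_sum summable_shifted_product)
  have "(\<Sum>k<n. \<bar>acov (int k)\<bar>) \<le> (\<Sum>k<n. \<Sum>j. \<delta> j * \<delta> (k + j))"
    by (intro sum_mono acov_bound)
  also have "\<dots> = (\<Sum>j. \<Sum>k<n. \<delta> j * \<delta> (k + j))"
    by (rule suminf_sum[symmetric]) (rule summable_shifted_product)
  also have "\<dots> \<le> (\<Sum>j. \<delta> j * suminf \<delta>)"
  proof (rule suminf_le[OF _ s' summable_mult2[OF \<delta>_summable]])
    fix j
    have "(\<Sum>k<n. \<delta> (k + j)) \<le> suminf \<delta>"
      by (rule sum_inj_le_suminf[OF \<delta>_summable \<delta>_nonneg]) auto
    then show "(\<Sum>k<n. \<delta> j * \<delta> (k + j)) \<le> \<delta> j * suminf \<delta>"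
      by (simp add: sum_distrib_left[symmetric] mult_left_mono \<delta>_nonneg)
  qed
  finally show "(\<Sum>k<n. \<bar>acov (int k)\<bar>) \<le> (\<Sum>j. \<delta> j * suminf \<delta>)" .
qed simp

text \<open>Absolute summability gives the unordered sum over the integers. It is written as two
  one-sided series because their partial sums are the increments of
  \<open>block_var\<close>.\<close>

lemma acov_has_sum:
  "(acov has_sum ((\<Sum>k. acov (int k)) + (\<Sum>k. acov (int (Suc k))))) UNIV"
proof -
  have a: "((\<lambda>k. acov (int k)) has_sum (\<Sum>k. acov (int k))) UNIV"
    by (rule norm_summable_imp_has_sum) (use summable_acov summable_rabs_cancel in \<open>auto intro: summable_sums\<close>)
  have "summable (\<lambda>k. \<bar>acov (int (Suc k))\<bar>)"
    using summable_acov summable_Suc_iff[of "\<lambda>k. \<bar>acov (int k)\<bar>"] by simp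
  then have b: "((\<lambda>k. acov (int (Suc k))) has_sum (\<Sum>k. acov (int (Suc k)))) UNIV"
    by (intro norm_summable_imp_has_sum) (use summable_rabs_cancel in \<open>auto intro: summable_sums\<close>)
  have "(acov has_sum (\<Sum>k. acov (int k))) (range int)"
    using a by (subst has_sum_reindex) (auto simp: o_def)
  moreover have "(acov has_sum (\<Sum>k. acov (int (Suc k)))) (range (\<lambda>k. - int (Suc k)))"
    using b by (subst has_sum_reindex) (auto simp: o_def acov_minus[of "int (Suc _)"] intro: injI simp del: of_nat_Suc)
  moreover have "range int \<inter> range (\<lambda>k. - int (Suc k)) = {}" by auto
  moreover have "range int \<union> range (\<lambda>k. - int (Suc k)) = UNIV"
  proof -
    have "i \<in> range int \<union> range (\<lambda>k. - int (Suc k))" for i :: int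
      by (cases i) auto
    then show ?thesis by auto
  qed
  ultimately show ?thesis by (metis has_sum_Un_disjoint)
qed

section \<open>Variance of a block and the long-run variance\<close>

definition block_var :: "nat \<Rightarrow> real" where
  "block_var L = (\<integral>z. (\<Sum>l<L. stat (int l) z)\<^sup>2 \<partial>iid M)"

text \<open>The increments are partial sums of the two series for the long-run variance. Cesaro
  averaging then yields the limit of \<open>block_var L / real L\<close>, and with it the sign of
  the long-run variance.\<close>

lemma block_var_Suc:
  "block_var (Suc L) = block_var L + ((\<Sum>k<Suc L. acov (int k)) + (\<Sum>k<L. acov (int (Suc k))))"
proof -
  have i: "integrable (iid M) (\<lambda>z. stat s z * stat t z)" for s t
    by (rule L2_mult_integrable[OF L2_stat L2_stat])
  have i2: "integrable (iid M) (\<lambda>z. (\<Sum>l<L. stat (int l) z)\<^sup>2)"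
    by (intro L2_square_integrable L2_sum L2_stat)
  have refl: "(\<Sum>l<L. acov (int L - int l)) = (\<Sum>k<L. acov (int (Suc k)))"
    by (rule sum.reindex_bij_witness[where i="\<lambda>k. L - Suc k" and j="\<lambda>l. L - Suc l"]) (auto simp: of_nat_diff algebra_simps)
  have "block_var (Suc L) = (\<integral>z. (\<Sum>l<L. stat (int l) z)\<^sup>2 + (\<Sum>l<L. 2 * (stat (int l) z * stat (int L) z)) +
      stat (int L) z * stat (int L) z \<partial>iid M)"
    unfolding block_var_def
    by (intro Bochner_Integration.integral_cong) (simp_all add: power2_eq_square algebra_simps sum_distrib_left)
  also have "\<dots> = block_var L + (\<Sum>l<L. 2 * acov (int L - int l)) + acov 0"
    using i i2 by (simp add: block_var_def acov_shift)
  also have "(\<Sum>l<L. 2 * acov (int L - int l)) = 2 * (\<Sum>k<L. acov (int (Suc k)))"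
    by (simp only: sum_distrib_left[symmetric] refl)
  \<comment> \<open>Lag 0 is absorbed here: one of the two copies of the lags 1..L joins it to form
    the sum over \<open>k < Suc L\<close>.\<close>
  also have "acov 0 = (\<Sum>k<Suc L. acov (int k)) - (\<Sum>k<L. acov (int (Suc k)))"
    by (simp only: sum.lessThan_Suc_shift) simp
  finally show ?thesis by simp
qed

lemma block_var_limit:
  "(\<lambda>L. block_var L / real L) \<longlonglongrightarrow> (\<Sum>k. acov (int k)) + (\<Sum>k. acov (int (Suc k)))"
proof -
  let ?a = "\<lambda>L. (\<Sum>k<Suc L. acov (int k)) + (\<Sum>k<L. acov (int (Suc k)))"
  have e: "block_var L = (\<Sum>i<L. ?a i)" for L
    by (induction L) (simp_all only: sum.lessThan_Suc block_var_Suc, simp_all add: block_var_def)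
  have s: "summable (\<lambda>k. acov (int k))" using summable_acov by (rule summable_rabs_cancel)
  then have s': "summable (\<lambda>k. acov (int (Suc k)))" using summable_Suc_iff[of "\<lambda>k. acov (int k)"] by simp
  have "?a \<longlonglongrightarrow> (\<Sum>k. acov (int k)) + (\<Sum>k. acov (int (Suc k)))"
    using LIMSEQ_Suc[OF summable_LIMSEQ[OF s]] summable_LIMSEQ[OF s'] by (rule tendsto_add)
  from cesaro_mean[OF this] show ?thesis unfolding e .
qed

lemma long_run_nonneg: "0 \<le> (\<Sum>k. acov (int k)) + (\<Sum>k. acov (int (Suc k)))"
  by (rule LIMSEQ_le_const[OF block_var_limit]) (auto simp: block_var_def)

text \<open>Bounds the summed influences of a perturbation of \<open>L\<^sup>2\<close> norm at most \<open>c\<close>.\<close>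

definition trunc_infl :: "real \<Rightarrow> real" where
  "trunc_infl c = (\<Sum>k. min (2 * \<delta> k) (2 * c))"

lemma summable_trunc: "0 \<le> c \<Longrightarrow> summable (\<lambda>k. min (2 * \<delta> k) (2 * c))"
  by (rule summable_comparison_test[OF _ summable_mult[OF \<delta>_summable, of 2]]) (auto simp: \<delta>_nonneg)

lemma trunc_infl_nonneg: "0 \<le> c \<Longrightarrow> 0 \<le> trunc_infl c"
  unfolding trunc_infl_def by (intro suminf_nonneg summable_trunc) (auto simp: \<delta>_nonneg)

text \<open>Tannery's theorem with the majorant \<open>2 * \<delta> k\<close>. Any null sequence
  \<open>c\<close> will do, so summability of \<delta> suffices without a rate.\<close>

lemma trunc_infl_tendsto:
  assumes "c \<longlonglongrightarrow> 0" "\<And>n. 0 \<le> c n"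
  shows "(\<lambda>n. trunc_infl (c n)) \<longlonglongrightarrow> 0"
proof -
  have "(\<lambda>n. \<Sum>k. min (2 * \<delta> k) (2 * c n)) \<longlonglongrightarrow> (\<Sum>k. 0)"
  proof (rule tannerys_theorem[THEN conjunct2, THEN conjunct2])
    fix k
    have "(\<lambda>n. min (2 * \<delta> k) (2 * c n)) \<longlonglongrightarrow> min (2 * \<delta> k) (2 * 0)"
      by (intro tendsto_intros assms)
    then show "(\<lambda>n. min (2 * \<delta> k) (2 * c n)) \<longlonglongrightarrow> 0" by (simp add: \<delta>_nonneg)
  next
    show "\<forall>\<^sub>F (k, n) in at_top \<times>\<^sub>F sequentially. norm (min (2 * \<delta> k) (2 * c n)) \<le> 2 * \<delta> k"
      using assms(2) by (intro always_eventually) (auto simp: \<delta>_nonneg)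
  qed (auto intro: summable_mult \<delta>_summable)
  then show ?thesis by (simp add: trunc_infl_def)
qed

text \<open>The index set \<open>nat \<times> int\<close> carries the original innovations in component \<open>0\<close> and, in
  component \<open>Suc j\<close>, the fresh copies that replace the past of block \<open>j\<close>.\<close>

lemma block_variance_bound:
  fixes g :: "nat \<Rightarrow> (nat \<times> int \<Rightarrow> 'e) \<Rightarrow> real"
  assumes T: "finite T" and g: "\<And>\<tau>. \<tau> \<in> T \<Longrightarrow> g \<tau> \<in> L2 (iid M)"
    and c: "\<And>\<tau>. \<tau> \<in> T \<Longrightarrow> 0 \<le> c \<tau>"
    and infl: "\<And>\<tau> a s. \<tau> \<in> T \<Longrightarrow> infl M (g \<tau>) (a, s) \<le>
      (if s \<le> int \<tau> \<and> (a = 0 \<or> a = Suc (p \<tau>)) then min (2 * \<delta> (nat (int \<tau> - s))) (2 * c \<tau>) else 0)"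
  shows "(norm2 (iid M) (\<lambda>z. \<Sum>\<tau>\<in>T. w \<tau> * (g \<tau> z - (\<integral>z. g \<tau> z \<partial>iid M))))\<^sup>2 \<le>
    2 * suminf \<delta> * (\<Sum>\<tau>\<in>T. (w \<tau>)\<^sup>2 * (2 * trunc_infl (c \<tau>)))"
proof -
  define d where "d = (\<lambda>\<tau> (a, s). if s \<le> int \<tau> \<and> (a = 0 \<or> a = Suc (p \<tau>))
    then min (2 * \<delta> (nat (int \<tau> - s))) (2 * c \<tau>) else 0)"
  show ?thesis
  proof (rule variance_bound[where d=d])
    show "infl M (g \<tau>) i \<le> d \<tau> i" if "\<tau> \<in> T" for \<tau> i
      using infl[OF that, of "fst i" "snd i"] by (simp add: d_def case_prod_beta)
  next
    fix i :: "nat \<times> int"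
    obtain a s where i: "i = (a, s)" by (cases i)
    have "(\<Sum>\<tau>\<in>T. d \<tau> i) \<le> (\<Sum>\<tau>\<in>T. if s \<le> int \<tau> then 2 * \<delta> (nat (int \<tau> - s)) else 0)"
      by (intro sum_mono) (auto simp: d_def i \<delta>_nonneg)
    also have "\<dots> = (\<Sum>\<tau>\<in>{\<tau> \<in> T. s \<le> int \<tau>}. 2 * \<delta> (nat (int \<tau> - s)))"
      using T by (simp add: sum.inter_filter)
    also have "\<dots> \<le> (\<Sum>k. 2 * \<delta> k)"
      using T by (intro sum_inj_le_suminf summable_mult \<delta>_summable) (auto simp: \<delta>_nonneg inj_on_def)
    also have "\<dots> = 2 * suminf \<delta>" by (rule suminf_mult[OF \<delta>_summable])
    finally show "(\<Sum>\<tau>\<in>T. d \<tau> i) \<le> 2 * suminf \<delta>" .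
  next
    fix \<tau> and J :: "(nat \<times> int) set" assume \<tau>: "\<tau> \<in> T" and J: "finite J"
    let ?m = "\<lambda>k. min (2 * \<delta> k) (2 * c \<tau>)"
    \<comment> \<open>This is one component of the index set. A term reads two of them, the original
      innovations and the copies for its block, whence the factor 2.\<close>
    have part: "(\<Sum>i\<in>{i \<in> J. snd i \<le> int \<tau> \<and> fst i = a}. ?m (nat (int \<tau> - snd i))) \<le> trunc_infl (c \<tau>)" for a
      unfolding trunc_infl_def using J c[OF \<tau>]
      by (intro sum_inj_le_suminf summable_trunc) (auto simp: \<delta>_nonneg inj_on_def)
    have "(\<Sum>i\<in>J. d \<tau> i) = (\<Sum>i\<in>{i \<in> J. snd i \<le> int \<tau> \<and> (fst i = 0 \<or> fst i = Suc (p \<tau>))}. ?m (nat (int \<tau> - snd i)))"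
      using J by (subst sum.inter_filter) (auto simp: d_def case_prod_beta)
    also have "{i \<in> J. snd i \<le> int \<tau> \<and> (fst i = 0 \<or> fst i = Suc (p \<tau>))} =
        {i \<in> J. snd i \<le> int \<tau> \<and> fst i = 0} \<union> {i \<in> J. snd i \<le> int \<tau> \<and> fst i = Suc (p \<tau>)}" by auto
    also have "(\<Sum>i\<in>\<dots>. ?m (nat (int \<tau> - snd i))) =
        (\<Sum>i\<in>{i \<in> J. snd i \<le> int \<tau> \<and> fst i = 0}. ?m (nat (int \<tau> - snd i))) +
        (\<Sum>i\<in>{i \<in> J. snd i \<le> int \<tau> \<and> fst i = Suc (p \<tau>)}. ?m (nat (int \<tau> - snd i)))"
      using J by (intro sum.union_disjoint) auto
    also have "\<dots> \<le> 2 * trunc_infl (c \<tau>)" using part[of 0] part[of "Suc (p \<tau>)"] by simp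
    finally show "(\<Sum>i\<in>J. d \<tau> i) \<le> 2 * trunc_infl (c \<tau>)" .
  qed (rule g)
qed

end

section \<open>The blocking argument\<close>

locale kernel_weights = bandwidth +
  fixes K :: "real \<Rightarrow> real"
  assumes K: "kernel_assumption K"
begin

definition wgt :: "nat \<Rightarrow> nat \<Rightarrow> real" where
  "wgt n \<tau> = K (grid b u n \<tau>) / sqrt (real n * b n)"

lemma K_support: "x \<notin> {-1/2..1/2} \<Longrightarrow> K x = 0"
  using K by (simp add: kernel_assumption_def)

text \<open>The integral of a non-integrable function has the default value 0, so the clause that it
  equals 1 already contains integrability.\<close>

lemma K_integrable: "integrable lborel K"
proof (rule ccontr)
  assume "\<not> integrable lborel K"
  then have "(LINT x|lborel. K x) = 0" by (rule not_integrable_integral_eq)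
  then show False using K by (simp add: kernel_assumption_def)
qed

lemma K_bounded: obtains B where "0 \<le> B" "\<And>x. \<bar>K x\<bar> \<le> B"
proof -
  obtain B where "\<And>x. \<bar>K x\<bar> \<le> B"
    using K by (auto simp: kernel_assumption_def bounded_iff)
  then show thesis using that[of "\<bar>B\<bar>"] by (meson abs_ge_self abs_ge_zero order_trans)
qed

lemma K_variation: obtains V where "variation_le K V"
  using K by (auto simp: kernel_assumption_def bounded_variation_def variation_le_def)

lemma K_square: "integrable lborel (\<lambda>x. (K x)\<^sup>2)" "\<exists>V. variation_le (\<lambda>x. (K x)\<^sup>2) V"
proof -
  obtain B where B: "0 \<le> B" "\<And>x. \<bar>K x\<bar> \<le> B" using K_bounded by blast
  have sq: "norm ((K x)\<^sup>2) \<le> norm (B * \<bar>K x\<bar>)" for x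
    using mult_right_mono[OF B(2)[of x], of "\<bar>K x\<bar>"] B(1) by (simp add: power2_eq_square flip: abs_mult)
  have Km: "K \<in> borel_measurable lborel" using K_integrable by (rule borel_measurable_integrable)
  show "integrable lborel (\<lambda>x. (K x)\<^sup>2)"
  proof (rule Bochner_Integration.integrable_bound)
    show "integrable lborel (\<lambda>x. B * \<bar>K x\<bar>)"
      by (intro integrable_mult_right integrable_abs K_integrable)
    show "(\<lambda>x. (K x)\<^sup>2) \<in> borel_measurable lborel"
      by (intro borel_measurable_power Km)
    show "AE x in lborel. norm ((K x)\<^sup>2) \<le> norm (B * \<bar>K x\<bar>)"
      by (intro AE_I2 sq)
  qed
  obtain V where V: "variation_le K V" using K_variation by blast
  have "variation_le (\<lambda>x. (K x)\<^sup>2) (2 * B * V)"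
  proof (rule variation_le_compose[OF V, where \<phi>="\<lambda>y. y\<^sup>2"])
    fix x y
    have "\<bar>(K x)\<^sup>2 - (K y)\<^sup>2\<bar> = \<bar>K x + K y\<bar> * \<bar>K x - K y\<bar>"
      by (simp add: power2_eq_square algebra_simps flip: abs_mult)
    also have "\<dots> \<le> 2 * B * \<bar>K x - K y\<bar>"
      using B(2)[of x] B(2)[of y] by (intro mult_right_mono) auto
    finally show "\<bar>(K x)\<^sup>2 - (K y)\<^sup>2\<bar> \<le> 2 * B * \<bar>K x - K y\<bar>" .
  qed (use B in simp)
  then show "\<exists>V. variation_le (\<lambda>x. (K x)\<^sup>2) V" by blast
qed

text \<open>Each residue class modulo \<open>L\<close> receives the same share of the integral,
  whatever the offset \<open>l\<close>.\<close>

lemma wgt_square_tendsto: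
  assumes "0 < L"
  shows "(\<lambda>n. \<Sum>j<n div L + 1. (wgt n (j * L + l))\<^sup>2) \<longlonglongrightarrow> (LINT x|lborel. (K x)\<^sup>2) / real L"
proof (rule Lim_transform_eventually)
  obtain V where V: "variation_le (\<lambda>x. (K x)\<^sup>2) V" using K_square(2) by blast
  show "(\<lambda>n. (\<Sum>j<n div L + 1. (K (grid b u n (j * L + l)))\<^sup>2) / (real n * b n)) \<longlonglongrightarrow>
      (LINT x|lborel. (K x)\<^sup>2) / real L"
    by (rule riemann_tendsto[OF V K_square(1) _ assms]) (simp add: K_support)
  show "\<forall>\<^sub>F n in sequentially. (\<Sum>j<n div L + 1. (K (grid b u n (j * L + l)))\<^sup>2) / (real n * b n) =
      (\<Sum>j<n div L + 1. (wgt n (j * L + l))\<^sup>2)"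
    using eventually_nb_pos by eventually_elim (simp add: wgt_def power_divide sum_divide_distrib add_divide_distrib)
qed

lemma wgt_abs_tendsto:
  "(\<lambda>n. (\<Sum>\<tau><n + 1. \<bar>wgt n \<tau>\<bar>) / sqrt (real n * b n)) \<longlonglongrightarrow> (LINT x|lborel. \<bar>K x\<bar>)"
proof (rule Lim_transform_eventually)
  obtain V where V: "variation_le K V" using K_variation by blast
  have V': "variation_le (\<lambda>x. \<bar>K x\<bar>) (1 * V)"
    by (rule variation_le_compose[OF V]) auto
  have "(\<lambda>n. (\<Sum>j<n div 1 + 1. \<bar>K (grid b u n (j * 1 + 0))\<bar>) / (real n * b n)) \<longlonglongrightarrow>
      (LINT x|lborel. \<bar>K x\<bar>) / real 1"
    using K_integrable by (intro riemann_tendsto[OF V']) (auto simp: K_support)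
  then show "(\<lambda>n. (\<Sum>\<tau><n + 1. \<bar>K (grid b u n \<tau>)\<bar>) / (real n * b n)) \<longlonglongrightarrow> (LINT x|lborel. \<bar>K x\<bar>)"
    by simp
  show "\<forall>\<^sub>F n in sequentially. (\<Sum>\<tau><n + 1. \<bar>K (grid b u n \<tau>)\<bar>) / (real n * b n) =
      (\<Sum>\<tau><n + 1. \<bar>wgt n \<tau>\<bar>) / sqrt (real n * b n)"
    using eventually_nb_pos
    by eventually_elim (simp add: wgt_def sum_divide_distrib[symmetric] flip: real_sqrt_mult)
qed

lemma sqrt_nb: "filterlim (\<lambda>n. sqrt (real n * b n)) at_top sequentially"
  by (rule filterlim_compose[OF sqrt_at_top nb])

text \<open>Before normalisation the oscillation within blocks stays below \<open>L\<close> times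
  the variation of \<open>K\<close>; dividing by sqrt(n b) makes it vanish for fixed
  \<open>L\<close>. This is why \<open>n\<close> tends to infinity before \<open>L\<close>
  does.\<close>

lemma wgt_oscillation:
  "(\<lambda>n. \<Sum>j<n div L + 1. \<Sum>l<L. \<bar>wgt n (j * L + l) - wgt n (j * L)\<bar>) \<longlonglongrightarrow> 0"
proof -
  obtain V where V: "variation_le K V" using K_variation by blast
  show ?thesis
  proof (rule Lim_null_comparison)
    show "(\<lambda>n. real L * V / sqrt (real n * b n)) \<longlonglongrightarrow> 0"
      by (intro tendsto_divide_0[OF tendsto_const] filterlim_at_top_imp_at_infinity sqrt_nb)
    show "\<forall>\<^sub>F n in sequentially. norm (\<Sum>j<n div L + 1. \<Sum>l<L. \<bar>wgt n (j * L + l) - wgt n (j * L)\<bar>)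
        \<le> real L * V / sqrt (real n * b n)"
      using eventually_b_pos
    proof eventually_elim
      case (elim n)
      have "norm (\<Sum>j<n div L + 1. \<Sum>l<L. \<bar>wgt n (j * L + l) - wgt n (j * L)\<bar>) =
          (\<Sum>j<n div L + 1. \<Sum>l<L. \<bar>wgt n (j * L + l) - wgt n (j * L)\<bar>)"
        by (simp add: sum_nonneg)
      also have "\<dots> = (\<Sum>j<n div L + 1. \<Sum>l<L. \<bar>K (grid b u n (j * L + l)) - K (grid b u n (j * L))\<bar>) / sqrt (real n * b n)"
        using elim by (simp add: wgt_def sum_divide_distrib add_divide_distrib flip: diff_divide_distrib)
      also have "\<dots> \<le> real L * V / sqrt (real n * b n)"
        using elim by (intro divide_right_mono block_oscillation V) auto
      finally show ?case .
    qed
  qed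
qed

lemma wgt_max: obtains \<kappa> where "\<And>n \<tau>. \<bar>wgt n \<tau>\<bar> \<le> \<kappa> n" "\<kappa> \<longlonglongrightarrow> 0"
proof -
  obtain B where B: "0 \<le> B" "\<And>x. \<bar>K x\<bar> \<le> B" using K_bounded by blast
  have "(\<lambda>n. B / sqrt (real n * b n)) \<longlonglongrightarrow> 0"
    by (intro tendsto_divide_0[OF tendsto_const] filterlim_at_top_imp_at_infinity sqrt_nb)
  \<comment> \<open>The bound must hold for all \<open>n\<close>, including the finitely many with n
    b < 0, where the real \<open>sqrt\<close> is negative.\<close>
  from tendsto_rabs_zero[OF this] have "(\<lambda>n. \<bar>B / sqrt (real n * b n)\<bar>) \<longlonglongrightarrow> 0" .
  moreover have "\<bar>wgt n \<tau>\<bar> \<le> \<bar>B / sqrt (real n * b n)\<bar>" for n \<tau>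
    unfolding wgt_def abs_divide using B by (intro divide_right_mono) auto
  ultimately show thesis by (rule that[rotated])
qed

lemma wgt_zero: "\<forall>\<^sub>F n in sequentially. \<forall>\<tau>\<ge>n. wgt n \<tau> = 0"
  using eventually_grid_right
proof eventually_elim
  case (elim n)
  show ?case
  proof (intro allI impI)
    fix \<tau> assume "n \<le> \<tau>"
    then have "1/2 < grid b u n \<tau>" using elim by blast
    then show "wgt n \<tau> = 0" by (simp add: wgt_def K_support)
  qed
qed

end

section \<open>Coupling with independent blocks\<close>

locale kernel_clt = causal M f \<delta> + kernel_weights b u K
  for M :: "'e measure" and f \<delta> b u K
begin

text \<open>\<open>s\<close> counts from the start of block \<open>j\<close>; negative
  \<open>s\<close> leads to the copies reserved for that block. The second component remains
  absolute time, so that the influences of \<open>blk\<close> and \<open>orig\<close> are indexed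
  alike.\<close>

definition fresh :: "nat \<Rightarrow> nat \<Rightarrow> int \<Rightarrow> nat \<times> int" where
  "fresh L j s = (if 0 \<le> s then 0 else Suc j, int (j * L) + s)"

lemma inj_fresh: "inj (fresh L j)"
  by (auto simp: fresh_def intro!: injI)

definition orig :: "nat \<Rightarrow> (nat \<times> int \<Rightarrow> 'e) \<Rightarrow> real" where
  "orig \<tau> z = stat (int \<tau>) (\<lambda>s. z (0, s))"

definition blk :: "nat \<Rightarrow> nat \<Rightarrow> (nat \<times> int \<Rightarrow> 'e) \<Rightarrow> real" where
  "blk L \<tau> z = stat (int (\<tau> mod L)) (\<lambda>s. z (fresh L (\<tau> div L) s))"

lemma inj_zero: "inj (\<lambda>s. (0, s))"
  by (auto intro: injI)

lemma L2_orig: "orig \<tau> \<in> L2 (iid M)"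
  unfolding orig_def[abs_def] by (rule L2_reindex[OF inj_zero L2_stat])

lemma L2_blk: "blk L \<tau> \<in> L2 (iid M)"
  unfolding blk_def[abs_def] by (rule L2_reindex[OF inj_fresh L2_stat])

lemma mean_orig: "(\<integral>z. orig \<tau> z \<partial>iid M) = 0"
  unfolding orig_def using integral_reindex[OF inj_zero L2_measurable[OF L2_stat]] mean_stat by simp

lemma mean_blk: "(\<integral>z. blk L \<tau> z \<partial>iid M) = 0"
  unfolding blk_def using integral_reindex[OF inj_fresh L2_measurable[OF L2_stat]] mean_stat by simp

lemma infl_orig: "infl M (orig \<tau>) (a, s) \<le> (if s \<le> int \<tau> \<and> (a = 0 \<or> a = Suc (\<tau> div L)) then \<delta> (nat (int \<tau> - s)) else 0)"
proof (cases "a = 0")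
  case True
  have "infl M (orig \<tau>) (0, s) = infl M (stat (int \<tau>)) s"
    unfolding orig_def[abs_def] by (rule infl_reindex[OF inj_zero L2_measurable[OF L2_stat]])
  then show ?thesis using infl_stat[of "int \<tau>" s] True by simp
next
  case False
  then have "(a, s) \<notin> range (\<lambda>s. (0, s))" by auto
  then have "infl M (orig \<tau>) (a, s) = 0"
    unfolding orig_def[abs_def] by (rule infl_reindex_0[where h="\<lambda>s. (0, s)" and f="stat (int \<tau>)"])
  then show ?thesis by (simp add: \<delta>_nonneg)
qed

lemma infl_blk:
  "infl M (blk L \<tau>) (a, s) \<le> (if s \<le> int \<tau> \<and> (a = 0 \<or> a = Suc (\<tau> div L)) then \<delta> (nat (int \<tau> - s)) else 0)"
proof (cases "(a, s) \<in> range (fresh L (\<tau> div L))")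
  case True
  then obtain r where r: "(a, s) = fresh L (\<tau> div L) r" by auto
  have "infl M (blk L \<tau>) (a, s) = infl M (stat (int (\<tau> mod L))) r"
    unfolding blk_def[abs_def] r by (rule infl_reindex[OF inj_fresh L2_measurable[OF L2_stat]])
  also have "\<dots> \<le> (if r \<le> int (\<tau> mod L) then \<delta> (nat (int (\<tau> mod L) - r)) else 0)"
    by (rule infl_stat)
  also have "\<dots> = (if s \<le> int \<tau> \<and> (a = 0 \<or> a = Suc (\<tau> div L)) then \<delta> (nat (int \<tau> - s)) else 0)"
  proof -
    have "int \<tau> = int (\<tau> div L * L) + int (\<tau> mod L)" by (metis div_mult_mod_eq of_nat_add)
    then have "int (\<tau> mod L) - r = int \<tau> - s" using r by (simp add: fresh_def)
    moreover from this have "r \<le> int (\<tau> mod L) \<longleftrightarrow> s \<le> int \<tau>" by linarith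
    moreover have "a = 0 \<or> a = Suc (\<tau> div L)" using r by (auto simp: fresh_def)
    ultimately show ?thesis by simp
  qed
  finally show ?thesis .
next
  case False
  then have "infl M (blk L \<tau>) (a, s) = 0"
    unfolding blk_def[abs_def] by (rule infl_reindex_0)
  then show ?thesis by (simp add: \<delta>_nonneg)
qed

text \<open>At position \<open>l\<close> of a block exactly the lags 0..l still read original
  innovations; all older ones come from the copies.\<close>

definition resample_err :: "nat \<Rightarrow> real" where
  "resample_err l = norm2 (iid M) (\<lambda>z. f (mix {..l} z) - f (mix UNIV z))"

lemma resample_err_nonneg: "0 \<le> resample_err l"
  by (simp add: resample_err_def)

lemma resample_err_tendsto: "resample_err \<longlonglongrightarrow> 0"
proof (rule LIMSEQ_I)
  fix e :: real assume "0 < e"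
  then have "0 < e / 2" by simp
  from resample_L2[OF f this] obtain J0 where J0: "finite J0"
    "\<And>J. J0 \<subseteq> J \<Longrightarrow> norm2 (iid M) (\<lambda>z. f (mix J z) - f (mix UNIV z)) \<le> e / 2" by blast
  obtain N where N: "\<And>k. k \<in> J0 \<Longrightarrow> k \<le> N"
    using J0(1) finite_nat_set_iff_bounded_le[of J0] by auto
  have "norm (resample_err l - 0) < e" if "N \<le> l" for l
  proof -
    have "J0 \<subseteq> {..l}" using N that by (auto intro: order_trans)
    from J0(2)[OF this] show ?thesis using \<open>0 < e\<close> resample_err_nonneg[of l] unfolding resample_err_def by simp
  qed
  then show "\<exists>n0. \<forall>l\<ge>n0. norm (resample_err l - 0) < e" by blast
qed

lemma norm2_blk_diff: "norm2 (iid M) (\<lambda>z. blk L \<tau> z - orig \<tau> z) = resample_err (\<tau> mod L)"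
proof -
  \<comment> \<open>Flagged lags go to the original innovations, unflagged ones to the copies of the
    block, so \<open>mix {..\<tau> mod L}\<close> becomes \<open>blk\<close> and
    \<open>mix UNIV\<close> becomes \<open>orig\<close>.\<close>
  define h where "h = (\<lambda>(k, c). (if c then 0 else Suc (\<tau> div L), int \<tau> - int k))"
  have "inj h" by (auto simp: h_def intro!: injI split: if_splits)
  have m: "(\<lambda>z. f (mix {..\<tau> mod L} z) - f (mix UNIV z)) \<in> borel_measurable (iid M)"
    by (intro L2_measurable L2_diff L2_mix f)
  have \<tau>: "int (\<tau> div L * L) + int (\<tau> mod L) = int \<tau>" by (metis div_mult_mod_eq of_nat_add)
  have "(\<lambda>k. z (fresh L (\<tau> div L) (int (\<tau> mod L) - int k))) = mix {..\<tau> mod L} (\<lambda>i. z (h i))" for z :: "_ \<Rightarrow> 'e"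
    using \<tau> by (auto simp: fresh_def mix_def h_def fun_eq_iff add_diff_eq)
  moreover have "(\<lambda>k. z (0, int \<tau> - int k)) = mix UNIV (\<lambda>i. z (h i))" for z :: "_ \<Rightarrow> 'e"
    by (auto simp: mix_def h_def fun_eq_iff)
  ultimately have "(\<lambda>z. blk L \<tau> z - orig \<tau> z) = (\<lambda>z. f (mix {..\<tau> mod L} (\<lambda>i. z (h i))) - f (mix UNIV (\<lambda>i. z (h i))))"
    by (simp add: blk_def orig_def stat_def)
  then show ?thesis
    using norm2_reindex[OF \<open>inj h\<close> m] by (simp add: resample_err_def)
qed

text \<open>The influence of a difference has two bounds: \<delta> + \<delta> from the two
  processes, and twice the L2 norm. Their minimum is the term of \<open>trunc_infl\<close>.\<close>

lemma blk_variance_bound: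
  assumes "finite T"
  shows "(norm2 (iid M) (\<lambda>z. \<Sum>\<tau>\<in>T. w \<tau> * (blk L \<tau> z - orig \<tau> z)))\<^sup>2 \<le>
    2 * suminf \<delta> * (\<Sum>\<tau>\<in>T. (w \<tau>)\<^sup>2 * (2 * trunc_infl (resample_err (\<tau> mod L))))"
proof -
  interpret I: prob_space "iid M :: (nat \<times> int \<Rightarrow> 'e) measure" by (rule prob_space_iid)
  let ?g = "\<lambda>\<tau> z. blk L \<tau> z - orig \<tau> z"
  have g: "?g \<tau> \<in> L2 (iid M)" for \<tau> by (intro L2_diff L2_blk L2_orig)
  have mean: "(\<integral>z. ?g \<tau> z \<partial>iid M) = 0" for \<tau>
    by (subst Bochner_Integration.integral_diff) (simp_all add: I.L2_integrable L2_blk L2_orig mean_blk mean_orig)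
  have "(norm2 (iid M) (\<lambda>z. \<Sum>\<tau>\<in>T. w \<tau> * (?g \<tau> z - (\<integral>z. ?g \<tau> z \<partial>iid M))))\<^sup>2 \<le>
    2 * suminf \<delta> * (\<Sum>\<tau>\<in>T. (w \<tau>)\<^sup>2 * (2 * trunc_infl (resample_err (\<tau> mod L))))"
  proof (rule block_variance_bound[OF assms g, where p="\<lambda>\<tau>. \<tau> div L"])
    fix \<tau> a s
    have "infl M (?g \<tau>) (a, s) \<le> infl M (blk L \<tau>) (a, s) + infl M (orig \<tau>) (a, s)"
      by (rule infl_diff[OF L2_blk L2_orig])
    moreover have "infl M (?g \<tau>) (a, s) \<le> 2 * resample_err (\<tau> mod L)"
      using infl_le[OF g, of \<tau> "(a, s)"] by (simp add: norm2_blk_diff)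
    ultimately show "infl M (?g \<tau>) (a, s) \<le>
        (if s \<le> int \<tau> \<and> (a = 0 \<or> a = Suc (\<tau> div L)) then min (2 * \<delta> (nat (int \<tau> - s))) (2 * resample_err (\<tau> mod L)) else 0)"
      using infl_blk[of L \<tau> a s] infl_orig[of \<tau> a s L] by (auto split: if_splits)
  qed (rule resample_err_nonneg)
  then show ?thesis unfolding mean by simp
qed

definition blocksum :: "nat \<Rightarrow> nat \<Rightarrow> (nat \<times> int \<Rightarrow> 'e) \<Rightarrow> real" where
  "blocksum L j z = (\<Sum>l<L. blk L (j * L + l) z)"

lemma blocksum_eq: "blocksum L j z = (\<Sum>l<L. stat (int l) (\<lambda>s. z (fresh L j s)))"
  by (simp add: blocksum_def blk_def)

lemma L2_blocksum: "blocksum L j \<in> L2 (iid M)"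
  unfolding blocksum_def[abs_def] by (intro L2_sum L2_blk)

text \<open>Block \<open>j\<close> reads its own stretch of the original innovations and its own
  family of copies. These index sets are disjoint, so even adjacent blocks are independent.\<close>

lemma indep_blocksum: "prob_space.indep_vars (iid M) (\<lambda>_. borel) (blocksum L) UNIV"
proof (rule indep_blocks[where K="\<lambda>j. {(a, s). a = Suc j \<or> (a = 0 \<and> int (j * L) \<le> s \<and> s < int (j * L) + int L)}"])
  have "j = j'" if "int (j * L) \<le> s" "s < int (j * L) + int L" "int (j' * L) \<le> s" "s < int (j' * L) + int L" for j j' s
  proof -
    have "int j * int L < (int j' + 1) * int L" "int j' * int L < (int j + 1) * int L"
      using that by (simp_all add: distrib_right)
    then have "int j < int j' + 1" "int j' < int j + 1"
      by (simp_all add: mult_less_cancel_right)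
    then show ?thesis by simp
  qed
  then show "disjoint_family_on (\<lambda>j. {(a, s). a = Suc j \<or> (a = 0 \<and> int (j * L) \<le> s \<and> s < int (j * L) + int L)}) UNIV"
    by (fastforce simp: disjoint_family_on_def)
  show "blocksum L j \<in> borel_measurable (iid M)" for j by (rule L2_measurable[OF L2_blocksum])
next
  fix j and z z' :: "nat \<times> int \<Rightarrow> 'e"
  assume z: "z i = z' i" if "i \<in> {(a, s). a = Suc j \<or> (a = 0 \<and> int (j * L) \<le> s \<and> s < int (j * L) + int L)}" for i
  have "z (fresh L j (int l - int k)) = z' (fresh L j (int l - int k))" if "l < L" for l k
    using that by (intro z) (auto simp: fresh_def)
  then show "blocksum L j z = blocksum L j z'"
    unfolding blocksum_eq stat_def by (intro sum.cong) auto
qed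

lemma distr_blocksum: "distr (iid M) borel (blocksum L j) = distr (iid M) borel (\<lambda>x. \<Sum>l<L. stat (int l) x)"
proof -
  have "distr (iid M) borel (\<lambda>x. \<Sum>l<L. stat (int l) x) =
      distr (distr (iid M) (iid M) (\<lambda>z s. z (fresh L j s))) borel (\<lambda>x. \<Sum>l<L. stat (int l) x)"
    by (simp only: reindex[OF inj_fresh])
  also have "\<dots> = distr (iid M) borel ((\<lambda>x. \<Sum>l<L. stat (int l) x) \<circ> (\<lambda>z s. z (fresh L j s)))"
    by (intro distr_distr measurable_reindex L2_measurable L2_sum L2_stat)
  also have "(\<lambda>x. \<Sum>l<L. stat (int l) x) \<circ> (\<lambda>z s. z (fresh L j s)) = blocksum L j"
    by (auto simp: fun_eq_iff blocksum_eq)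
  finally show ?thesis by simp
qed

lemma mean_blocksum: "(\<integral>z. blocksum L j z \<partial>iid M) = 0"
proof -
  interpret I: prob_space "iid M :: (nat \<times> int \<Rightarrow> 'e) measure" by (rule prob_space_iid)
  show ?thesis unfolding blocksum_def
    by (subst Bochner_Integration.integral_sum) (simp_all add: I.L2_integrable L2_blk mean_blk)
qed

lemma square_blocksum: "(\<integral>z. (blocksum L j z)\<^sup>2 \<partial>iid M) = block_var L"
  unfolding block_var_def blocksum_eq
  by (rule integral_reindex[OF inj_fresh, where f="\<lambda>x. (\<Sum>l<L. stat (int l) x)\<^sup>2"])
    (intro borel_measurable_power L2_measurable L2_sum L2_stat)

lemma blocksum_clt:
  assumes "0 < L"
  shows "(\<lambda>n. char (distr (iid M) borel (\<lambda>z. \<Sum>j<n div L + 1. wgt n (j * L) * blocksum L j z)) t) \<longlonglongrightarrow>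
    complex_of_real (exp (- (t\<^sup>2 * ((LINT x|lborel. (K x)\<^sup>2) / real L * block_var L) / 2)))"
proof -
  interpret I: prob_space "iid M :: (nat \<times> int \<Rightarrow> 'e) measure" by (rule prob_space_iid)
  obtain \<kappa> where \<kappa>: "\<And>n \<tau>. \<bar>wgt n \<tau>\<bar> \<le> \<kappa> n" "\<kappa> \<longlonglongrightarrow> 0" using wgt_max by blast
  show ?thesis
    unfolding square_blocksum[of L 0, symmetric]
  proof (rule I.weighted_iid_clt[OF indep_blocksum _ L2_blocksum mean_blocksum])
    show "distr (iid M) borel (blocksum L j) = distr (iid M) borel (blocksum L 0)" for j
      by (simp only: distr_blocksum)
    show "(\<lambda>n. \<Sum>j<n div L + 1. (wgt n (j * L))\<^sup>2) \<longlonglongrightarrow> (LINT x|lborel. (K x)\<^sup>2) / real L"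
      using wgt_square_tendsto[OF assms, of 0] by simp
  qed (use \<kappa> in auto)
qed

end

lemma sum_blocks:
  fixes g :: "nat \<Rightarrow> 'b::comm_monoid_add"
  shows "(\<Sum>\<tau><m * L. g \<tau>) = (\<Sum>j<m. \<Sum>l<L. g (j * L + l))"
proof -
  have "(\<Sum>\<tau><m * L. g \<tau>) = (\<Sum>j<m. \<Sum>\<tau>\<in>{j * L..<j * L + L}. g \<tau>)"
    by (rule sum.nat_group[symmetric])
  also have "\<dots> = (\<Sum>j<m. \<Sum>l<L. g (j * L + l))"
  proof (rule sum.cong[OF refl])
    fix j show "(\<Sum>\<tau>\<in>{j * L..<j * L + L}. g \<tau>) = (\<Sum>l<L. g (j * L + l))"
      using sum.shift_bounds_nat_ivl[of g 0 "j * L" L] by (simp add: lessThan_atLeast0 add.commute)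
  qed
  finally show ?thesis .
qed

context kernel_clt
begin

lemma norm2_blk: "norm2 (iid M) (blk L \<tau>) = norm2 (iid M) f"
  unfolding blk_def[abs_def] norm2_reindex[OF inj_fresh L2_measurable[OF L2_stat]]
  unfolding stat_def[abs_def] by (rule norm2_reindex[OF inj_past L2_measurable[OF f]])

definition frozen_sum :: "nat \<Rightarrow> (nat \<times> int \<Rightarrow> 'e) \<Rightarrow> real" where
  "frozen_sum n z = (\<Sum>\<tau><n. wgt n \<tau> * orig \<tau> z)"

definition block_approx :: "nat \<Rightarrow> nat \<Rightarrow> (nat \<times> int \<Rightarrow> 'e) \<Rightarrow> real" where
  "block_approx L n z = (\<Sum>j<n div L + 1. wgt n (j * L) * blocksum L j z)"

lemma L2_frozen_sum: "frozen_sum n \<in> L2 (iid M)"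
  unfolding frozen_sum_def[abs_def] by (intro L2_sum L2_cmult L2_orig)

lemma L2_block_approx: "block_approx L n \<in> L2 (iid M)"
  unfolding block_approx_def[abs_def] by (intro L2_sum L2_cmult L2_blocksum)

text \<open>Two replacements are paid for separately. \<open>A\<close> exchanges the past of each
  block and needs the variance bound; \<open>D\<close> moves the weights to the left end of the
  block, where the triangle inequality suffices because the total oscillation of the weights is
  small.\<close>

lemma block_approx_error:
  assumes L: "0 < L" and zero: "\<And>\<tau>. n \<le> \<tau> \<Longrightarrow> wgt n \<tau> = 0"
  shows "(\<integral>z. \<bar>block_approx L n z - frozen_sum n z\<bar> \<partial>iid M) \<le>
    sqrt (2 * suminf \<delta> * (\<Sum>l<L. 2 * trunc_infl (resample_err l) * (\<Sum>j<n div L + 1. (wgt n (j * L + l))\<^sup>2))) +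
    norm2 (iid M) f * (\<Sum>j<n div L + 1. \<Sum>l<L. \<bar>wgt n (j * L + l) - wgt n (j * L)\<bar>)"
proof -
  interpret I: prob_space "iid M :: (nat \<times> int \<Rightarrow> 'e) measure" by (rule prob_space_iid)
  let ?m = "n div L + 1"
  define A where "A z = (\<Sum>\<tau><?m * L. wgt n \<tau> * (blk L \<tau> z - orig \<tau> z))" for z
  define D where "D z = (\<Sum>j<?m. \<Sum>l<L. (wgt n (j * L) - wgt n (j * L + l)) * blk L (j * L + l) z)" for z
  have AL: "A \<in> L2 (iid M)" unfolding A_def[abs_def] by (intro L2_sum L2_cmult L2_diff L2_blk L2_orig)
  have DL: "D \<in> L2 (iid M)" unfolding D_def[abs_def] by (intro L2_sum L2_cmult L2_blk)
  have n: "n \<le> ?m * L"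
    using div_mult_mod_eq[of n L] mod_less_divisor[OF L, of n] unfolding distrib_right by linarith
  \<comment> \<open>The weights vanish from \<open>n\<close> on, so the last block may be
    completed.\<close>
  have fs: "frozen_sum n z = (\<Sum>\<tau><?m * L. wgt n \<tau> * orig \<tau> z)" for z
    unfolding frozen_sum_def using n zero by (intro sum.mono_neutral_left) auto
  have "block_approx L n z - frozen_sum n z = A z + D z" for z
    unfolding block_approx_def fs A_def D_def blocksum_def sum_blocks
    by (simp only: right_diff_distrib left_diff_distrib sum_subtractf sum_distrib_left)
  then have "(\<integral>z. \<bar>block_approx L n z - frozen_sum n z\<bar> \<partial>iid M) = (\<integral>z. \<bar>A z + D z\<bar> \<partial>iid M)"
    by simp
  also have "\<dots> \<le> (\<integral>z. \<bar>A z\<bar> + \<bar>D z\<bar> \<partial>iid M)"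
    by (intro integral_mono integrable_abs Bochner_Integration.integrable_add I.L2_integrable AL DL) auto
  also have "\<dots> = (\<integral>z. \<bar>A z\<bar> \<partial>iid M) + (\<integral>z. \<bar>D z\<bar> \<partial>iid M)"
    by (intro Bochner_Integration.integral_add integrable_abs I.L2_integrable AL DL)
  also have "(\<integral>z. \<bar>A z\<bar> \<partial>iid M) \<le> norm2 (iid M) A" by (rule I.L1_le_norm2[OF AL])
  also have "norm2 (iid M) A \<le>
      sqrt (2 * suminf \<delta> * (\<Sum>\<tau><?m * L. (wgt n \<tau>)\<^sup>2 * (2 * trunc_infl (resample_err (\<tau> mod L)))))"
    unfolding A_def[abs_def] by (rule real_le_rsqrt, rule blk_variance_bound) simp
  also have "(\<Sum>\<tau><?m * L. (wgt n \<tau>)\<^sup>2 * (2 * trunc_infl (resample_err (\<tau> mod L)))) =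
      (\<Sum>j<?m. \<Sum>l<L. 2 * trunc_infl (resample_err l) * (wgt n (j * L + l))\<^sup>2)"
    unfolding sum_blocks by (intro sum.cong refl) simp
  also have "\<dots> = (\<Sum>l<L. 2 * trunc_infl (resample_err l) * (\<Sum>j<?m. (wgt n (j * L + l))\<^sup>2))"
    unfolding sum_distrib_left by (rule sum.swap)
  also have "(\<integral>z. \<bar>D z\<bar> \<partial>iid M) \<le>
      norm2 (iid M) f * (\<Sum>j<?m. \<Sum>l<L. \<bar>wgt n (j * L + l) - wgt n (j * L)\<bar>)"
  proof -
    have "norm2 (iid M) D \<le> (\<Sum>j<?m. norm2 (iid M) (\<lambda>z. \<Sum>l<L. (wgt n (j * L) - wgt n (j * L + l)) * blk L (j * L + l) z))"
      unfolding D_def[abs_def] by (intro norm2_sum L2_sum L2_cmult L2_blk)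
    also have "\<dots> \<le> (\<Sum>j<?m. \<Sum>l<L. norm2 (iid M) (\<lambda>z. (wgt n (j * L) - wgt n (j * L + l)) * blk L (j * L + l) z))"
      by (intro sum_mono norm2_sum L2_cmult L2_blk)
    also have "\<dots> = norm2 (iid M) f * (\<Sum>j<?m. \<Sum>l<L. \<bar>wgt n (j * L + l) - wgt n (j * L)\<bar>)"
      unfolding norm2_cmult norm2_blk sum_distrib_left
      by (intro sum.cong refl) (simp add: mult.commute abs_minus_commute)
    finally show ?thesis using I.L1_le_norm2[OF DL] by linarith
  qed
  finally show ?thesis by simp
qed

lemma frozen_clt:
  "(\<lambda>n. char (distr (iid M) borel (frozen_sum n)) t) \<longlonglongrightarrow>
    complex_of_real (exp (- (t\<^sup>2 * ((LINT x|lborel. (K x)\<^sup>2) *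
      ((\<Sum>k. acov (int k)) + (\<Sum>k. acov (int (Suc k))))) / 2)))"
proof -
  interpret I: prob_space "iid M :: (nat \<times> int \<Rightarrow> 'e) measure" by (rule prob_space_iid)
  define k2 where "k2 = (LINT x|lborel. (K x)\<^sup>2)"
  define \<sigma>2 where "\<sigma>2 = (\<Sum>k. acov (int k)) + (\<Sum>k. acov (int (Suc k)))"
  define G where "G = complex_of_real (exp (- (t\<^sup>2 * (k2 * \<sigma>2) / 2)))"
  define GL where "GL L = complex_of_real (exp (- (t\<^sup>2 * (k2 / real L * block_var L) / 2)))" for L
  define Q where "Q L = 2 * suminf \<delta> * (\<Sum>l<L. 2 * trunc_infl (resample_err l) * (k2 / real L))" for L
  \<comment> \<open>\<open>err L\<close> is the limit of \<open>bound L n\<close> in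
    \<open>n\<close>; the zero summands keep the shape of \<open>bound\<close>, so that the limits
    can be taken summand by summand.\<close>
  define err where "err L = \<bar>t\<bar> * (sqrt (Q L) + norm2 (iid M) f * 0) + 0 + cmod (GL L - G)" for L
  define bound where "bound L n = \<bar>t\<bar> * (sqrt (2 * suminf \<delta> * (\<Sum>l<L. 2 * trunc_infl (resample_err l) *
      (\<Sum>j<n div L + 1. (wgt n (j * L + l))\<^sup>2))) +
      norm2 (iid M) f * (\<Sum>j<n div L + 1. \<Sum>l<L. \<bar>wgt n (j * L + l) - wgt n (j * L)\<bar>)) +
      cmod (char (distr (iid M) borel (block_approx L n)) t - GL L) + cmod (GL L - G)" for L n
  have bound_tendsto: "bound L \<longlonglongrightarrow> err L" if "0 < L" for L
  proof -
    have "(\<lambda>n. char (distr (iid M) borel (block_approx L n)) t - GL L) \<longlonglongrightarrow> 0"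
      unfolding GL_def k2_def block_approx_def[abs_def] by (rule LIM_zero[OF blocksum_clt[OF that]])
    then have "(\<lambda>n. cmod (char (distr (iid M) borel (block_approx L n)) t - GL L)) \<longlonglongrightarrow> 0"
      by (rule tendsto_norm_zero)
    then show ?thesis
      unfolding bound_def[abs_def] err_def Q_def k2_def
      by (intro tendsto_intros wgt_square_tendsto wgt_oscillation that)
  qed
  have le_bound: "\<forall>\<^sub>F n in sequentially. cmod (char (distr (iid M) borel (frozen_sum n)) t - G) \<le> bound L n"
    if "0 < L" for L
    using wgt_zero
  proof eventually_elim
    case (elim n)
    have "cmod (char (distr (iid M) borel (frozen_sum n)) t - char (distr (iid M) borel (block_approx L n)) t) =
       cmod (char (distr (iid M) borel (block_approx L n)) t - char (distr (iid M) borel (frozen_sum n)) t)"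
      by (rule norm_minus_commute)
    also have "\<dots> \<le> \<bar>t\<bar> * (\<integral>z. \<bar>block_approx L n z - frozen_sum n z\<bar> \<partial>iid M)"
      by (intro I.char_diff_le L2_measurable I.L2_integrable L2_diff L2_frozen_sum L2_block_approx)
    also have "\<dots> \<le> \<bar>t\<bar> * (sqrt (2 * suminf \<delta> * (\<Sum>l<L. 2 * trunc_infl (resample_err l) *
      (\<Sum>j<n div L + 1. (wgt n (j * L + l))\<^sup>2))) +
      norm2 (iid M) f * (\<Sum>j<n div L + 1. \<Sum>l<L. \<bar>wgt n (j * L + l) - wgt n (j * L)\<bar>))"
      using elim by (intro mult_left_mono block_approx_error that) auto
    finally have 1: "cmod (char (distr (iid M) borel (frozen_sum n)) t - char (distr (iid M) borel (block_approx L n)) t) \<le> \<dots>" .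
    show ?case
      unfolding bound_def add.assoc
      by (rule norm_diff_triangle_le[OF 1 norm_diff_triangle_le[OF order_refl order_refl]])
  qed
  have "err \<longlonglongrightarrow> \<bar>t\<bar> * (sqrt (4 * suminf \<delta> * k2 * 0) + norm2 (iid M) f * 0) + 0 + cmod (G - G)"
  proof -
    \<comment> \<open>The resampled past is felt mainly near the start of a block; averaged over the
      \<open>L\<close> positions its effect disappears.\<close>
    have "(\<lambda>L. (\<Sum>l<L. trunc_infl (resample_err l)) / real L) \<longlonglongrightarrow> 0"
      by (intro cesaro_mean trunc_infl_tendsto resample_err_tendsto resample_err_nonneg)
    then have "(\<lambda>L. 4 * suminf \<delta> * k2 * ((\<Sum>l<L. trunc_infl (resample_err l)) / real L)) \<longlonglongrightarrow> 4 * suminf \<delta> * k2 * 0"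
      by (intro tendsto_intros)
    moreover have "4 * suminf \<delta> * k2 * ((\<Sum>l<L. trunc_infl (resample_err l)) / real L) = Q L" for L
      by (simp add: Q_def sum_distrib_left sum_distrib_right sum_divide_distrib mult_ac)
    ultimately have q: "Q \<longlonglongrightarrow> 4 * suminf \<delta> * k2 * 0" by simp
    have "(\<lambda>L. complex_of_real (exp (- (t\<^sup>2 * (k2 * (block_var L / real L)) / 2)))) \<longlonglongrightarrow> G"
      unfolding G_def \<sigma>2_def by (intro tendsto_intros block_var_limit) auto
    then have g: "GL \<longlonglongrightarrow> G" by (simp add: GL_def[abs_def])
    show ?thesis unfolding err_def[abs_def] by (intro tendsto_intros q g)
  qed
  then have err0: "err \<longlonglongrightarrow> 0" by simp
  have "(\<lambda>n. char (distr (iid M) borel (frozen_sum n)) t) \<longlonglongrightarrow> G"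
  proof (rule tendstoI)
    fix e :: real assume e: "0 < e"
    have "\<forall>\<^sub>F L in sequentially. err L < e \<and> 0 < L"
      using e by (intro eventually_conj order_tendstoD(2)[OF err0] eventually_gt_at_top)
    then obtain L where L: "err L < e" "0 < L" by (auto simp: eventually_sequentially)
    have "\<forall>\<^sub>F n in sequentially. bound L n < e"
      by (rule order_tendstoD(2)[OF bound_tendsto[OF L(2)] L(1)])
    with le_bound[OF L(2)] show "\<forall>\<^sub>F n in sequentially. dist (char (distr (iid M) borel (frozen_sum n)) t) G < e"
      by eventually_elim (simp add: dist_norm)
  qed
  then show ?thesis by (simp add: G_def k2_def \<sigma>2_def)
qed

end

section \<open>Transfer to the innovations\<close>

lemma (in prob_space) prob_space_marginal:
  assumes "innovations M E eps eps'"
  shows "prob_space (distr M E (eps 1))"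
  using assms by (intro prob_space_distr) (auto simp: innovations_def indep_vars_def)

context prob_space
begin

context
  fixes E :: "'e measure" and eps eps' :: "int \<Rightarrow> 'a \<Rightarrow> 'e" and N :: "'e measure"
  assumes inn: "innovations M E eps eps'"
  defines "N \<equiv> distr M E (eps 1)"
begin

lemma eps_measurable: "eps t \<in> measurable M E"
  using inn by (auto simp: innovations_def indep_vars_def)

lemma eps'_measurable: "eps' t \<in> measurable M E"
  using inn by (auto simp: innovations_def)

lemma sets_N: "sets N = sets E"
  by (simp add: N_def)

lemma space_N: "space N = space E"
  by (simp add: N_def)

lemma prob_space_N: "prob_space N"
  unfolding N_def by (rule prob_space_marginal[OF inn])

lemma sets_iid_N: "sets (iid N) = sets (Pi\<^sub>M UNIV (\<lambda>_. E))"
  by (intro sets_PiM_cong refl sets_N)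

lemma measurable_family:
  "(\<And>i. X i \<in> measurable M E) \<Longrightarrow> (\<lambda>\<omega> i. X i \<omega>) \<in> measurable M (iid N)"
  by (rule measurable_PiM_single')
    (auto simp: space_N measurable_cong_sets[OF refl sets_N] dest: measurable_space)

lemma law_eps:
  fixes h :: "'i \<Rightarrow> int"
  assumes "inj h"
  shows "distr M (iid N) (\<lambda>\<omega> i. eps (h i) \<omega>) = iid N"
proof -
  interpret N: prob_space N by (rule prob_space_N)
  have "distr M (Pi\<^sub>M UNIV (\<lambda>_. E)) (\<lambda>\<omega>. \<lambda>i\<in>UNIV. eps i \<omega>) = Pi\<^sub>M UNIV (\<lambda>i. distr M E (eps i))"
    using inn by (subst indep_vars_iff_distr_eq_PiM[symmetric])
      (auto simp: innovations_def eps_measurable)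
  also have "\<dots> = iid N"
  proof -
    have "distr M E (eps i) = N" for i using inn unfolding innovations_def N_def by blast
    then show ?thesis by (simp only:)
  qed
  finally have 1: "distr M (iid N) (\<lambda>\<omega> i. eps i \<omega>) = iid N"
    by (subst distr_cong[OF refl sets_iid_N, of _ "\<lambda>\<omega> i. eps i \<omega>"]) (auto simp: restrict_def)
  have "iid N = distr (distr M (iid N) (\<lambda>\<omega> i. eps i \<omega>)) (iid N) (\<lambda>z i. z (h i))"
    unfolding 1 by (rule N.reindex[OF assms, symmetric])
  also have "\<dots> = distr M (iid N) ((\<lambda>z i. z (h i)) \<circ> (\<lambda>\<omega> i. eps i \<omega>))"
    by (intro distr_distr measurable_reindex measurable_family eps_measurable)
  finally show ?thesis by (simp add: o_def)
qed

definition eps_star :: "int \<Rightarrow> int \<Rightarrow> 'a \<Rightarrow> nat option \<Rightarrow> 'e" where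
  "eps_star s t \<omega> x = (case x of None \<Rightarrow> eps' s \<omega> | Some k \<Rightarrow> eps (t - int k) \<omega>)"

lemma measurable_eps_star: "eps_star s t \<in> measurable M (iid N)"
proof -
  have "(\<lambda>\<omega> x. eps_star s t \<omega> x) \<in> measurable M (iid N)"
  proof (rule measurable_family)
    fix x show "(\<lambda>\<omega>. eps_star s t \<omega> x) \<in> measurable M E"
      by (cases x) (auto simp: eps_star_def eps_measurable eps'_measurable)
  qed
  then show ?thesis by (simp add: eta_contract_eq)
qed

text \<open>Joining the copy to the past as coordinate \<open>None\<close> gives an i.i.d. family,
  so that the past and its starred version become the two reindexings in \<open>infl\<close>. A
  cylinder event splits into one for \<open>eps' s\<close> and one for the innovations, and there
  the independence of the generated sigma-algebras applies.\<close>

lemma law_eps_star: "distr M (iid N) (eps_star s t) = iid N"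
proof -
  interpret N: prob_space N by (rule prob_space_N)
  interpret NI: product_prob_space "\<lambda>_. N" "UNIV :: nat option set" ..
  have inj: "inj (\<lambda>k. t - int k)" by (auto intro: injI)
  show ?thesis
  proof (rule NI.PiM_eq)
    fix J :: "nat option set" and F assume J: "finite J" and F: "\<And>j. j \<in> J \<Longrightarrow> F j \<in> sets N"
    define J' where "J' = {k. Some k \<in> J}"
    have J': "finite J'" using finite_vimageI[OF J, of Some] by (simp add: J'_def vimage_def)
    \<comment> \<open>If coordinate \<open>None\<close> is unrestricted, the whole space takes its
      place and \<open>A\<close> is \<open>space M\<close>.\<close>
    define A where "A = eps' s -` (if None \<in> J then F None else space E) \<inter> space M"
    define B' where "B' = prod_emb UNIV (\<lambda>_. N) J' (Pi\<^sub>E J' (\<lambda>k. F (Some k)))"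
    define B where "B = (\<lambda>\<omega> k. eps (t - int k) \<omega>) -` B' \<inter> space M"
    have B'_sets: "B' \<in> sets (iid N)"
      unfolding B'_def using J' F by (intro sets_PiM_I) (auto simp: J'_def)
    have ev: "eps_star s t -` prod_emb UNIV (\<lambda>_. N) J (Pi\<^sub>E J F) \<inter> space M = A \<inter> B"
    proof -
      have "\<omega> \<in> eps_star s t -` prod_emb UNIV (\<lambda>_. N) J (Pi\<^sub>E J F) \<longleftrightarrow> \<omega> \<in> A \<inter> B" if \<omega>: "\<omega> \<in> space M" for \<omega>
      proof -
        have sp: "eps i \<omega> \<in> space N" "eps' i \<omega> \<in> space N" for i
          using measurable_space[OF eps_measurable \<omega>] measurable_space[OF eps'_measurable \<omega>] by (auto simp: space_N)
        have "eps_star s t \<omega> j \<in> space N" for j using sp by (auto simp: eps_star_def split: option.split)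
        then have "\<omega> \<in> eps_star s t -` prod_emb UNIV (\<lambda>_. N) J (Pi\<^sub>E J F) \<longleftrightarrow> (\<forall>j\<in>J. eps_star s t \<omega> j \<in> F j)"
          by (auto simp: prod_emb_iff restrict_PiE_iff)
        also have "\<dots> \<longleftrightarrow> (None \<in> J \<longrightarrow> eps' s \<omega> \<in> F None) \<and> (\<forall>k\<in>J'. eps (t - int k) \<omega> \<in> F (Some k))"
        proof -
          have "(\<forall>j\<in>J. Q j) \<longleftrightarrow> (None \<in> J \<longrightarrow> Q None) \<and> (\<forall>k\<in>J'. Q (Some k))" for Q
            unfolding J'_def by (metis mem_Collect_eq option.exhaust)
          from this[of "\<lambda>j. eps_star s t \<omega> j \<in> F j"] show ?thesis by (simp add: eps_star_def)
        qed
        also have "\<dots> \<longleftrightarrow> \<omega> \<in> A \<inter> B"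
          using sp \<omega> unfolding A_def B_def B'_def by (auto simp: prod_emb_iff restrict_PiE_iff space_N)
        finally show ?thesis .
      qed
      then show ?thesis by (auto simp: A_def)
    qed
    have ind: "indep_set (sets (vimage_algebra (space M) (eps' s) E))
       (sets (vimage_algebra (space M) (\<lambda>\<omega> t. eps t \<omega>) (Pi\<^sub>M UNIV (\<lambda>_. E))))"
      using inn by (simp add: innovations_def)
    have AX: "(if None \<in> J then F None else space E) \<in> sets E" using F sets_N by auto
    then have A: "A \<in> sets (vimage_algebra (space M) (eps' s) E)"
      unfolding A_def by (rule in_vimage_algebra)
    have B: "B \<in> sets (vimage_algebra (space M) (\<lambda>\<omega> t. eps t \<omega>) (Pi\<^sub>M UNIV (\<lambda>_. E)))"
    proof -
      have "(\<lambda>z k. z (t - int k)) -` B' \<inter> space (iid N) \<in> sets (iid N)"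
        by (rule measurable_sets[OF measurable_reindex B'_sets])
      then have "(\<lambda>\<omega> t. eps t \<omega>) -` ((\<lambda>z k. z (t - int k)) -` B' \<inter> space (iid N)) \<inter> space M \<in>
          sets (vimage_algebra (space M) (\<lambda>\<omega> t. eps t \<omega>) (Pi\<^sub>M UNIV (\<lambda>_. E)))"
        unfolding sets_iid_N by (rule in_vimage_algebra)
      also have "(\<lambda>\<omega> t. eps t \<omega>) -` ((\<lambda>z k. z (t - int k)) -` B' \<inter> space (iid N)) \<inter> space M = B"
        unfolding B_def using measurable_space[OF measurable_family[OF eps_measurable]] by auto
      finally show ?thesis .
    qed
    have "emeasure (distr M (iid N) (eps_star s t)) (prod_emb UNIV (\<lambda>_. N) J (Pi\<^sub>E J F)) = emeasure M (A \<inter> B)"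
      unfolding ev[symmetric] using J F by (intro emeasure_distr measurable_eps_star sets_PiM_I) auto
    also have "\<dots> = ennreal (prob A * prob B)"
      by (simp add: emeasure_eq_measure indep_setD[OF ind A B])
    also have "\<dots> = emeasure M A * emeasure M B"
      by (simp add: emeasure_eq_measure ennreal_mult)
    also have "emeasure M A = (if None \<in> J then emeasure N (F None) else 1)"
    proof -
      have "distr M E (eps' s) = N" using inn by (simp add: innovations_def N_def)
      then have "emeasure M A = emeasure N (if None \<in> J then F None else space E)"
        unfolding A_def emeasure_distr[OF eps'_measurable AX, symmetric] by (simp only:)
      then show ?thesis using N.emeasure_space_1 by (simp add: space_N)
    qed
    also have "emeasure M B = emeasure (distr M (iid N) (\<lambda>\<omega> k. eps (t - int k) \<omega>)) B'"
      unfolding B_def by (rule emeasure_distr[symmetric, OF measurable_family[OF eps_measurable] B'_sets])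
    also have "\<dots> = (\<Prod>k\<in>J'. emeasure N (F (Some k)))"
      unfolding law_eps[OF inj] B'_def using J' F by (intro emeasure_PiM_emb) (auto simp: J'_def prob_space_N)
    also have "\<dots> = (\<Prod>j\<in>Some ` J'. emeasure N (F j))"
      by (subst prod.reindex) auto
    also have "Some ` J' = J - {None}"
      by (auto simp: J'_def image_iff) (metis option.exhaust)
    also have "(if None \<in> J then emeasure N (F None) else 1) * (\<Prod>j\<in>J - {None}. emeasure N (F j)) = (\<Prod>j\<in>J. emeasure N (F j))"
      using J by (auto simp: prod.remove)
    finally show "emeasure (distr M (iid N) (eps_star s t)) (prod_emb UNIV (\<lambda>_. N) J (Pi\<^sub>E J F)) = (\<Prod>j\<in>J. emeasure N (F j))" .
  qed simp
qed

lemma inj_past_index: "inj (\<lambda>k. t - int k)"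
  by (auto intro: injI)

lemma measurable_past: "past eps t \<in> measurable M (iid N)"
  unfolding past_def[abs_def] by (rule measurable_family[OF eps_measurable])

lemma L2_past: "G \<in> borel_measurable (iid N) \<Longrightarrow> (\<lambda>\<omega>. G (past eps t \<omega>)) \<in> L2 M \<longleftrightarrow> G \<in> L2 (iid N)"
  using L2_distr[OF measurable_past, of G t] law_eps[OF inj_past_index, of t] by (simp add: past_def[abs_def])

lemma norm2_past: "G \<in> borel_measurable (iid N) \<Longrightarrow> norm2 M (\<lambda>\<omega>. G (past eps t \<omega>)) = norm2 (iid N) G"
  using norm2_distr[OF measurable_past, of G t] law_eps[OF inj_past_index, of t] by (simp add: past_def[abs_def])

text \<open>With the copy taken at time \<open>t - int k\<close>, both arguments are reindexings of
  \<open>eps_star\<close>. This is the bridge from replaced innovations to influences, and the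
  result is the same for every \<open>t\<close>.\<close>

lemma norm2_past_star:
  assumes "G \<in> borel_measurable (iid N)"
  shows "norm2 M (\<lambda>\<omega>. G (past eps t \<omega>) - G (past_star eps eps' k t \<omega>)) = infl N G k"
proof -
  interpret N: prob_space N by (rule prob_space_N)
  let ?g = "\<lambda>z. G (\<lambda>j. z (Some j)) - G (\<lambda>j. z (if j = k then None else Some j))"
  have "norm2 (distr M (iid N) (eps_star (t - int k) t)) ?g = norm2 M (\<lambda>\<omega>. ?g (eps_star (t - int k) t \<omega>))"
    by (intro norm2_distr measurable_eps_star N.measurable_infl assms)
  moreover have "(\<lambda>j. eps_star (t - int k) t \<omega> (Some j)) = past eps t \<omega>" for \<omega>
    by (simp add: eps_star_def past_def)
  moreover have "(\<lambda>j. eps_star (t - int k) t \<omega> (if j = k then None else Some j)) = past_star eps eps' k t \<omega>" for \<omega>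
    by (auto simp: eps_star_def past_star_def past_def fun_eq_iff)
  ultimately show ?thesis by (simp add: law_eps_star infl_def)
qed

lemma measurable_past_star: "past_star eps eps' k t \<in> measurable M (iid N)"
proof -
  have "(\<lambda>\<omega> j. eps_star (t - int k) t \<omega> (if j = k then None else Some j)) \<in> measurable M (iid N)"
    using measurable_compose[OF measurable_eps_star measurable_reindex] .
  also have "(\<lambda>\<omega> j. eps_star (t - int k) t \<omega> (if j = k then None else Some j)) = past_star eps eps' k t"
    by (auto simp: eps_star_def past_star_def past_def fun_eq_iff)
  finally show ?thesis .
qed

end

end

section \<open>The local central limit theorem for causal arrays\<close>

lemma (in prob_space) integral_past:
  fixes G :: "(nat \<Rightarrow> 'e) \<Rightarrow> real"
  assumes "innovations M E eps eps'" "G \<in> borel_measurable (iid (distr M E (eps 1)))"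
  shows "expectation (\<lambda>\<omega>. G (past eps t \<omega>)) = (\<integral>x. G x \<partial>iid (distr M E (eps 1)))"
  using integral_distr[OF measurable_past[OF assms(1)] assms(2), of t]
    law_eps[OF assms(1) inj_past_index[OF assms(1)], of t]
  by (simp add: past_def[abs_def])

text \<open>\<open>G v\<close> represents the stationary process at rescaled time \<open>v\<close>.
  Approximation of \<open>W\<close> is demanded only from time \<open>r\<close> on: earlier times
  may involve lags before time 1, and the kernel does not see them for large
  \<open>n\<close>.\<close>

locale causal_array = prob_space M + kernel_weights b u K
  for M :: "'a measure" and b u K +
  fixes E :: "'e measure" and eps eps' :: "int \<Rightarrow> 'a \<Rightarrow> 'e" and N :: "'e measure"
    and W :: "int \<Rightarrow> nat \<Rightarrow> 'a \<Rightarrow> real" and Y :: "int \<Rightarrow> 'a \<Rightarrow> real"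
    and G :: "real \<Rightarrow> (nat \<Rightarrow> 'e) \<Rightarrow> real" and d :: "nat \<Rightarrow> real" and \<alpha> C :: real and r :: nat
  assumes inn: "innovations M E eps eps'"
    and N: "N = distr M E (eps 1)"
    and \<alpha>: "0 < \<alpha>" and C: "0 \<le> C"
    and rate: "(\<lambda>n. sqrt (real n * b n) * real n powr (- \<alpha>)) \<longlonglongrightarrow> 0"
    and W: "\<And>n t. t \<in> {1..int n} \<Longrightarrow> W t n \<in> borel_measurable M"
    and G_L2: "\<And>v. v \<in> {0..1} \<Longrightarrow> G v \<in> L2 (iid N)"
    and G_infl: "\<And>v k. v \<in> {0..1} \<Longrightarrow> infl N (G v) k \<le> d k"
    and d: "summable d"
    and G_holder: "\<And>v v'. v \<in> {0..1} \<Longrightarrow> v' \<in> {0..1} \<Longrightarrow>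
      norm2 (iid N) (\<lambda>x. G v x - G v' x) \<le> C * \<bar>v - v'\<bar> powr \<alpha>"
    and W_L2: "\<And>n t. int r \<le> t \<Longrightarrow> t \<in> {1..int n} \<Longrightarrow>
      (\<lambda>\<omega>. W t n \<omega> - G (real_of_int t / real n) (past eps t \<omega>)) \<in> L2 M"
    and W_approx: "\<And>n t. int r \<le> t \<Longrightarrow> t \<in> {1..int n} \<Longrightarrow>
      norm2 M (\<lambda>\<omega>. W t n \<omega> - G (real_of_int t / real n) (past eps t \<omega>)) \<le> C * real n powr (- \<alpha>)"
    and Y: "\<And>t. Y t \<in> borel_measurable M"
    and Y_eq: "\<And>t. AE \<omega> in M. Y t \<omega> = G u (past eps t \<omega>)"
begin

lemma u_unit: "u \<in> {0..1}"
  using u by simp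

sublocale N: prob_space N
  unfolding N by (rule prob_space_N[OF inn])

lemma iid_prob: "prob_space (iid N)"
  by (rule N.prob_space_iid)

definition frozen :: "(nat \<Rightarrow> 'e) \<Rightarrow> real" where
  "frozen x = G u x - (\<integral>x. G u x \<partial>iid N)"

lemma frozen_L2: "frozen \<in> L2 (iid N)"
proof -
  interpret I: prob_space "iid N :: (nat \<Rightarrow> 'e) measure" by (rule iid_prob)
  show ?thesis unfolding frozen_def[abs_def] by (intro L2_diff G_L2 u_unit I.L2_const)
qed

sublocale kc: kernel_clt N frozen d b u K
proof
  interpret I: prob_space "iid N :: (nat \<Rightarrow> 'e) measure" by (rule iid_prob)
  show "frozen \<in> L2 (iid N)" by (rule frozen_L2)
  show "(\<integral>x. frozen x \<partial>iid N) = 0"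
    unfolding frozen_def by (simp add: I.L2_integrable[OF G_L2[OF u_unit]] I.prob_space)
  show "infl N frozen k \<le> d k" for k
    unfolding frozen_def[abs_def] infl_minus_const by (rule G_infl[OF u_unit])
qed (rule d)

lemma G_measurable: "v \<in> {0..1} \<Longrightarrow> G v \<in> borel_measurable (iid N)"
  by (rule L2_measurable[OF G_L2])

lemma law: "inj h \<Longrightarrow> distr M (iid N) (\<lambda>\<omega> i. eps (h i) \<omega>) = iid N"
  unfolding N by (rule law_eps[OF inn])

lemma measurable_eps_family: "(\<lambda>\<omega> i. eps (h i) \<omega>) \<in> measurable M (iid N)"
  unfolding N by (rule measurable_family[OF inn eps_measurable[OF inn]])

lemma integral_law:
  fixes F :: "('i \<Rightarrow> 'e) \<Rightarrow> real"
  shows "inj h \<Longrightarrow> F \<in> borel_measurable (iid N) \<Longrightarrow>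
    expectation (\<lambda>\<omega>. F (\<lambda>i. eps (h i) \<omega>)) = (\<integral>x. F x \<partial>iid N)"
  using integral_distr[OF measurable_eps_family, of F h] law[of h] by simp

lemma norm2_law:
  "inj h \<Longrightarrow> F \<in> borel_measurable (iid N) \<Longrightarrow> norm2 M (\<lambda>\<omega>. F (\<lambda>i. eps (h i) \<omega>)) = norm2 (iid N) F"
  using norm2_distr[OF measurable_eps_family, of F h] law[of h] by simp

lemma expectation_past: "F \<in> borel_measurable (iid N) \<Longrightarrow>
    expectation (\<lambda>\<omega>. F (past eps t \<omega>)) = (\<integral>x. F x \<partial>iid N)" for F :: "(nat \<Rightarrow> 'e) \<Rightarrow> real"
  unfolding N by (rule integral_past[OF inn])

lemma L2_past': "F \<in> L2 (iid N) \<Longrightarrow> (\<lambda>\<omega>. F (past eps t \<omega>)) \<in> L2 M"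
  using L2_past[OF inn, of F t] unfolding N by (simp add: L2_measurable)

lemma covariance_eq: "covariance M (Y 0) (Y k) = kc.acov k"
proof -
  have m: "G u \<in> borel_measurable (iid N)" by (rule G_measurable[OF u_unit])
  have mp: "(\<lambda>\<omega>. G u (past eps t \<omega>)) \<in> borel_measurable M" for t
    by (rule L2_measurable[OF L2_past'[OF G_L2[OF u_unit]]])
  have EY: "expectation (Y t) = (\<integral>x. G u x \<partial>iid N)" for t
    unfolding expectation_past[OF m, of t, symmetric] by (rule integral_cong_AE[OF Y mp Y_eq])
  have "covariance M (Y 0) (Y k) = expectation (\<lambda>\<omega>. frozen (past eps 0 \<omega>) * frozen (past eps k \<omega>))"
    unfolding covariance_def EY
  proof (rule integral_cong_AE)
    show "AE \<omega> in M. (Y 0 \<omega> - (\<integral>x. G u x \<partial>iid N)) * (Y k \<omega> - (\<integral>x. G u x \<partial>iid N)) =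
        frozen (past eps 0 \<omega>) * frozen (past eps k \<omega>)"
      using Y_eq[of 0] Y_eq[of k] by eventually_elim (simp add: frozen_def)
    show "(\<lambda>\<omega>. frozen (past eps 0 \<omega>) * frozen (past eps k \<omega>)) \<in> borel_measurable M"
      by (intro borel_measurable_times L2_measurable[OF L2_past'[OF frozen_L2]])
    show "(\<lambda>\<omega>. (Y 0 \<omega> - (\<integral>x. G u x \<partial>iid N)) * (Y k \<omega> - (\<integral>x. G u x \<partial>iid N))) \<in> borel_measurable M"
      by (intro borel_measurable_times borel_measurable_diff Y borel_measurable_const)
  qed
  also have "\<dots> = kc.acov k"
  proof -
    have m: "(\<lambda>z. kc.stat 0 z * kc.stat k z) \<in> borel_measurable (iid N)"
      by (intro borel_measurable_times L2_measurable kc.L2_stat)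
    show ?thesis
      unfolding kc.acov_def using integral_law[of "\<lambda>i. i", OF _ m] by (simp add: kc.stat_def past_def)
  qed
  finally show ?thesis .
qed

lemma long_run:
  "(\<lambda>k. covariance M (Y 0) (Y k)) summable_on UNIV"
  "long_run_variance M Y = (\<Sum>k. kc.acov (int k)) + (\<Sum>k. kc.acov (int (Suc k)))"
  using kc.acov_has_sum unfolding covariance_eq[abs_def] long_run_variance_def
  by (auto simp: infsumI dest: has_sum_imp_summable)

section \<open>From the kernel sum to its frozen version\<close>

definition main_sum :: "nat \<Rightarrow> 'a \<Rightarrow> real" where
  "main_sum n \<omega> = (\<Sum>\<tau><n. wgt n \<tau> * frozen (past eps (int \<tau> + 1) \<omega>))"

lemma main_sum_L2: "main_sum n \<in> L2 M"
  unfolding main_sum_def[abs_def] by (intro L2_sum L2_cmult L2_past' frozen_L2)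

lemma inj_shift: "inj (\<lambda>s :: int. s + 1)"
  by (auto intro: injI)

lemma distr_main_sum: "distr M borel (main_sum n) = distr (iid N) borel (kc.frozen_sum n)"
proof -
  define F where "F x = (\<Sum>\<tau><n. wgt n \<tau> * kc.stat (int \<tau>) x)" for x
  have F: "F \<in> borel_measurable (iid N)"
    unfolding F_def[abs_def] by (intro L2_measurable L2_sum L2_cmult kc.L2_stat)
  have "distr M borel (main_sum n) = distr M borel (F \<circ> (\<lambda>\<omega> s. eps (s + 1) \<omega>))"
    by (simp add: main_sum_def[abs_def] F_def o_def kc.stat_def past_def algebra_simps)
  also have "\<dots> = distr (distr M (iid N) (\<lambda>\<omega> s. eps (s + 1) \<omega>)) borel F"
    by (rule distr_distr[symmetric, OF F measurable_eps_family])
  also have "\<dots> = distr (distr (iid N) (iid N) (\<lambda>z s. z (0 :: nat, s))) borel F"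
    unfolding law[OF inj_shift] N.reindex[OF kc.inj_zero] ..
  also have "\<dots> = distr (iid N) borel (F \<circ> (\<lambda>z s. z (0 :: nat, s)))"
    by (rule distr_distr[OF F measurable_reindex])
  also have "F \<circ> (\<lambda>z s. z (0 :: nat, s)) = kc.frozen_sum n"
    by (simp add: fun_eq_iff F_def kc.frozen_sum_def kc.orig_def)
  finally show ?thesis .
qed

lemma kernel_sum_eq:
  "kernel_sum M K b u W n \<omega> = (\<Sum>\<tau><n. wgt n \<tau> * (W (int \<tau> + 1) n \<omega> - expectation (W (int \<tau> + 1) n)))"
proof -
  have "(\<Sum>t = 1..int n. K ((real_of_int t / real n - u) / b n) * (W t n \<omega> - expectation (W t n))) =
      (\<Sum>\<tau><n. K (grid b u n \<tau>) * (W (int \<tau> + 1) n \<omega> - expectation (W (int \<tau> + 1) n)))"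
    by (rule sum.reindex_bij_witness[where i="\<lambda>\<tau>. int \<tau> + 1" and j="\<lambda>t. nat (t - 1)"]) (auto simp: grid_def)
  then show ?thesis
    by (simp add: kernel_sum_def wgt_def sum_divide_distrib)
qed

text \<open>Each term is small only like c^\<alpha>, while the absolute kernel weights add up to
  order sqrt(n b). The variance bound brings in squared weights, so it is enough that
  \<open>c\<close> tends to 0. Only original innovations occur; they are placed in component 0 to
  reuse \<open>block_variance_bound\<close>.\<close>

lemma freezing_error:
  assumes "finite T" and v: "\<And>\<tau>. \<tau> \<in> T \<Longrightarrow> v \<tau> \<in> {0..1} \<and> \<bar>v \<tau> - u\<bar> \<le> c"
  shows "(norm2 M (\<lambda>\<omega>. \<Sum>\<tau>\<in>T. w \<tau> * ((G (v \<tau>) (past eps (int \<tau> + 1) \<omega>) - G u (past eps (int \<tau> + 1) \<omega>)) -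
      (\<integral>x. G (v \<tau>) x - G u x \<partial>iid N))))\<^sup>2 \<le>
    2 * suminf d * (\<Sum>\<tau>\<in>T. (w \<tau>)\<^sup>2 * (2 * kc.trunc_infl (C * c powr \<alpha>)))"
proof -
  define g where "g \<tau> x = G (v \<tau>) x - G u x" for \<tau> x
  have g: "g \<tau> \<in> L2 (iid N)" if "\<tau> \<in> T" for \<tau>
    unfolding g_def[abs_def] using v[OF that] by (intro L2_diff G_L2 u_unit) auto
  define gz where "gz \<tau> z = g \<tau> (\<lambda>k. z (0 :: nat, int \<tau> - int k))" for \<tau> and z :: "nat \<times> int \<Rightarrow> 'e"
  have inj0: "inj (\<lambda>k. (0 :: nat, int \<tau> - int k))" for \<tau> by (auto intro: injI)
  have inj1: "inj (\<lambda>k. int \<tau> - int k)" for \<tau> by (auto intro: injI)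
  have gz: "gz \<tau> \<in> L2 (iid N)" if "\<tau> \<in> T" for \<tau>
    unfolding gz_def[abs_def] by (rule N.L2_reindex[OF inj0 g[OF that]])
  have mean: "(\<integral>z. gz \<tau> z \<partial>iid N) = (\<integral>x. g \<tau> x \<partial>iid N)" if "\<tau> \<in> T" for \<tau>
    unfolding gz_def by (rule N.integral_reindex[OF inj0 L2_measurable[OF g[OF that]]])
  define F where "F x = (\<Sum>\<tau>\<in>T. w \<tau> * (g \<tau> (\<lambda>k. x (int \<tau> - int k)) - (\<integral>x. g \<tau> x \<partial>iid N)))" for x :: "int \<Rightarrow> 'e"
  interpret I: prob_space "iid N :: (int \<Rightarrow> 'e) measure" by (rule iid_prob)
  have F: "F \<in> borel_measurable (iid N)"
    unfolding F_def[abs_def]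
    by (intro L2_measurable L2_sum L2_cmult L2_diff I.L2_const N.L2_reindex[OF inj1] g)
  have "norm2 M (\<lambda>\<omega>. \<Sum>\<tau>\<in>T. w \<tau> * ((G (v \<tau>) (past eps (int \<tau> + 1) \<omega>) - G u (past eps (int \<tau> + 1) \<omega>)) -
      (\<integral>x. G (v \<tau>) x - G u x \<partial>iid N))) = norm2 M (\<lambda>\<omega>. F (\<lambda>s. eps (s + 1) \<omega>))"
    by (simp add: F_def g_def past_def algebra_simps)
  also have "\<dots> = norm2 (iid N) F" by (rule norm2_law[OF inj_shift F])
  also have "\<dots> = norm2 (iid N) (\<lambda>z. F (\<lambda>s. z (0 :: nat, s)))"
    by (rule N.norm2_reindex[OF kc.inj_zero F, symmetric])
  also have "(\<lambda>z. F (\<lambda>s. z (0 :: nat, s))) = (\<lambda>z. \<Sum>\<tau>\<in>T. w \<tau> * (gz \<tau> z - (\<integral>z. gz \<tau> z \<partial>iid N)))"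
    by (auto simp: F_def gz_def mean[unfolded gz_def] fun_eq_iff intro!: sum.cong)
  also have "(norm2 (iid N) \<dots>)\<^sup>2 \<le> 2 * suminf d * (\<Sum>\<tau>\<in>T. (w \<tau>)\<^sup>2 * (2 * kc.trunc_infl (C * c powr \<alpha>)))"
  proof (rule kc.block_variance_bound[OF assms(1) gz, where p="\<lambda>_. 0"])
    fix \<tau> a s assume \<tau>: "\<tau> \<in> T"
    have n2: "norm2 (iid N) (g \<tau>) \<le> C * c powr \<alpha>"
    proof -
      have "norm2 (iid N) (g \<tau>) \<le> C * \<bar>v \<tau> - u\<bar> powr \<alpha>"
        unfolding g_def[abs_def] using v[OF \<tau>] by (intro G_holder u_unit) auto
      also have "\<dots> \<le> C * c powr \<alpha>"
        using v[OF \<tau>] C \<alpha> by (intro mult_left_mono powr_mono2) auto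
      finally show ?thesis .
    qed
    show "infl N (gz \<tau>) (a, s) \<le> (if s \<le> int \<tau> \<and> (a = 0 \<or> a = Suc 0)
        then min (2 * d (nat (int \<tau> - s))) (2 * (C * c powr \<alpha>)) else 0)"
    proof (cases "(a, s) \<in> range (\<lambda>k. (0 :: nat, int \<tau> - int k))")
      case True
      then obtain k where k: "a = 0" "s = int \<tau> - int k" by auto
      have "infl N (gz \<tau>) (a, s) = infl N (g \<tau>) k"
        unfolding gz_def[abs_def] k by (rule N.infl_reindex[OF inj0 L2_measurable[OF g[OF \<tau>]]])
      moreover have "infl N (g \<tau>) k \<le> d k + d k"
        unfolding g_def[abs_def] using v[OF \<tau>]
        by (intro order_trans[OF N.infl_diff] add_mono G_infl G_L2 u_unit) auto
      moreover have "infl N (g \<tau>) k \<le> 2 * (C * c powr \<alpha>)"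
        using N.infl_le[OF g[OF \<tau>], of k] n2 by simp
      ultimately show ?thesis using k by simp
    next
      case False
      have "infl N (gz \<tau>) (a, s) = 0"
        unfolding gz_def[abs_def] by (rule N.infl_reindex_0[OF False])
      moreover have "0 \<le> d k" for k by (rule kc.\<delta>_nonneg)
      ultimately show ?thesis using C by simp
    qed
  qed (assumption | rule mult_nonneg_nonneg[OF C powr_ge_zero])+
  finally show ?thesis .
qed

text \<open>\<open>R\<close> compares the array with the stationary process at time t / n and is
  summed by the triangle inequality, to be absorbed by the rate condition; \<open>D\<close> freezes
  that process at \<open>u\<close> and goes through the variance bound.\<close>

lemma kernel_sum_error:
  assumes n: "0 < b n" "0 < n" and left: "grid b u n r < -1/2"
  shows "expectation (\<lambda>\<omega>. \<bar>kernel_sum M K b u W n \<omega> - main_sum n \<omega>\<bar>) \<le>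
    C * real n powr (- \<alpha>) * (\<Sum>\<tau><n + 1. \<bar>wgt n \<tau>\<bar>) +
    sqrt (2 * suminf d * (2 * kc.trunc_infl (C * b n powr \<alpha>)) * (\<Sum>\<tau><n + 1. (wgt n \<tau>)\<^sup>2))"
    and "integrable M (\<lambda>\<omega>. kernel_sum M K b u W n \<omega> - main_sum n \<omega>)"
proof -
  \<comment> \<open>On the terms with nonzero weight the grid lies in the support. This yields both
    |t/n - u| <= b and, through \<open>left\<close>, that the time is at least
    \<open>r\<close>.\<close>
  define T where "T = {\<tau> \<in> {..<n}. wgt n \<tau> \<noteq> 0}"
  have T: "finite T" "T \<subseteq> {..<n + 1}" by (auto simp: T_def)
  define v where "v \<tau> = (real \<tau> + 1) / real n" for \<tau>
  have grid: "\<bar>grid b u n \<tau>\<bar> \<le> 1/2" if "\<tau> \<in> T" for \<tau>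
    using that K_support[of "grid b u n \<tau>"] by (force simp: T_def wgt_def)
  have v: "v \<tau> \<in> {0..1} \<and> \<bar>v \<tau> - u\<bar> \<le> b n" if "\<tau> \<in> T" for \<tau>
  proof -
    have "\<tau> < n" using that by (simp add: T_def)
    then have "v \<tau> \<in> {0..1}" by (auto simp: v_def)
    moreover have "\<bar>v \<tau> - u\<bar> = \<bar>grid b u n \<tau>\<bar> * b n" using n by (simp add: grid_def v_def abs_mult abs_divide)
    moreover have "\<dots> \<le> 1/2 * b n" using n by (intro mult_right_mono grid that) auto
    ultimately show ?thesis using n by simp
  qed
  have r: "int r \<le> int \<tau> + 1" "int \<tau> + 1 \<in> {1..int n}" if "\<tau> \<in> T" for \<tau>
  proof -
    show "int r \<le> int \<tau> + 1"
    proof (rule ccontr)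
      assume "\<not> int r \<le> int \<tau> + 1"
      then have "grid b u n \<tau> \<le> grid b u n r"
        unfolding grid_def using n by (intro divide_right_mono diff_right_mono) auto
      then show False using grid[OF that] left by simp
    qed
    show "int \<tau> + 1 \<in> {1..int n}" using that by (simp add: T_def)
  qed
  define R where "R \<tau> \<omega> = W (int \<tau> + 1) n \<omega> - G (v \<tau>) (past eps (int \<tau> + 1) \<omega>)" for \<tau> \<omega>
  define D where "D \<tau> \<omega> = G (v \<tau>) (past eps (int \<tau> + 1) \<omega>) - G u (past eps (int \<tau> + 1) \<omega>)" for \<tau> \<omega>
  have ve: "real_of_int (int \<tau> + 1) / real n = v \<tau>" for \<tau> by (simp add: v_def)
  have R: "R \<tau> \<in> L2 M" "norm2 M (R \<tau>) \<le> C * real n powr (- \<alpha>)" if "\<tau> \<in> T" for \<tau>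
    using W_L2[OF r[OF that]] W_approx[OF r[OF that]] unfolding ve R_def[abs_def] by auto
  have D: "D \<tau> \<in> L2 M" if "\<tau> \<in> T" for \<tau>
    unfolding D_def[abs_def] using v[OF that] by (intro L2_diff L2_past' G_L2 u_unit) auto
  have ED: "expectation (D \<tau>) = (\<integral>x. G (v \<tau>) x - G u x \<partial>iid N)" if "\<tau> \<in> T" for \<tau>
    unfolding D_def[abs_def] using v[OF that]
    by (intro expectation_past[of "\<lambda>x. G (v \<tau>) x - G u x"] borel_measurable_diff G_measurable u_unit) auto
  have gu: "(\<lambda>\<omega>. G u (past eps t \<omega>)) \<in> L2 M" for t by (rule L2_past'[OF G_L2[OF u_unit]])
  have decomp: "W (int \<tau> + 1) n \<omega> - expectation (W (int \<tau> + 1) n) - frozen (past eps (int \<tau> + 1) \<omega>) =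
      (R \<tau> \<omega> - expectation (R \<tau>)) + (D \<tau> \<omega> - expectation (D \<tau>))" if "\<tau> \<in> T" for \<tau> \<omega>
  proof -
    have W: "W (int \<tau> + 1) n = (\<lambda>\<omega>. R \<tau> \<omega> + D \<tau> \<omega> + G u (past eps (int \<tau> + 1) \<omega>))"
      by (simp add: R_def D_def)
    have "expectation (W (int \<tau> + 1) n) = expectation (R \<tau>) + expectation (D \<tau>) + (\<integral>x. G u x \<partial>iid N)"
      unfolding W using R(1)[OF that] D[OF that] gu
      by (simp add: L2_integrable expectation_past[OF G_measurable[OF u_unit]])
    then show ?thesis by (simp add: W frozen_def)
  qed
  define A where "A \<omega> = (\<Sum>\<tau>\<in>T. wgt n \<tau> * (R \<tau> \<omega> - expectation (R \<tau>)))" for \<omega>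
  define B where "B \<omega> = (\<Sum>\<tau>\<in>T. wgt n \<tau> * (D \<tau> \<omega> - expectation (D \<tau>)))" for \<omega>
  have A: "A \<in> L2 M" unfolding A_def[abs_def] by (intro L2_sum L2_cmult L2_diff L2_const R)
  have B: "B \<in> L2 M" unfolding B_def[abs_def] by (intro L2_sum L2_cmult L2_diff L2_const D)
  have "kernel_sum M K b u W n \<omega> - main_sum n \<omega> = A \<omega> + B \<omega>" for \<omega>
  proof -
    have "kernel_sum M K b u W n \<omega> - main_sum n \<omega> = (\<Sum>\<tau><n. wgt n \<tau> * (W (int \<tau> + 1) n \<omega> -
        expectation (W (int \<tau> + 1) n) - frozen (past eps (int \<tau> + 1) \<omega>)))"
      unfolding kernel_sum_eq main_sum_def by (simp add: sum_subtractf right_diff_distrib)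
    also have "\<dots> = (\<Sum>\<tau>\<in>T. wgt n \<tau> * (W (int \<tau> + 1) n \<omega> -
        expectation (W (int \<tau> + 1) n) - frozen (past eps (int \<tau> + 1) \<omega>)))"
      by (rule sum.mono_neutral_right) (auto simp: T_def)
    also have "\<dots> = (\<Sum>\<tau>\<in>T. wgt n \<tau> * ((R \<tau> \<omega> - expectation (R \<tau>)) + (D \<tau> \<omega> - expectation (D \<tau>))))"
      using decomp by (intro sum.cong) auto
    also have "\<dots> = A \<omega> + B \<omega>" by (simp add: A_def B_def sum.distrib distrib_left)
    finally show ?thesis .
  qed
  then have AB: "(\<lambda>\<omega>. kernel_sum M K b u W n \<omega> - main_sum n \<omega>) = (\<lambda>\<omega>. A \<omega> + B \<omega>)" by auto
  show "integrable M (\<lambda>\<omega>. kernel_sum M K b u W n \<omega> - main_sum n \<omega>)"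
    unfolding AB by (intro L2_integrable L2_add A B)
  have nA: "norm2 M A \<le> C * real n powr (- \<alpha>) * (\<Sum>\<tau><n + 1. \<bar>wgt n \<tau>\<bar>)"
  proof -
    have "norm2 M A \<le> (\<Sum>\<tau>\<in>T. \<bar>wgt n \<tau>\<bar> * norm2 M (\<lambda>\<omega>. R \<tau> \<omega> - expectation (R \<tau>)))"
      unfolding A_def[abs_def] norm2_cmult[symmetric] by (intro norm2_sum L2_cmult L2_diff L2_const R)
    also have "\<dots> \<le> (\<Sum>\<tau>\<in>T. \<bar>wgt n \<tau>\<bar> * (C * real n powr (- \<alpha>)))"
      using R norm2_centered_le[OF R(1)] by (intro sum_mono mult_left_mono) (auto intro: order_trans)
    also have "\<dots> \<le> (\<Sum>\<tau><n + 1. \<bar>wgt n \<tau>\<bar> * (C * real n powr (- \<alpha>)))"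
      using T C by (intro sum_mono2) auto
    finally show ?thesis unfolding sum_distrib_right[symmetric] by (simp only: mult.commute)
  qed
  have nB: "norm2 M B \<le> sqrt (2 * suminf d * (2 * kc.trunc_infl (C * b n powr \<alpha>)) * (\<Sum>\<tau><n + 1. (wgt n \<tau>)\<^sup>2))"
  proof (rule real_le_rsqrt)
    have d0: "0 \<le> suminf d" by (intro suminf_nonneg d kc.\<delta>_nonneg)
    have t0: "0 \<le> kc.trunc_infl (C * b n powr \<alpha>)" using C by (intro kc.trunc_infl_nonneg) simp
    have "B = (\<lambda>\<omega>. \<Sum>\<tau>\<in>T. wgt n \<tau> * ((G (v \<tau>) (past eps (int \<tau> + 1) \<omega>) - G u (past eps (int \<tau> + 1) \<omega>)) -
      (\<integral>x. G (v \<tau>) x - G u x \<partial>iid N)))"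
      unfolding B_def[abs_def] by (intro ext sum.cong refl) (simp only: ED D_def)
    then have "(norm2 M B)\<^sup>2 \<le> 2 * suminf d * (\<Sum>\<tau>\<in>T. (wgt n \<tau>)\<^sup>2 * (2 * kc.trunc_infl (C * b n powr \<alpha>)))"
      using freezing_error[OF T(1) v, where w="wgt n"] by simp
    also have "\<dots> \<le> 2 * suminf d * (\<Sum>\<tau><n + 1. (wgt n \<tau>)\<^sup>2 * (2 * kc.trunc_infl (C * b n powr \<alpha>)))"
      using T d0 t0 by (intro mult_left_mono sum_mono2) auto
    also have "\<dots> = 2 * suminf d * (2 * kc.trunc_infl (C * b n powr \<alpha>)) * (\<Sum>\<tau><n + 1. (wgt n \<tau>)\<^sup>2)"
      unfolding sum_distrib_right[symmetric] by (simp only: mult_ac)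
    finally show "(norm2 M B)\<^sup>2 \<le> \<dots>" .
  qed
  have "expectation (\<lambda>\<omega>. \<bar>kernel_sum M K b u W n \<omega> - main_sum n \<omega>\<bar>) \<le> norm2 M (\<lambda>\<omega>. A \<omega> + B \<omega>)"
    using L1_le_norm2[OF L2_add[OF A B]] fun_cong[OF AB] by simp
  also have "\<dots> \<le> norm2 M A + norm2 M B" by (rule norm2_add[OF A B])
  finally show "expectation (\<lambda>\<omega>. \<bar>kernel_sum M K b u W n \<omega> - main_sum n \<omega>\<bar>) \<le>
    C * real n powr (- \<alpha>) * (\<Sum>\<tau><n + 1. \<bar>wgt n \<tau>\<bar>) +
    sqrt (2 * suminf d * (2 * kc.trunc_infl (C * b n powr \<alpha>)) * (\<Sum>\<tau><n + 1. (wgt n \<tau>)\<^sup>2))"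
    using nA nB by linarith
qed

lemma kernel_sum_measurable: "kernel_sum M K b u W n \<in> borel_measurable M"
proof -
  have "(\<lambda>\<omega>. \<Sum>\<tau><n. wgt n \<tau> * (W (int \<tau> + 1) n \<omega> - expectation (W (int \<tau> + 1) n))) \<in> borel_measurable M"
    by (intro borel_measurable_sum borel_measurable_times borel_measurable_diff borel_measurable_const W) auto
  then show ?thesis by (simp add: kernel_sum_eq[abs_def])
qed

lemma kernel_sum_error_tendsto:
  "(\<lambda>n. C * real n powr (- \<alpha>) * (\<Sum>\<tau><n + 1. \<bar>wgt n \<tau>\<bar>) +
    sqrt (2 * suminf d * (2 * kc.trunc_infl (C * b n powr \<alpha>)) * (\<Sum>\<tau><n + 1. (wgt n \<tau>)\<^sup>2))) \<longlonglongrightarrow> 0"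
proof -
  have 1: "(\<lambda>n. C * real n powr (- \<alpha>) * (\<Sum>\<tau><n + 1. \<bar>wgt n \<tau>\<bar>)) \<longlonglongrightarrow> 0"
  proof (rule Lim_transform_eventually)
    show "(\<lambda>n. C * (sqrt (real n * b n) * real n powr (- \<alpha>)) * ((\<Sum>\<tau><n + 1. \<bar>wgt n \<tau>\<bar>) / sqrt (real n * b n))) \<longlonglongrightarrow> 0"
      using tendsto_mult[OF tendsto_mult[OF tendsto_const rate] wgt_abs_tendsto, of C] by simp
    show "\<forall>\<^sub>F n in sequentially. C * (sqrt (real n * b n) * real n powr (- \<alpha>)) * ((\<Sum>\<tau><n + 1. \<bar>wgt n \<tau>\<bar>) / sqrt (real n * b n)) =
        C * real n powr (- \<alpha>) * (\<Sum>\<tau><n + 1. \<bar>wgt n \<tau>\<bar>)"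
    proof -
      have "C * (s * p) * (S / s) = C * p * S" if "0 < s" for s p S :: real
        using that by simp
      then show ?thesis using eventually_nb_pos by (auto elim!: eventually_mono simp del: sum.lessThan_Suc)
    qed
  qed
  \<comment> \<open>Absolute values guard against the finitely many \<open>n\<close> with negative
    \<open>b n\<close>.\<close>
  have "(\<lambda>n. \<bar>b n\<bar> powr \<alpha>) \<longlonglongrightarrow> 0 powr \<alpha>"
    by (intro tendsto_powr2 tendsto_const tendsto_rabs_zero b0 always_eventually) (use \<alpha> in auto)
  then have "(\<lambda>n. C * \<bar>b n\<bar> powr \<alpha>) \<longlonglongrightarrow> 0"
    using tendsto_mult[OF tendsto_const[of C], of "\<lambda>n. \<bar>b n\<bar> powr \<alpha>" 0 sequentially] by simp
  then have t: "(\<lambda>n. kc.trunc_infl (C * \<bar>b n\<bar> powr \<alpha>)) \<longlonglongrightarrow> 0"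
    by (rule kc.trunc_infl_tendsto) (use C in simp)
  have sq: "(\<lambda>n. \<Sum>\<tau><n + 1. (wgt n \<tau>)\<^sup>2) \<longlonglongrightarrow> (LINT x|lborel. (K x)\<^sup>2)"
    using wgt_square_tendsto[of 1 0] by simp
  have "(\<lambda>n. sqrt (2 * suminf d * (2 * kc.trunc_infl (C * \<bar>b n\<bar> powr \<alpha>)) * (\<Sum>\<tau><n + 1. (wgt n \<tau>)\<^sup>2))) \<longlonglongrightarrow>
      sqrt (2 * suminf d * (2 * 0) * (LINT x|lborel. (K x)\<^sup>2))"
    by (intro tendsto_intros t sq)
  then have 2: "(\<lambda>n. sqrt (2 * suminf d * (2 * kc.trunc_infl (C * \<bar>b n\<bar> powr \<alpha>)) * (\<Sum>\<tau><n + 1. (wgt n \<tau>)\<^sup>2))) \<longlonglongrightarrow> 0"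
    by simp
  have "(\<lambda>n. sqrt (2 * suminf d * (2 * kc.trunc_infl (C * b n powr \<alpha>)) * (\<Sum>\<tau><n + 1. (wgt n \<tau>)\<^sup>2))) \<longlonglongrightarrow> 0"
    by (rule Lim_transform_eventually[OF 2]) (use eventually_b_pos in eventually_elim, simp)
  from tendsto_add[OF 1 this] show ?thesis by simp
qed

theorem local_clt: "local_clt M K b u W Y"
proof -
  let ?v = "(LINT x|lborel. (K x)\<^sup>2) * long_run_variance M Y"
  have lrv: "0 \<le> long_run_variance M Y" unfolding long_run(2) by (rule kc.long_run_nonneg)
  then have v: "0 \<le> ?v" by simp
  have "weak_conv_m (\<lambda>n. distr M borel (kernel_sum M K b u W n)) (normal_law 0 ?v)"
  proof (rule levy_continuity)
    show "real_distribution (distr M borel (kernel_sum M K b u W n))" for n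
      by (rule real_distribution_distr[OF kernel_sum_measurable])
    show "real_distribution (normal_law 0 ?v)" by (rule real_distribution_normal_law[OF v])
    fix t
    have "(\<lambda>n. char (distr M borel (main_sum n)) t) \<longlonglongrightarrow> char (normal_law 0 ?v) t"
      unfolding distr_main_sum char_normal_law[OF v] unfolding long_run(2) by (rule kc.frozen_clt)
    moreover have "(\<lambda>n. char (distr M borel (kernel_sum M K b u W n)) t - char (distr M borel (main_sum n)) t) \<longlonglongrightarrow> 0"
    proof (rule Lim_null_comparison)
      let ?e = "\<lambda>n. C * real n powr (- \<alpha>) * (\<Sum>\<tau><n + 1. \<bar>wgt n \<tau>\<bar>) +
        sqrt (2 * suminf d * (2 * kc.trunc_infl (C * b n powr \<alpha>)) * (\<Sum>\<tau><n + 1. (wgt n \<tau>)\<^sup>2))"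
      show "(\<lambda>n. \<bar>t\<bar> * ?e n) \<longlonglongrightarrow> 0"
        by (rule tendsto_mult_right_zero[OF kernel_sum_error_tendsto])
      show "\<forall>\<^sub>F n in sequentially. cmod (char (distr M borel (kernel_sum M K b u W n)) t - char (distr M borel (main_sum n)) t) \<le> \<bar>t\<bar> * ?e n"
        using eventually_b_pos eventually_grid_left[of r]
      proof eventually_elim
        case (elim n)
        have "cmod (char (distr M borel (kernel_sum M K b u W n)) t - char (distr M borel (main_sum n)) t) \<le>
            \<bar>t\<bar> * expectation (\<lambda>\<omega>. \<bar>kernel_sum M K b u W n \<omega> - main_sum n \<omega>\<bar>)"
          using elim by (intro char_diff_le kernel_sum_measurable L2_measurable[OF main_sum_L2] kernel_sum_error) auto
        also have "\<dots> \<le> \<bar>t\<bar> * ?e n"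
          using elim by (intro mult_left_mono kernel_sum_error) auto
        finally show ?case .
      qed
    qed
    ultimately show "(\<lambda>n. char (distr M borel (kernel_sum M K b u W n)) t) \<longlonglongrightarrow> char (normal_law 0 ?v) t"
      by (rule Lim_transform)
  qed
  then show ?thesis using long_run(1) lrv by (simp add: local_clt_def)
qed

end

section \<open>Moment bounds and the Lipschitz class\<close>

text \<open>The bound \<open>Lq_norm M p W \<le> c\<close> in real numbers: free of roots, and
  including integrability.\<close>

definition Lp_le :: "'a measure \<Rightarrow> real \<Rightarrow> ('a \<Rightarrow> real) \<Rightarrow> real \<Rightarrow> bool" where
  "Lp_le M p W c \<longleftrightarrow> integrable M (\<lambda>\<omega>. \<bar>W \<omega>\<bar> powr p) \<and> (\<integral>\<omega>. \<bar>W \<omega>\<bar> powr p \<partial>M) \<le> c powr p"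

lemma Lp_leI:
  assumes W: "W \<in> borel_measurable M" and p: "0 < p" and c: "0 \<le> c" and le: "Lq_norm M p W \<le> ennreal c"
  shows "Lp_le M p W c"
proof -
  define I where "I = (\<integral>\<^sup>+\<omega>. ennreal (\<bar>W \<omega>\<bar> powr p) \<partial>M)"
  have "I \<noteq> \<infinity>" using le by (auto simp: Lq_norm_def I_def Let_def top_unique)
  moreover from this have "enn2real I powr (1 / p) \<le> c"
    using le c by (auto simp: Lq_norm_def I_def[symmetric] Let_def ennreal_le_iff)
  then have "(enn2real I powr (1 / p)) powr p \<le> c powr p" using p by (intro powr_mono2) auto
  then have "enn2real I \<le> c powr p" using p by (simp add: powr_powr)
  moreover have m: "(\<lambda>\<omega>. \<bar>W \<omega>\<bar> powr p) \<in> borel_measurable M" using W by measurable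
  ultimately show ?thesis
    unfolding Lp_le_def I_def
    by (intro conjI integrableI_nonneg) (auto simp: integral_eq_nn_integral less_top)
qed

lemma Lp_le_mono: "Lp_le M p W c \<Longrightarrow> 0 < p \<Longrightarrow> 0 \<le> c \<Longrightarrow> c \<le> c' \<Longrightarrow> Lp_le M p W c'"
  using powr_mono2[of p c c'] by (auto simp: Lp_le_def)

lemma Lp_le_cong_AE:
  assumes "Lp_le M p W c" "W \<in> borel_measurable M" "W' \<in> borel_measurable M" "AE \<omega> in M. W \<omega> = W' \<omega>"
  shows "Lp_le M p W' c"
proof -
  have ae: "AE \<omega> in M. \<bar>W \<omega>\<bar> powr p = \<bar>W' \<omega>\<bar> powr p" using assms(4) by auto
  have m: "(\<lambda>\<omega>. \<bar>W \<omega>\<bar> powr p) \<in> borel_measurable M" "(\<lambda>\<omega>. \<bar>W' \<omega>\<bar> powr p) \<in> borel_measurable M"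
    using assms(2,3) by auto
  show ?thesis
    using assms(1) integrable_cong_AE[OF m ae] integral_cong_AE[OF m ae] by (simp add: Lp_le_def)
qed

lemma Lp_le_distr:
  assumes "T \<in> measurable M N" "W \<in> borel_measurable N"
  shows "Lp_le (distr M N T) p W c \<longleftrightarrow> Lp_le M p (\<lambda>\<omega>. W (T \<omega>)) c"
proof -
  have "(\<lambda>x. \<bar>W x\<bar> powr p) \<in> borel_measurable N" using assms(2) by auto
  then show ?thesis using assms(1) by (simp add: Lp_le_def integrable_distr_eq integral_distr)
qed

lemma powr_add_le:
  fixes a b p :: real
  assumes "0 \<le> a" "0 \<le> b" "0 < p"
  shows "(a + b) powr p \<le> 2 powr p * (a powr p + b powr p)"
proof -
  have "(a + b) powr p \<le> (2 * max a b) powr p" using assms by (intro powr_mono2) auto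
  also have "\<dots> = 2 powr p * max a b powr p" using assms by (simp add: powr_mult)
  also have "\<dots> \<le> 2 powr p * (a powr p + b powr p)" by (intro mult_left_mono) (auto simp: max_def)
  finally show ?thesis .
qed

text \<open>Minkowski's inequality up to the factor 4, which only enters constants: one 2 comes from
  \<open>powr_add_le\<close>, the other from 2 <= 2^p.\<close>

lemma Lp_le_add:
  assumes f: "Lp_le M p f a" and g: "Lp_le M p g b" and m: "f \<in> borel_measurable M" "g \<in> borel_measurable M"
    and p: "1 \<le> p" and ab: "0 \<le> a" "0 \<le> b"
  shows "Lp_le M p (\<lambda>\<omega>. f \<omega> + g \<omega>) (4 * (a + b))"
proof -
  have le: "\<bar>f \<omega> + g \<omega>\<bar> powr p \<le> 2 powr p * (\<bar>f \<omega>\<bar> powr p + \<bar>g \<omega>\<bar> powr p)" for \<omega>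
  proof -
    have "\<bar>f \<omega> + g \<omega>\<bar> powr p \<le> (\<bar>f \<omega>\<bar> + \<bar>g \<omega>\<bar>) powr p" using p by (intro powr_mono2) auto
    also have "\<dots> \<le> 2 powr p * (\<bar>f \<omega>\<bar> powr p + \<bar>g \<omega>\<bar> powr p)" using p by (intro powr_add_le) auto
    finally show ?thesis .
  qed
  have i: "integrable M (\<lambda>\<omega>. 2 powr p * (\<bar>f \<omega>\<bar> powr p + \<bar>g \<omega>\<bar> powr p))"
    using f g by (auto simp: Lp_le_def)
  have i': "integrable M (\<lambda>\<omega>. \<bar>f \<omega> + g \<omega>\<bar> powr p)"
    by (rule Bochner_Integration.integrable_bound[OF i]) (use m le in auto)
  have "(\<integral>\<omega>. \<bar>f \<omega> + g \<omega>\<bar> powr p \<partial>M) \<le> (\<integral>\<omega>. 2 powr p * (\<bar>f \<omega>\<bar> powr p + \<bar>g \<omega>\<bar> powr p) \<partial>M)"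
    by (intro integral_mono i i' le)
  also have "\<dots> \<le> 2 powr p * (a powr p + b powr p)"
    using f g by (simp add: Lp_le_def)
  also have "\<dots> \<le> 2 powr p * ((a + b) powr p + (a + b) powr p)"
    using ab p by (intro mult_left_mono add_mono powr_mono2) auto
  also have "\<dots> = 2 powr p * (2 powr 1 * (a + b) powr p)" by simp
  also have "\<dots> \<le> 2 powr p * (2 powr p * (a + b) powr p)"
    using p by (intro mult_left_mono mult_right_mono powr_mono) auto
  also have "\<dots> = (4 * (a + b)) powr p"
  proof -
    have "(4 * (a + b)) powr p = 4 powr p * (a + b) powr p" using ab powr_mult[of 4 "a + b" p] by simp
    moreover have "4 powr p = 2 powr p * 2 powr p" using powr_mult[of 2 2 p] by simp
    ultimately show ?thesis by (simp only: mult.assoc)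
  qed
  finally show ?thesis using i' by (simp add: Lp_le_def)
qed

lemma sum_powr_le:
  fixes a :: "nat \<Rightarrow> real"
  assumes a: "\<And>i. i < r \<Longrightarrow> 0 \<le> a i" and p: "0 < p"
  shows "(\<Sum>i<r. a i) powr p \<le> real r powr p * (\<Sum>i<r. a i powr p)"
proof (cases "r = 0")
  case False
  define m where "m = Max (a ` {..<r})"
  have "m \<in> a ` {..<r}" unfolding m_def using False by (intro Max_in) auto
  then obtain j where j: "j < r" "m = a j" by auto
  have m: "a i \<le> m" if "i < r" for i unfolding m_def using that by (intro Max_ge) auto
  have "(\<Sum>i<r. a i) powr p \<le> (real r * m) powr p"
    using a p m sum_bounded_above[of "{..<r}" a m] by (intro powr_mono2 sum_nonneg) auto
  also have "\<dots> = real r powr p * a j powr p" using a[OF j(1)] j(2) by (simp add: powr_mult)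
  also have "\<dots> \<le> real r powr p * (\<Sum>i<r. a i powr p)"
    using j(1) by (intro mult_left_mono member_le_sum) auto
  finally show ?thesis .
qed (use p in simp)

section \<open>The Lipschitz class: pointwise bounds and measurability\<close>

lemma l1_norm_nonneg: "0 \<le> l1_norm r y"
  by (auto simp: l1_norm_def intro: sum_nonneg)

lemma nonneg_pow_le:
  assumes "0 \<le> x" "x \<le> m" "1 \<le> m" "0 \<le> a"
  shows "nonneg_pow x a \<le> m powr a"
  using assms powr_mono2[of a x m] by (auto simp: nonneg_pow_def)

lemma nonneg_pow_nonneg: "0 \<le> nonneg_pow x a"
  by (simp add: nonneg_pow_def)

text \<open>The defining quotient can be cleared because distinct extensional vectors differ at some
  index below \<open>r\<close>, so the denominator is positive.\<close>

lemma lip_class_le: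
  assumes g: "g \<in> lip_class r M C" and y: "y \<in> rvec r" "y' \<in> rvec r"
  shows "\<bar>g y - g y'\<bar> \<le> C * (l1_norm r (\<lambda>i. y i - y' i) *
    (1 + nonneg_pow (l1_norm r y) M + nonneg_pow (l1_norm r y') M))"
proof (cases "y = y'")
  case False
  then obtain i where i: "i < r" "y i \<noteq> y' i"
    using y by (metis PiE_ext lessThan_iff)
  have "\<bar>y i - y' i\<bar> \<le> l1_norm r (\<lambda>i. y i - y' i)"
    unfolding l1_norm_def using i by (intro member_le_sum) auto
  then have "0 < l1_norm r (\<lambda>i. y i - y' i)" using i(2) by linarith
  moreover have "0 < 1 + nonneg_pow (l1_norm r y) M + nonneg_pow (l1_norm r y') M"
    by (intro add_pos_nonneg nonneg_pow_nonneg) auto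
  ultimately show ?thesis
    using g y False by (auto simp: lip_class_def divide_le_eq mult_pos_pos)
qed (simp add: l1_norm_def)

text \<open>The bound is homogeneous of degree two in the scale \<open>\<tau>\<close>; choosing for \<open>\<tau>\<close> the \<open>L\<^sup>p\<close> size of
  \<open>y - y'\<close> it takes the place of an application of Hoelder's inequality.\<close>

lemma lip_class_square_le:
  assumes g: "g \<in> lip_class r M C" and y: "y \<in> rvec r" "y' \<in> rvec r"
    and \<tau>: "0 < \<tau>" "\<tau> \<le> T" and MC: "0 \<le> M" "0 \<le> C" and p: "2 * (M + 1) \<le> p"
  shows "(g y - g y')\<^sup>2 \<le> (3 * C * (1 + T) powr M)\<^sup>2 * \<tau>\<^sup>2 *
    (1 + (l1_norm r (\<lambda>i. y i - y' i) / \<tau>) powr p + l1_norm r y powr p)"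
proof -
  define A where "A = l1_norm r (\<lambda>i. y i - y' i)"
  \<comment> \<open>\<open>m\<close> dominates the scaled distance and, up to the factor 1 + T, both
    norms; every factor becomes a power of \<open>m\<close>, with total exponent M + 1.\<close>
  define m where "m = max 1 (max (A / \<tau>) (l1_norm r y))"
  have A: "0 \<le> A" by (simp add: A_def l1_norm_nonneg)
  have m: "1 \<le> m" "A / \<tau> \<le> m" "l1_norm r y \<le> m" by (auto simp: m_def)
  have A': "A \<le> \<tau> * m" using m(2) \<tau> by (simp add: divide_le_eq mult.commute)
  have T: "0 < T" using \<tau> by simp
  have "l1_norm r y' \<le> l1_norm r y + A"
    unfolding A_def l1_norm_def sum.distrib[symmetric] by (intro sum_mono) auto
  also have "\<dots> \<le> m + T * m" using m A' \<tau> mult_right_mono[of \<tau> T m] by linarith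
  finally have y': "l1_norm r y' \<le> (1 + T) * m" by (simp add: distrib_right)
  have Tm: "1 \<le> (1 + T) powr M" using T MC by (intro ge_one_powr_ge_zero) auto
  have mM: "1 \<le> m powr M" using m MC by (intro ge_one_powr_ge_zero) auto
  have "\<bar>g y - g y'\<bar> \<le> C * (A * (1 + nonneg_pow (l1_norm r y) M + nonneg_pow (l1_norm r y') M))"
    unfolding A_def by (rule lip_class_le[OF g y])
  also have "\<dots> \<le> C * ((\<tau> * m) * (3 * ((1 + T) powr M * m powr M)))"
  proof (intro mult_left_mono mult_mono A' MC)
    have "nonneg_pow (l1_norm r y) M \<le> m powr M"
      by (intro nonneg_pow_le l1_norm_nonneg m MC)
    also have "\<dots> \<le> (1 + T) powr M * m powr M" using Tm by (simp add: mult_le_cancel_right1)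
    finally have 1: "nonneg_pow (l1_norm r y) M \<le> (1 + T) powr M * m powr M" .
    have "1 \<le> (1 + T) * m" using T m mult_mono[of 1 "1 + T" 1 m] by simp
    then have "nonneg_pow (l1_norm r y') M \<le> ((1 + T) * m) powr M"
      by (intro nonneg_pow_le l1_norm_nonneg y' MC)
    also have "\<dots> = (1 + T) powr M * m powr M" using T m by (simp add: powr_mult)
    finally have 2: "nonneg_pow (l1_norm r y') M \<le> (1 + T) powr M * m powr M" .
    have "1 \<le> (1 + T) powr M * m powr M" using mult_mono[OF Tm mM] Tm by simp
    with 1 2 show "1 + nonneg_pow (l1_norm r y) M + nonneg_pow (l1_norm r y') M \<le> 3 * ((1 + T) powr M * m powr M)"
      by linarith
  qed (use \<tau> m nonneg_pow_nonneg[of "l1_norm r y" M] nonneg_pow_nonneg[of "l1_norm r y'" M] in auto)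
  also have "\<dots> = 3 * C * (1 + T) powr M * \<tau> * m powr (M + 1)"
    using m by (simp add: powr_add mult_ac)
  finally have "\<bar>g y - g y'\<bar>\<^sup>2 \<le> (3 * C * (1 + T) powr M * \<tau> * m powr (M + 1))\<^sup>2"
    by (intro power_mono) auto
  then have "(g y - g y')\<^sup>2 \<le> (3 * C * (1 + T) powr M)\<^sup>2 * \<tau>\<^sup>2 * (m powr (M + 1))\<^sup>2"
    by (simp add: power_mult_distrib)
  also have "(m powr (M + 1))\<^sup>2 = m powr (2 * (M + 1))"
    by (simp only: mult_2 powr_add power2_eq_square)
  also have "(3 * C * (1 + T) powr M)\<^sup>2 * \<tau>\<^sup>2 * m powr (2 * (M + 1)) \<le>
      (3 * C * (1 + T) powr M)\<^sup>2 * \<tau>\<^sup>2 * (1 + (A / \<tau>) powr p + l1_norm r y powr p)"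
  proof (rule mult_left_mono)
    have "m powr (2 * (M + 1)) \<le> m powr p" using m p by (intro powr_mono) auto
    \<comment> \<open>\<open>m\<close> is one of three nonnegative quantities, and the sum contains
      the power of each.\<close>
    also have "\<dots> \<le> 1 + (A / \<tau>) powr p + l1_norm r y powr p"
      unfolding m_def by (auto simp: max_def)
    finally show "m powr (2 * (M + 1)) \<le> 1 + (A / \<tau>) powr p + l1_norm r y powr p" .
  qed simp
  finally show ?thesis by (simp add: A_def)
qed

text \<open>Rounding the arguments down to multiples of 1 / (n + 1) confines them to a countable
  set, on which every function is measurable; the Lipschitz bound makes the rounded values of
  \<open>g\<close> converge.\<close>

lemma lip_class_measurable:
  fixes Z :: "nat \<Rightarrow> 'a \<Rightarrow> real"
  assumes g: "g \<in> lip_class r M C" and MC: "0 \<le> M" "0 \<le> C"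
    and Z: "\<And>i. i < r \<Longrightarrow> Z i \<in> borel_measurable P"
  shows "(\<lambda>\<omega>. g (\<lambda>i\<in>{..<r}. Z i \<omega>)) \<in> borel_measurable P"
proof (rule borel_measurable_LIMSEQ_real)
  define Q where "Q n \<omega> = (\<lambda>i\<in>{..<r}. \<lfloor>real (Suc n) * Z i \<omega>\<rfloor>)" for n \<omega>
  define R where "R n a = (\<lambda>i\<in>{..<r}. real_of_int (a i) / real (Suc n))" for n and a :: "nat \<Rightarrow> int"
  let ?I = "{..<r} \<rightarrow>\<^sub>E (UNIV :: int set)"
  have I: "countable ?I" by (intro countable_PiE) auto
  show "(\<lambda>\<omega>. g (R n (Q n \<omega>))) \<in> borel_measurable P" for n
  proof (rule measurable_compose_countable'[OF _ _ I])
    show "Q n \<in> measurable P (count_space ?I)"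
      unfolding measurable_count_space_eq_countable[OF I]
    proof (intro conjI ballI)
      fix a assume a: "a \<in> ?I"
      have "Q n -` {a} \<inter> space P = {\<omega> \<in> space P. \<forall>i\<in>{..<r}. \<lfloor>real (Suc n) * Z i \<omega>\<rfloor> = a i}"
        using a unfolding Q_def by (auto simp: fun_eq_iff restrict_def PiE_iff extensional_def)
      also have "\<dots> \<in> sets P"
      proof (rule sets.sets_Collect_finite_All)
        fix i assume "i \<in> {..<r}"
        then have [measurable]: "Z i \<in> borel_measurable P" using Z by simp
        show "{\<omega> \<in> space P. \<lfloor>real (Suc n) * Z i \<omega>\<rfloor> = a i} \<in> sets P" by measurable
      qed simp
      finally show "Q n -` {a} \<inter> space P \<in> sets P" .
    qed (auto simp: Q_def)
  qed auto
  fix \<omega>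
  let ?z = "\<lambda>i\<in>{..<r}. Z i \<omega>"
  define B where "B = (3 * C * (1 + (real r + 1)) powr M)\<^sup>2 * (2 + l1_norm r ?z powr (2 * (M + 1)))"
  have sq: "(g ?z - g (R n (Q n \<omega>)))\<^sup>2 \<le> B * ((real r + 1) / real (Suc n))\<^sup>2" for n
  proof -
    \<comment> \<open>The rounding error is at most r / (n + 1); the extra 1 keeps the scale
      positive for \<open>r = 0\<close>. The scaled distance is then at most 1, which gives the 2 in
      \<open>B\<close>.\<close>
    let ?\<tau> = "(real r + 1) / real (Suc n)"
    have \<tau>: "0 < ?\<tau>" "?\<tau> \<le> real r + 1" by (auto simp: divide_le_eq field_simps)
    have "\<bar>?z i - R n (Q n \<omega>) i\<bar> \<le> 1 / real (Suc n)" if "i < r" for i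
    proof -
      have "\<bar>real (Suc n) * Z i \<omega> - real_of_int \<lfloor>real (Suc n) * Z i \<omega>\<rfloor>\<bar> \<le> 1" by linarith
      then have "\<bar>real (Suc n) * Z i \<omega> - real_of_int \<lfloor>real (Suc n) * Z i \<omega>\<rfloor>\<bar> / real (Suc n) \<le> 1 / real (Suc n)"
        by (intro divide_right_mono) auto
      also have "\<bar>real (Suc n) * Z i \<omega> - real_of_int \<lfloor>real (Suc n) * Z i \<omega>\<rfloor>\<bar> / real (Suc n) =
          \<bar>(real (Suc n) * Z i \<omega> - real_of_int \<lfloor>real (Suc n) * Z i \<omega>\<rfloor>) / real (Suc n)\<bar>" by simp
      finally show ?thesis using that by (simp add: R_def Q_def diff_divide_distrib)
    qed
    then have "l1_norm r (\<lambda>i. ?z i - R n (Q n \<omega>) i) \<le> (\<Sum>i<r. 1 / real (Suc n))"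
      unfolding l1_norm_def by (intro sum_mono) auto
    also have "\<dots> \<le> ?\<tau>" by (simp add: divide_right_mono)
    finally have "l1_norm r (\<lambda>i. ?z i - R n (Q n \<omega>) i) / ?\<tau> \<le> 1"
      using \<tau>(1) by (subst divide_le_eq_1_pos) auto
    then have A: "(l1_norm r (\<lambda>i. ?z i - R n (Q n \<omega>) i) / ?\<tau>) powr (2 * (M + 1)) \<le> 1"
      using l1_norm_nonneg MC \<tau>(1) by (intro powr_le1 divide_nonneg_pos) auto
    have "(g ?z - g (R n (Q n \<omega>)))\<^sup>2 \<le> (3 * C * (1 + (real r + 1)) powr M)\<^sup>2 * ?\<tau>\<^sup>2 *
        (1 + (l1_norm r (\<lambda>i. ?z i - R n (Q n \<omega>) i) / ?\<tau>) powr (2 * (M + 1)) + l1_norm r ?z powr (2 * (M + 1)))"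
      by (rule lip_class_square_le[OF g _ _ \<tau> MC order_refl]) (auto simp: R_def)
    also have "\<dots> \<le> (3 * C * (1 + (real r + 1)) powr M)\<^sup>2 * ?\<tau>\<^sup>2 * (2 + l1_norm r ?z powr (2 * (M + 1)))"
      using A by (intro mult_left_mono) auto
    finally show ?thesis by (simp add: B_def mult_ac)
  qed
  have t0: "(\<lambda>n. (real r + 1) / real (Suc n)) \<longlonglongrightarrow> 0"
    using tendsto_mult_right_zero[OF LIMSEQ_inverse_real_of_nat, of "real r + 1"] by (simp add: divide_inverse)
  have "(\<lambda>n. (g ?z - g (R n (Q n \<omega>)))\<^sup>2) \<longlonglongrightarrow> 0"
  proof (rule Lim_null_comparison)
    show "(\<lambda>n. B * ((real r + 1) / real (Suc n))\<^sup>2) \<longlonglongrightarrow> 0"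
      using tendsto_mult[OF tendsto_const tendsto_power[OF t0, of 2], of B] by simp
  qed (use sq in auto)
  then have "(\<lambda>n. sqrt ((g ?z - g (R n (Q n \<omega>)))\<^sup>2)) \<longlonglongrightarrow> 0"
    using tendsto_real_sqrt by fastforce
  then have "(\<lambda>n. g ?z - g (R n (Q n \<omega>))) \<longlonglongrightarrow> 0" by (simp add: tendsto_rabs_zero_iff)
  then have "(\<lambda>n. g ?z - (g ?z - g (R n (Q n \<omega>)))) \<longlonglongrightarrow> g ?z - 0" by (intro tendsto_diff tendsto_const)
  then show "(\<lambda>n. g (R n (Q n \<omega>))) \<longlonglongrightarrow> g ?z" by simp
qed

text \<open>The root comes from the expectation of the bracket in
  \<open>lip_class_square_le\<close>: by \<open>sum_powr_le\<close> each \<open>l1_norm\<close> to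
  the power \<open>p\<close> costs \<open>real r powr p\<close> times a sum of \<open>r\<close>
  moments, normalised to 1 for the difference and at most \<open>c powr p\<close> for
  \<open>Z\<close>.\<close>

definition lip_const :: "nat \<Rightarrow> real \<Rightarrow> real \<Rightarrow> real \<Rightarrow> real \<Rightarrow> real \<Rightarrow> real" where
  "lip_const r M C p T c = 3 * C * (1 + T) powr M * sqrt (1 + real r powr p * real r + real r powr p * (real r * c powr p))"

lemma lip_const_nonneg: "0 \<le> C \<Longrightarrow> 0 \<le> lip_const r M C p T c"
  by (simp add: lip_const_def)

text \<open>The scale \<tau> is the Lp bound of \<open>Z i - Z' i\<close>, so the scaled differences
  have p-th moment at most 1 and the result is linear in \<tau>. Moments of \<open>Z'\<close> are
  controlled through \<open>Z\<close> and the difference.\<close>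

lemma (in prob_space) lip_class_L2_bound:
  fixes Z Z' :: "nat \<Rightarrow> 'a \<Rightarrow> real"
  assumes g: "g \<in> lip_class r L C" and LC: "0 \<le> L" "0 \<le> C" and p: "2 * (L + 1) \<le> p"
    and Z: "\<And>i. i < r \<Longrightarrow> Z i \<in> borel_measurable M" "\<And>i. i < r \<Longrightarrow> Z' i \<in> borel_measurable M"
    and \<tau>: "0 < \<tau>" "\<tau> \<le> T"
    and c: "\<And>i. i < r \<Longrightarrow> Lp_le M p (Z i) c"
    and d: "\<And>i. i < r \<Longrightarrow> Lp_le M p (\<lambda>\<omega>. Z i \<omega> - Z' i \<omega>) \<tau>"
  shows "(\<lambda>\<omega>. g (\<lambda>i\<in>{..<r}. Z i \<omega>) - g (\<lambda>i\<in>{..<r}. Z' i \<omega>)) \<in> L2 M"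
    and "norm2 M (\<lambda>\<omega>. g (\<lambda>i\<in>{..<r}. Z i \<omega>) - g (\<lambda>i\<in>{..<r}. Z' i \<omega>)) \<le> lip_const r L C p T c * \<tau>"
proof -
  let ?D = "\<lambda>\<omega>. g (\<lambda>i\<in>{..<r}. Z i \<omega>) - g (\<lambda>i\<in>{..<r}. Z' i \<omega>)"
  define k where "k = (3 * C * (1 + T) powr L)\<^sup>2 * \<tau>\<^sup>2"
  define B where "B \<omega> = k * (1 + real r powr p * (\<Sum>i<r. (\<bar>Z i \<omega> - Z' i \<omega>\<bar> powr p) / \<tau> powr p) +
      real r powr p * (\<Sum>i<r. \<bar>Z i \<omega>\<bar> powr p))" for \<omega>
  have "0 < 2 * (L + 1)" using LC by simp
  then have p0: "0 < p" using p by (rule less_le_trans)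
  have D: "?D \<in> borel_measurable M"
    by (intro borel_measurable_diff lip_class_measurable[OF g LC] Z)
  have le: "(?D \<omega>)\<^sup>2 \<le> B \<omega>" for \<omega>
  proof -
    let ?y = "\<lambda>i\<in>{..<r}. Z i \<omega>" and ?y' = "\<lambda>i\<in>{..<r}. Z' i \<omega>"
    have "(?D \<omega>)\<^sup>2 \<le> k * (1 + (l1_norm r (\<lambda>i. ?y i - ?y' i) / \<tau>) powr p + l1_norm r ?y powr p)"
      unfolding k_def by (rule lip_class_square_le[OF g _ _ \<tau> LC p]) auto
    also have "\<dots> \<le> B \<omega>"
      unfolding B_def
    proof (intro mult_left_mono add_mono order_refl)
      have "(l1_norm r (\<lambda>i. ?y i - ?y' i) / \<tau>) powr p = (\<Sum>i<r. \<bar>Z i \<omega> - Z' i \<omega>\<bar> / \<tau>) powr p"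
        by (simp add: l1_norm_def sum_divide_distrib)
      also have "\<dots> \<le> real r powr p * (\<Sum>i<r. (\<bar>Z i \<omega> - Z' i \<omega>\<bar> / \<tau>) powr p)"
        using \<tau> p0 by (intro sum_powr_le) auto
      also have "(\<Sum>i<r. (\<bar>Z i \<omega> - Z' i \<omega>\<bar> / \<tau>) powr p) = (\<Sum>i<r. (\<bar>Z i \<omega> - Z' i \<omega>\<bar> powr p) / \<tau> powr p)"
        using \<tau> by (intro sum.cong) (auto simp: powr_divide)
      finally show "(l1_norm r (\<lambda>i. ?y i - ?y' i) / \<tau>) powr p \<le>
        real r powr p * (\<Sum>i<r. (\<bar>Z i \<omega> - Z' i \<omega>\<bar> powr p) / \<tau> powr p)" .
      have "l1_norm r ?y powr p = (\<Sum>i<r. \<bar>Z i \<omega>\<bar>) powr p" by (simp add: l1_norm_def)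
      also have "\<dots> \<le> real r powr p * (\<Sum>i<r. \<bar>Z i \<omega>\<bar> powr p)"
        using p0 by (intro sum_powr_le) auto
      finally show "l1_norm r ?y powr p \<le> real r powr p * (\<Sum>i<r. \<bar>Z i \<omega>\<bar> powr p)" .
    qed (simp add: k_def)
    finally show ?thesis .
  qed
  have i1: "integrable M (\<lambda>\<omega>. (\<bar>Z i \<omega> - Z' i \<omega>\<bar> powr p) / \<tau> powr p)"
    "expectation (\<lambda>\<omega>. (\<bar>Z i \<omega> - Z' i \<omega>\<bar> powr p) / \<tau> powr p) \<le> 1" if "i < r" for i
    using d[OF that] \<tau> by (auto simp: Lp_le_def divide_le_eq)
  have i2: "integrable M (\<lambda>\<omega>. \<bar>Z i \<omega>\<bar> powr p)" "expectation (\<lambda>\<omega>. \<bar>Z i \<omega>\<bar> powr p) \<le> c powr p" if "i < r" for i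
    using c[OF that] by (auto simp: Lp_le_def)
  have B: "integrable M B"
    unfolding B_def[abs_def] using i1(1) i2(1) by (intro integrable_mult_right Bochner_Integration.integrable_add Bochner_Integration.integrable_sum) auto
  show L2: "?D \<in> L2 M"
  proof -
    have "integrable M (\<lambda>\<omega>. (?D \<omega>)\<^sup>2)"
      by (rule Bochner_Integration.integrable_bound[OF B borel_measurable_power[OF D]])
        (use le in \<open>auto intro!: AE_I2 intro: order_trans[OF _ abs_ge_self]\<close>)
    then show ?thesis using D by (simp add: L2_def)
  qed
  have "(norm2 M ?D)\<^sup>2 \<le> expectation B"
    unfolding norm2_square by (intro integral_mono L2_square_integrable[OF L2] B le)
  also have "\<dots> = k * (1 + real r powr p * (\<Sum>i<r. expectation (\<lambda>\<omega>. (\<bar>Z i \<omega> - Z' i \<omega>\<bar> powr p) / \<tau> powr p)) +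
      real r powr p * (\<Sum>i<r. expectation (\<lambda>\<omega>. \<bar>Z i \<omega>\<bar> powr p)))"
  proof -
    define F1 where "F1 \<omega> = (\<Sum>i<r. (\<bar>Z i \<omega> - Z' i \<omega>\<bar> powr p) / \<tau> powr p)" for \<omega>
    define F2 where "F2 \<omega> = (\<Sum>i<r. \<bar>Z i \<omega>\<bar> powr p)" for \<omega>
    have F1: "integrable M F1" "expectation F1 = (\<Sum>i<r. expectation (\<lambda>\<omega>. (\<bar>Z i \<omega> - Z' i \<omega>\<bar> powr p) / \<tau> powr p))"
      unfolding F1_def[abs_def] by (rule Bochner_Integration.integrable_sum Bochner_Integration.integral_sum; use i1(1) in simp)+
    have F2: "integrable M F2" "expectation F2 = (\<Sum>i<r. expectation (\<lambda>\<omega>. \<bar>Z i \<omega>\<bar> powr p))"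
      unfolding F2_def[abs_def] by (rule Bochner_Integration.integrable_sum Bochner_Integration.integral_sum; use i2(1) in simp)+
    have "expectation (\<lambda>\<omega>. k * (1 + real r powr p * F1 \<omega> + real r powr p * F2 \<omega>)) =
        k * (1 + real r powr p * expectation F1 + real r powr p * expectation F2)"
      using F1(1) F2(1) by (simp add: prob_space)
    then show ?thesis unfolding F1(2) F2(2) by (simp only: B_def[abs_def] F1_def F2_def)
  qed
  also have "\<dots> \<le> k * (1 + real r powr p * (\<Sum>i<r. 1) + real r powr p * (\<Sum>i<r. c powr p))"
    using i1(2) i2(2) by (intro mult_left_mono add_mono sum_mono order_refl) (auto simp: k_def)
  also have "\<dots> = (lip_const r L C p T c * \<tau>)\<^sup>2"
    by (simp add: lip_const_def k_def power_mult_distrib mult_ac)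
  finally show "norm2 M ?D \<le> lip_const r L C p T c * \<tau>"
    by (rule power2_le_imp_le) (use LC \<tau> lip_const_nonneg in simp)
qed

section \<open>Lipschitz functionals of locally stationary processes\<close>

text \<open>The moment order \<open>q * (L + 1)\<close> is at least \<open>2 * (L + 1)\<close>, so
  the functional is square integrable although it grows like the power L + 1 of the lagged vector.
  Its L2, influence, Hoelder and approximation bounds are \<open>lip_class_L2_bound\<close> with
  four choices of \<tau>.\<close>

lemma (in prob_space) lip_local_clt:
  fixes X :: "int \<Rightarrow> nat \<Rightarrow> 'a \<Rightarrow> real" and Xst :: "int \<Rightarrow> real \<Rightarrow> 'a \<Rightarrow> real"
  assumes X: "\<And>n t. t \<in> {1..int n} \<Longrightarrow> X t n \<in> borel_measurable M"
    and Xst: "\<And>t v. v \<in> {0..1} \<Longrightarrow> Xst t v \<in> borel_measurable M"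
    and inn: "innovations M E eps eps'" and K: "kernel_assumption K"
    and q: "2 \<le> q" and \<alpha>: "0 < \<alpha>"
    and b: "b \<longlonglongrightarrow> 0" "filterlim (\<lambda>n. real n * b n) at_top sequentially"
    and rate: "(\<lambda>n. sqrt (real n * b n) * real n powr (- \<alpha>)) \<longlonglongrightarrow> 0"
    and r: "1 \<le> r" and LC: "0 \<le> L" "0 \<le> C" and g: "g \<in> lip_class r L C"
    and S1: "assumption_S1 M X Xst (q * (L + 1)) \<alpha>"
    and M1: "assumption_M1 M E eps eps' Xst (q * (L + 1))"
    and u: "u \<in> {0<..<1}"
  shows "local_clt M K b u (\<lambda>t n \<omega>. g (Z_array X Xst r t n \<omega>)) (\<lambda>t \<omega>. g (Z_stat Xst r t u \<omega>))"
proof -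
  define p where "p = q * (L + 1)"
  have p2: "2 * (L + 1) \<le> p" unfolding p_def using q LC by (intro mult_right_mono) auto
  moreover have "2 \<le> 2 * (L + 1)" using LC by simp
  ultimately have p: "0 < p" "1 \<le> p" by linarith+
  define N where "N = distr M E (eps 1)"
  interpret N: prob_space N unfolding N_def by (rule prob_space_N[OF inn])
  interpret IN: prob_space "iid N :: (nat \<Rightarrow> 'b) measure" by (rule N.prob_space_iid)

  obtain H where H0: "\<forall>v\<in>{0..1}. H v \<in> borel_measurable (Pi\<^sub>M UNIV (\<lambda>_. E)) \<and>
          (\<forall>t. AE \<omega> in M. Xst t v \<omega> = H v (past eps t \<omega>))"
    and H3: "(\<Sum>k. SUP v\<in>{0..1}. dep_measure M eps eps' p (\<lambda>_. H v) k) < \<infinity>"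
    using M1 unfolding assumption_M1_def p_def[symmetric] by blast
  have H1: "H v \<in> borel_measurable (iid N)" if "v \<in> {0..1}" for v
    using H0 that unfolding N_def measurable_cong_sets[OF sets_iid_N[OF inn] refl] by blast
  have H2: "AE \<omega> in M. Xst t v \<omega> = H v (past eps t \<omega>)" if "v \<in> {0..1}" for t v
    using H0 that by blast
  have mp: "past eps t \<in> measurable M (iid N)" for t
    unfolding N_def by (rule measurable_past[OF inn])
  have mps: "past_star eps eps' k t \<in> measurable M (iid N)" for t k
    unfolding N_def by (rule measurable_past_star[OF inn])
  have Hp: "(\<lambda>\<omega>. H v (past eps t \<omega>)) \<in> borel_measurable M" if "v \<in> {0..1}" for v t
    by (rule measurable_compose[OF mp H1[OF that]])
  have Hps: "(\<lambda>\<omega>. H v (past_star eps eps' k t \<omega>)) \<in> borel_measurable M" if "v \<in> {0..1}" for v k t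
    by (rule measurable_compose[OF mps H1[OF that]])
  have Lp_past: "Lp_le M p (\<lambda>\<omega>. F (past eps t \<omega>)) c \<longleftrightarrow> Lp_le (iid N) p F c"
    if "F \<in> borel_measurable (iid N)" for F c t
    using Lp_le_distr[OF mp that, of t p c] law_eps[OF inn inj_past_index[OF inn], of t]
    unfolding N_def by (simp add: past_def[abs_def])

  obtain C1 where C1: "0 < C1"
    and S1a: "\<And>n t v v'. t \<in> {1..int n} \<Longrightarrow> v \<in> {0..1} \<Longrightarrow> v' \<in> {0..1} \<Longrightarrow>
      Lq_norm M p (\<lambda>\<omega>. Xst t v \<omega> - Xst t v' \<omega>) \<le> ennreal (C1 * \<bar>v - v'\<bar> powr \<alpha>)"
    and S1b: "\<And>n t. t \<in> {1..int n} \<Longrightarrow>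
      Lq_norm M p (\<lambda>\<omega>. X t n \<omega> - Xst t (real_of_int t / real n) \<omega>) \<le> ennreal (C1 * real n powr (- \<alpha>))"
    using S1 unfolding assumption_S1_def p_def[symmetric] by blast

  define D where "D k = (SUP v\<in>{0..1}. dep_measure M eps eps' p (\<lambda>_. H v) k)" for k
  define e where "e k = enn2real (D k)" for k
  have Dfin: "D k < top" for k
  proof -
    have "sum D {k} \<le> suminf D" by (intro sum_le_suminf) auto
    also have "\<dots> < top" using H3 by (simp add: D_def[abs_def])
    finally show ?thesis by simp
  qed
  have De: "ennreal (e k) = D k" for k using Dfin[of k] by (simp add: e_def)
  have e0: "0 \<le> e k" for k by (simp add: e_def)
  have e_sum: "summable e"
    by (rule summable_suminf_not_top) (use e0 H3 in \<open>auto simp: De D_def[abs_def]\<close>)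
  have e_le: "Lp_le M p (\<lambda>\<omega>. H v (past eps t \<omega>) - H v (past_star eps eps' k t \<omega>)) (e k)" if v: "v \<in> {0..1}" for v t k
  proof (rule Lp_leI[OF borel_measurable_diff[OF Hp[OF v] Hps[OF v]] p(1) e0])
    have "Lq_norm M p (\<lambda>\<omega>. H v (past eps t \<omega>) - H v (past_star eps eps' k t \<omega>)) \<le> dep_measure M eps eps' p (\<lambda>_. H v) k"
      unfolding dep_measure_def by (rule SUP_upper) simp
    also have "\<dots> \<le> ennreal (e k)" unfolding De D_def by (rule SUP_upper[OF v])
    finally show "Lq_norm M p (\<lambda>\<omega>. H v (past eps t \<omega>) - H v (past_star eps eps' k t \<omega>)) \<le> ennreal (e k)" .
  qed

  define c where "c = enn2real (SUP v\<in>{0..1}. Lq_norm M p (Xst 0 v))"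
  have c0: "0 \<le> c" by (simp add: c_def)
  have mom: "Lp_le (iid N) p (H v) c" if v: "v \<in> {0..1}" for v
  proof -
    have fin: "(SUP v\<in>{0..1}. Lq_norm M p (Xst 0 v)) < \<infinity>"
      using S1 unfolding assumption_S1_def p_def[symmetric] by blast
    have "Lq_norm M p (Xst 0 v) \<le> (SUP v\<in>{0..1}. Lq_norm M p (Xst 0 v))" by (rule SUP_upper[OF v])
    also have "\<dots> = ennreal c" using fin by (simp add: c_def)
    finally have "Lp_le M p (Xst 0 v) c" by (rule Lp_leI[OF Xst[OF v] p(1) c0])
    then have "Lp_le M p (\<lambda>\<omega>. H v (past eps 0 \<omega>)) c" by (rule Lp_le_cong_AE[OF _ Xst[OF v] Hp[OF v] H2[OF v]])
    then show ?thesis unfolding Lp_past[OF H1[OF v]] .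
  qed
  have hold: "Lp_le (iid N) p (\<lambda>x. H v x - H v' x) (C1 * \<bar>v - v'\<bar> powr \<alpha>)"
    if v: "v \<in> {0..1}" "v' \<in> {0..1}" for v v'
  proof -
    have m: "(\<lambda>x. H v x - H v' x) \<in> borel_measurable (iid N)"
      by (rule borel_measurable_diff[OF H1[OF v(1)] H1[OF v(2)]])
    \<comment> \<open>One time in one row is enough, because the law of \<open>past eps t\<close> is
      the same for all \<open>t\<close>.\<close>
    have "Lp_le M p (\<lambda>\<omega>. Xst 1 v \<omega> - Xst 1 v' \<omega>) (C1 * \<bar>v - v'\<bar> powr \<alpha>)"
      using C1 by (intro Lp_leI S1a[of 1 1] borel_measurable_diff Xst v p) auto
    then have "Lp_le M p (\<lambda>\<omega>. H v (past eps 1 \<omega>) - H v' (past eps 1 \<omega>)) (C1 * \<bar>v - v'\<bar> powr \<alpha>)"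
    proof (rule Lp_le_cong_AE)
      show "AE \<omega> in M. Xst 1 v \<omega> - Xst 1 v' \<omega> = H v (past eps 1 \<omega>) - H v' (past eps 1 \<omega>)"
        using H2[OF v(1), of 1] H2[OF v(2), of 1] by eventually_elim simp
    qed (intro borel_measurable_diff Xst Hp v)+
    then show ?thesis by (rule iffD1[OF Lp_past[OF m]])
  qed

  \<comment> \<open>The past at time t - i is the past at time t with its first \<open>i\<close>
    entries dropped.\<close>
  define G where "G v x = g (\<lambda>i\<in>{..<r}. H v (\<lambda>j. x (i + j)))" for v and x :: "nat \<Rightarrow> 'b"
  have Gm: "G v \<in> borel_measurable (iid N)" if "v \<in> {0..1}" for v
    unfolding G_def[abs_def] by (rule lip_class_measurable[OF g LC measurable_compose_reindex[OF H1[OF that]]])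
  have Gp: "G v (past eps t \<omega>) = g (\<lambda>i\<in>{..<r}. H v (past eps (t - int i) \<omega>))" for v t \<omega>
  proof -
    have "(\<lambda>j. past eps t \<omega> (i + j)) = past eps (t - int i) \<omega>" for i
      by (simp add: past_def fun_eq_iff diff_diff_eq)
    then show ?thesis by (simp add: G_def)
  qed
  have momp: "Lp_le M p (\<lambda>\<omega>. H v (past eps t \<omega>)) c" if "v \<in> {0..1}" for v t
    unfolding Lp_past[OF H1[OF that]] by (rule mom[OF that])

  have G_L2: "G v \<in> L2 (iid N)" if v: "v \<in> {0..1}" for v
  proof -
    have "(\<lambda>\<omega>. g (\<lambda>i\<in>{..<r}. H v (past eps (0 - int i) \<omega>)) - g (\<lambda>i\<in>{..<r}. 0)) \<in> L2 M"
    \<comment> \<open>Comparison with the zero vector, at which \<open>g\<close> is a constant;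
      \<open>c + 1\<close> instead of \<open>c\<close> keeps the scale positive.\<close>
    proof (rule lip_class_L2_bound(1)[OF g LC p2, where \<tau>="c + 1" and T="c + 1" and c=c])
      show "Lp_le M p (\<lambda>\<omega>. H v (past eps (0 - int i) \<omega>) - 0) (c + 1)" for i
        using Lp_le_mono[OF momp[OF v, of "0 - int i"] p(1) c0, of "c + 1"] by simp
      show "(\<lambda>\<omega>. H v (past eps (0 - int i) \<omega>)) \<in> borel_measurable M" for i by (rule Hp[OF v])
      show "Lp_le M p (\<lambda>\<omega>. H v (past eps (0 - int i) \<omega>)) c" for i by (rule momp[OF v])
      show "0 < c + 1" using c0 by simp
    qed simp_all
    from L2_add[OF this L2_const[of "g (\<lambda>i\<in>{..<r}. 0)"]]
    have "(\<lambda>\<omega>. G v (past eps 0 \<omega>)) \<in> L2 M" by (simp add: Gp)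
    then show ?thesis by (rule iffD1[OF L2_past[OF inn, folded N_def, OF Gm[OF v]]])
  qed

  \<comment> \<open>An innovation \<open>k\<close> steps back is \<open>k - i\<close> steps back for
    lag \<open>i\<close>, and lies in the future of that lag if \<open>k < i\<close>. The geometric
    term makes \<tau> strictly positive, as a scale has to be, and keeps it summable.\<close>
  define \<tau> where "\<tau> k = (\<Sum>i<r. if i \<le> k then e (k - i) else 0) + (1/2) ^ k" for k
  have \<tau>_sum: "summable \<tau>"
  proof -
    have "summable (\<lambda>k. if i \<le> k then e (k - i) else 0)" for i
      by (subst summable_iff_shift[of _ i, symmetric]) (simp add: e_sum)
    then show ?thesis
      unfolding \<tau>_def[abs_def] by (intro summable_add summable_sum summable_geometric) auto
  qed
  have \<tau>0: "0 < \<tau> k" for k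
    unfolding \<tau>_def using e0 by (intro add_nonneg_pos sum_nonneg) auto
  have \<tau>_le: "\<tau> k \<le> suminf \<tau>" for k
    using sum_inj_le_suminf[OF \<tau>_sum less_imp_le[OF \<tau>0], of "{k}" "\<lambda>i. i"] by simp
  have G_infl: "infl N (G v) k \<le> lip_const r L C p (suminf \<tau>) c * \<tau> k" if v: "v \<in> {0..1}" for v k
  proof -
    define Z' where "Z' i \<omega> = H v (if i \<le> k then past_star eps eps' (k - i) (0 - int i) \<omega> else past eps (0 - int i) \<omega>)" for i \<omega>
    have Gs: "G v (past_star eps eps' k 0 \<omega>) = g (\<lambda>i\<in>{..<r}. Z' i \<omega>)" for \<omega>
    proof -
      have "(\<lambda>j. past_star eps eps' k 0 \<omega> (i + j)) =
          (if i \<le> k then past_star eps eps' (k - i) (0 - int i) \<omega> else past eps (0 - int i) \<omega>)" for i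
        by (auto simp: past_star_def past_def fun_eq_iff of_nat_diff)
      then show ?thesis by (simp add: G_def Z'_def)
    qed
    have "norm2 M (\<lambda>\<omega>. g (\<lambda>i\<in>{..<r}. H v (past eps (0 - int i) \<omega>)) - g (\<lambda>i\<in>{..<r}. Z' i \<omega>)) \<le>
        lip_const r L C p (suminf \<tau>) c * \<tau> k"
    proof (rule lip_class_L2_bound(2)[OF g LC p2 _ _ \<tau>0 \<tau>_le])
      fix i assume i: "i < r"
      show "Z' i \<in> borel_measurable M"
        unfolding Z'_def[abs_def] using Hp[OF v] Hps[OF v] by (cases "i \<le> k") auto
      have "e (k - i) \<le> \<tau> k" if "i \<le> k"
      proof -
        have "e (k - i) \<le> (\<Sum>i<r. if i \<le> k then e (k - i) else 0)"
          using member_le_sum[of i "{..<r}" "\<lambda>i. if i \<le> k then e (k - i) else 0"] i that e0 by auto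
        then show ?thesis unfolding \<tau>_def using zero_le_power[of "1/2 :: real" k] by linarith
      qed
      then show "Lp_le M p (\<lambda>\<omega>. H v (past eps (0 - int i) \<omega>) - Z' i \<omega>) (\<tau> k)"
        unfolding Z'_def using Lp_le_mono[OF e_le[OF v, of "0 - int i" "k - i"] p(1) e0, of "\<tau> k"] p(1) \<tau>0[of k]
        by (cases "i \<le> k") (auto simp: Lp_le_def)
    qed (rule Hp[OF v], rule momp[OF v])
    then have "norm2 M (\<lambda>\<omega>. G v (past eps 0 \<omega>) - G v (past_star eps eps' k 0 \<omega>)) \<le>
        lip_const r L C p (suminf \<tau>) c * \<tau> k"
      by (simp only: Gp Gs)
    then show ?thesis unfolding norm2_past_star[OF inn, folded N_def, OF Gm[OF v]] .
  qed

  have G_holder: "norm2 (iid N) (\<lambda>x. G v x - G v' x) \<le> lip_const r L C p C1 c * C1 * \<bar>v - v'\<bar> powr \<alpha>"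
    if v: "v \<in> {0..1}" "v' \<in> {0..1}" for v v'
  proof (cases "v = v'")
    case False
    have Hm: "(\<lambda>x. H v (\<lambda>j. x (i + j))) \<in> borel_measurable (iid N)" if "v \<in> {0..1}" for v i
      by (rule measurable_compose_reindex[OF H1[OF that]])
    have "norm2 M (\<lambda>\<omega>. g (\<lambda>i\<in>{..<r}. H v (past eps (0 - int i) \<omega>)) - g (\<lambda>i\<in>{..<r}. H v' (past eps (0 - int i) \<omega>))) \<le>
        lip_const r L C p C1 c * (C1 * \<bar>v - v'\<bar> powr \<alpha>)"
    proof (rule lip_class_L2_bound(2)[OF g LC p2])
      show "0 < C1 * \<bar>v - v'\<bar> powr \<alpha>" using False C1 by simp
      have "\<bar>v - v'\<bar> powr \<alpha> \<le> 1" using v \<alpha> by (intro powr_le1) auto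
      then show "C1 * \<bar>v - v'\<bar> powr \<alpha> \<le> C1" using C1 by simp
      show "Lp_le M p (\<lambda>\<omega>. H v (past eps (0 - int i) \<omega>) - H v' (past eps (0 - int i) \<omega>)) (C1 * \<bar>v - v'\<bar> powr \<alpha>)" for i
        by (rule iffD2[OF Lp_past[OF borel_measurable_diff[OF H1[OF v(1)] H1[OF v(2)]]] hold[OF v]])
    qed (rule Hp[OF v(1)], rule Hp[OF v(2)], rule momp[OF v(1)])
    then have "norm2 M (\<lambda>\<omega>. G v (past eps 0 \<omega>) - G v' (past eps 0 \<omega>)) \<le> lip_const r L C p C1 c * (C1 * \<bar>v - v'\<bar> powr \<alpha>)"
      by (simp only: Gp)
    moreover have "norm2 M (\<lambda>\<omega>. G v (past eps 0 \<omega>) - G v' (past eps 0 \<omega>)) = norm2 (iid N) (\<lambda>x. G v x - G v' x)"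
      by (rule norm2_past[OF inn, folded N_def, OF borel_measurable_diff[OF Gm[OF v(1)] Gm[OF v(2)]]])
    ultimately show ?thesis by (simp add: mult.assoc)
  qed simp

  \<comment> \<open>\<open>C1\<close> is for replacing the array by the stationary process at its
    own time, C1 r^\<alpha> for moving the time (t - i)/n to t/n, over a distance of at most r/n;
    the 4 comes from \<open>Lp_le_add\<close>.\<close>
  define T where "T = 4 * (C1 + C1 * real r powr \<alpha>)"
  have T: "0 < T" unfolding T_def using C1 by (intro mult_pos_pos add_pos_nonneg) auto
  have approx: "(\<lambda>\<omega>. g (Z_array X Xst r t n \<omega>) - G (real_of_int t / real n) (past eps t \<omega>)) \<in> L2 M"
    "norm2 M (\<lambda>\<omega>. g (Z_array X Xst r t n \<omega>) - G (real_of_int t / real n) (past eps t \<omega>)) \<le>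
      lip_const r L C p T c * T * real n powr (- \<alpha>)"
    if t: "int r \<le> t" "t \<in> {1..int n}" for n t
  proof -
    define v where "v = real_of_int t / real n"
    have n: "1 \<le> n" using t by auto
    have v: "v \<in> {0..1}" using t n by (auto simp: v_def divide_le_eq)
    have tn: "real n powr (- \<alpha>) \<le> 1"
      using n \<alpha> powr_mono[of "- \<alpha>" 0 "real n"] by simp
    have Za: "Z_array X Xst r t n \<omega> = (\<lambda>i\<in>{..<r}. X (t - int i) n \<omega>)" for \<omega>
      using t by (auto simp: Z_array_def fun_eq_iff restrict_def Let_def)
    have s: "t - int i \<in> {1..int n}" if "i < r" for i using that t by auto
    have Xm: "X (t - int i) n \<in> borel_measurable M" if "i < r" for i by (rule X[OF s[OF that]])
    have d: "Lp_le M p (\<lambda>\<omega>. H v (past eps (t - int i) \<omega>) - X (t - int i) n \<omega>) (T * real n powr (- \<alpha>))" if i: "i < r" for i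
    proof -
      define w where "w = real_of_int (t - int i) / real n"
      have w: "w \<in> {0..1}" using s[OF i] n by (auto simp: w_def divide_le_eq)
      have vw: "\<bar>v - w\<bar> \<le> real r / real n"
        using i n by (simp add: v_def w_def diff_divide_distrib divide_right_mono)
      have "C1 * \<bar>v - w\<bar> powr \<alpha> \<le> C1 * (real r / real n) powr \<alpha>"
        using C1 vw \<alpha> by (intro mult_left_mono powr_mono2) auto
      also have "\<dots> = C1 * real r powr \<alpha> * real n powr (- \<alpha>)"
        using n by (simp add: powr_divide powr_minus field_simps)
      finally have vw': "C1 * \<bar>v - w\<bar> powr \<alpha> \<le> C1 * real r powr \<alpha> * real n powr (- \<alpha>)" .
      have 1: "Lp_le M p (\<lambda>\<omega>. X (t - int i) n \<omega> - Xst (t - int i) w \<omega>) (C1 * real n powr (- \<alpha>))"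
        unfolding w_def using C1 by (intro Lp_leI S1b[OF s[OF i]] borel_measurable_diff Xm[OF i] Xst w[unfolded w_def] p) auto
      have 2: "Lp_le M p (\<lambda>\<omega>. Xst (t - int i) w \<omega> - Xst (t - int i) v \<omega>) (C1 * real r powr \<alpha> * real n powr (- \<alpha>))"
      proof (rule Lp_le_mono[OF _ p(1) _ vw'])
        show "Lp_le M p (\<lambda>\<omega>. Xst (t - int i) w \<omega> - Xst (t - int i) v \<omega>) (C1 * \<bar>v - w\<bar> powr \<alpha>)"
          unfolding abs_minus_commute[of v w]
          using C1 by (intro Lp_leI S1a[OF s[OF i]] borel_measurable_diff Xst v w p) auto
      qed (use C1 in simp)
      have "Lp_le M p (\<lambda>\<omega>. (X (t - int i) n \<omega> - Xst (t - int i) w \<omega>) + (Xst (t - int i) w \<omega> - Xst (t - int i) v \<omega>))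
          (4 * (C1 * real n powr (- \<alpha>) + C1 * real r powr \<alpha> * real n powr (- \<alpha>)))"
        using C1 by (intro Lp_le_add 1 2 p borel_measurable_diff Xm[OF i] Xst v w) auto
      then have 3: "Lp_le M p (\<lambda>\<omega>. X (t - int i) n \<omega> - Xst (t - int i) v \<omega>) (T * real n powr (- \<alpha>))"
        by (simp add: T_def algebra_simps)
      then have 4: "Lp_le M p (\<lambda>\<omega>. Xst (t - int i) v \<omega> - X (t - int i) n \<omega>) (T * real n powr (- \<alpha>))"
        by (simp add: Lp_le_def abs_minus_commute)
      show ?thesis
      proof (rule Lp_le_cong_AE[OF 4])
        show "AE \<omega> in M. Xst (t - int i) v \<omega> - X (t - int i) n \<omega> = H v (past eps (t - int i) \<omega>) - X (t - int i) n \<omega>"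
          using H2[OF v, of "t - int i"] by eventually_elim simp
      qed (intro borel_measurable_diff Xm[OF i] Xst Hp v)+
    qed
    have \<tau>': "0 < T * real n powr (- \<alpha>)" "T * real n powr (- \<alpha>) \<le> T"
      using T n tn by auto
    have *: "(\<lambda>\<omega>. G v (past eps t \<omega>) - g (Z_array X Xst r t n \<omega>)) =
        (\<lambda>\<omega>. g (\<lambda>i\<in>{..<r}. H v (past eps (t - int i) \<omega>)) - g (\<lambda>i\<in>{..<r}. X (t - int i) n \<omega>))"
      by (simp only: Gp Za)
    have B: "(\<lambda>\<omega>. G v (past eps t \<omega>) - g (Z_array X Xst r t n \<omega>)) \<in> L2 M"
      "norm2 M (\<lambda>\<omega>. G v (past eps t \<omega>) - g (Z_array X Xst r t n \<omega>)) \<le> lip_const r L C p T c * (T * real n powr (- \<alpha>))"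
      unfolding * by (rule lip_class_L2_bound[OF g LC p2 Hp[OF v] Xm \<tau>' momp[OF v] d]; assumption)+
    show "(\<lambda>\<omega>. g (Z_array X Xst r t n \<omega>) - G (real_of_int t / real n) (past eps t \<omega>)) \<in> L2 M"
      using L2_cmult[OF B(1), of "-1"] by (simp add: v_def)
    show "norm2 M (\<lambda>\<omega>. g (Z_array X Xst r t n \<omega>) - G (real_of_int t / real n) (past eps t \<omega>)) \<le>
      lip_const r L C p T c * T * real n powr (- \<alpha>)"
      using B(2) by (simp add: v_def norm2_def power2_commute mult.assoc)
  qed

  define C2 where "C2 = max (lip_const r L C p C1 c * C1) (lip_const r L C p T c * T)"
  have "causal_array M b u K E eps eps' N (\<lambda>t n \<omega>. g (Z_array X Xst r t n \<omega>)) (\<lambda>t \<omega>. g (Z_stat Xst r t u \<omega>))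
      G (\<lambda>k. lip_const r L C p (suminf \<tau>) c * \<tau> k) \<alpha> C2 r"
  proof
    show "b \<longlonglongrightarrow> 0" "filterlim (\<lambda>n. real n * b n) at_top sequentially" "kernel_assumption K" "0 < u" "u < 1"
      "innovations M E eps eps'" "N = distr M E (eps 1)" "0 < \<alpha>"
      "(\<lambda>n. sqrt (real n * b n) * real n powr - \<alpha>) \<longlonglongrightarrow> 0"
      using b K u inn \<alpha> rate by (auto simp: N_def)
    show "0 \<le> C2" unfolding C2_def using lip_const_nonneg[OF LC(2), of r L p C1 c] C1 by (simp add: le_max_iff_disj)
    show "(\<lambda>\<omega>. g (Z_array X Xst r t n \<omega>)) \<in> borel_measurable M" if "t \<in> {1..int n}" for n t
    proof -
      have "(\<lambda>\<omega>. if t - int i \<le> 0 then Xst (t - int i) 0 \<omega> else X (t - int i) n \<omega>) \<in> borel_measurable M" for i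
        using Xst[of 0 "t - int i"] X[of "t - int i" n] that by (cases "t - int i \<le> 0") auto
      from lip_class_measurable[OF g LC this] show ?thesis by (simp add: Z_array_def Let_def)
    qed
    show "G v \<in> L2 (iid N)" "infl N (G v) k \<le> lip_const r L C p (suminf \<tau>) c * \<tau> k" if "v \<in> {0..1}" for v k
      by (rule G_L2[OF that] G_infl[OF that])+
    show "summable (\<lambda>k. lip_const r L C p (suminf \<tau>) c * \<tau> k)" by (rule summable_mult[OF \<tau>_sum])
    show "norm2 (iid N) (\<lambda>x. G v x - G v' x) \<le> C2 * \<bar>v - v'\<bar> powr \<alpha>" if "v \<in> {0..1}" "v' \<in> {0..1}" for v v'
      by (rule order_trans[OF G_holder[OF that]]) (auto simp: C2_def intro!: mult_right_mono)
    show "(\<lambda>\<omega>. g (Z_array X Xst r t n \<omega>) - G (real_of_int t / real n) (past eps t \<omega>)) \<in> L2 M"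
      "norm2 M (\<lambda>\<omega>. g (Z_array X Xst r t n \<omega>) - G (real_of_int t / real n) (past eps t \<omega>)) \<le> C2 * real n powr (- \<alpha>)"
      if "int r \<le> t" "t \<in> {1..int n}" for n t
      by (rule approx(1)[OF that], rule order_trans[OF approx(2)[OF that]]) (auto simp: C2_def intro!: mult_right_mono)
    have u': "u \<in> {0..1}" using u by simp
    show "(\<lambda>\<omega>. g (Z_stat Xst r t u \<omega>)) \<in> borel_measurable M" for t
      unfolding Z_stat_def by (rule lip_class_measurable[OF g LC Xst[OF u']])
    show "AE \<omega> in M. g (Z_stat Xst r t u \<omega>) = G u (past eps t \<omega>)" for t
    proof -
      have "AE \<omega> in M. \<forall>i\<in>{..<r}. Xst (t - int i) u \<omega> = H u (past eps (t - int i) \<omega>)"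
        by (intro AE_finite_allI H2 u') simp
      then show ?thesis
      proof eventually_elim
        case (elim \<omega>)
        then have "Z_stat Xst r t u \<omega> = (\<lambda>i\<in>{..<r}. H u (past eps (t - int i) \<omega>))"
          by (auto simp: Z_stat_def fun_eq_iff restrict_def)
        then show ?case by (simp add: Gp)
      qed
    qed
  qed
  then show ?thesis by (rule causal_array.local_clt)
qed

text \<open>With M = 0 the convention \<open>nonneg_pow x 0 = 1\<close> makes the denominator 3 |y -
  y'|, so C = 1 is generous. The moment order q (M + 1) is then just \<open>q\<close>, and the claim
  on \<open>X\<close> becomes a case of the claim on \<open>g\<close>.\<close>

lemma projection_lip_class: "(\<lambda>y. y 0) \<in> lip_class 1 0 1"
  by (auto simp: lip_class_def l1_norm_def nonneg_pow_def divide_le_eq)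

theorem theorem2p10:
  fixes P :: "'a measure" and E :: "'e measure"
    and X :: "int \<Rightarrow> nat \<Rightarrow> 'a \<Rightarrow> real"
    and Xst :: "int \<Rightarrow> real \<Rightarrow> 'a \<Rightarrow> real"
    and eps eps' :: "int \<Rightarrow> 'a \<Rightarrow> 'e"
    and K :: "real \<Rightarrow> real" and b :: "nat \<Rightarrow> real"
    and q \<alpha> :: real
  assumes "prob_space P"
    and "\<And>n t. t \<in> {1..int n} \<Longrightarrow> X t n \<in> borel_measurable P"
    and "\<And>t u. u \<in> {0..1} \<Longrightarrow> Xst t u \<in> borel_measurable P"
    and "\<And>u. u \<in> {0..1} \<Longrightarrow> stationary_process P (\<lambda>t. Xst t u)"
    and "\<And>u. u \<in> {0..1} \<Longrightarrow> ergodic_process P (\<lambda>t. Xst t u)"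
    and "innovations P E eps eps'"
    and "kernel_assumption K"
    and "2 \<le> q" and "0 < \<alpha>" and "\<alpha> \<le> 1"
    and "b \<longlonglongrightarrow> 0"
    and "filterlim (\<lambda>n. real n * b n) at_top sequentially"
    and "(\<lambda>n. sqrt (real n * b n) * real n powr (- \<alpha>)) \<longlonglongrightarrow> 0"
  shows "(assumption_S1 P X Xst q \<alpha> \<and> assumption_S2 P Xst q \<and>
          assumption_M1 P E eps eps' Xst q \<longrightarrow>
            (\<forall>u\<in>{0<..<1}. local_clt P K b u X (\<lambda>t. Xst t u))) \<and>
         (\<forall>r M C g.
            1 \<le> r \<and> 0 \<le> M \<and> 0 \<le> C \<and> g \<in> lip_class r M C \<and>
            assumption_S1 P X Xst (q * (M + 1)) \<alpha> \<and> assumption_S2 P Xst (q * (M + 1)) \<and>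
            assumption_M1 P E eps eps' Xst (q * (M + 1)) \<longrightarrow>
              (\<forall>u\<in>{0<..<1}. local_clt P K b u
                 (\<lambda>t n \<omega>. g (Z_array X Xst r t n \<omega>))
                 (\<lambda>t \<omega>. g (Z_stat Xst r t u \<omega>))))"
proof -
  interpret P: prob_space P by fact
  have lip: "local_clt P K b u (\<lambda>t n \<omega>. g (Z_array X Xst r t n \<omega>)) (\<lambda>t \<omega>. g (Z_stat Xst r t u \<omega>))"
    if "1 \<le> r" "0 \<le> M" "0 \<le> C" "g \<in> lip_class r M C" "assumption_S1 P X Xst (q * (M + 1)) \<alpha>"
      "assumption_M1 P E eps eps' Xst (q * (M + 1))" "u \<in> {0<..<1}" for r M C g u
    by (rule P.lip_local_clt[OF _ _ assms(6-9,11-13) that]; rule assms; assumption)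
  have "local_clt P K b u X (\<lambda>t. Xst t u)"
    if S1: "assumption_S1 P X Xst q \<alpha>" and M1: "assumption_M1 P E eps eps' Xst q" and u: "u \<in> {0<..<1}" for u
  proof -
    let ?W = "\<lambda>t n \<omega>. Z_array X Xst 1 t n \<omega> 0"
    have "(\<lambda>t \<omega>. Z_stat Xst 1 t u \<omega> 0) = (\<lambda>t. Xst t u)"
      by (simp add: Z_stat_def)
    with lip[OF _ _ _ projection_lip_class _ _ u] S1 M1
    have W: "local_clt P K b u ?W (\<lambda>t. Xst t u)" by simp
    \<comment> \<open>For t <= 0 the convention in \<open>Z_array\<close> separates the two arrays,
      but \<open>kernel_sum\<close> reads only times in {1..n}.\<close>
    have "Z_array X Xst 1 t n \<omega> 0 = X t n \<omega>" if "t \<in> {1..int n}" for t n \<omega>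
      using that by (simp add: Z_array_def)
    then have "kernel_sum P K b u ?W = kernel_sum P K b u X"
      unfolding kernel_sum_def by (intro ext arg_cong2[where f="(*)"] sum.cong refl) simp
    with W show ?thesis unfolding local_clt_def by (simp only:)
  qed
  then show ?thesis using lip by blast
qed

end
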